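(* Let $\mathcal M,\mathcal N$ be connected, compact, oriented smooth $2$-dimensional Riemannian manifolds (possibly with Lipschitz boundaries) with $V_{\mathcal N}\le V_{\mathcal M}$. (a) Let $\phi\in\operatorname{Lip}_+^{\mathrm{inj}}(\mathcal M,\mathcal N)$ with $V_{\phi(\mathcal M)}/V_{\mathcal M}\le1/4$. Then $$\frac1{V_{\mathcal M}}\int_{\mathcal M}\operatorname{dist}^2(d\phi,K)\ \le\ E_2(\phi)-F\left(\frac{V_{\phi(\mathcal M)}}{V_{\mathcal M}}\right)\ \le\ \frac2{V_{\mathcal M}}\int_{\mathcal M}\operatorname{dist}^2(d\phi,K).$$ (b) If $V_{\mathcal N}/V_{\mathcal M}\le1/4$, then for every $\phi\in\operatorname{Lip}_+^{\mathrm{inj}}(\mathcal M,\mathcal N)$ $$\frac1{V_{\mathcal M}}\int_{\mathcal M}\operatorname{dist}^2(d\phi,K)+\frac{2(V_{\mathcal N}-V_{\phi(\mathcal M)})}{V_{\mathcal M}}\ \le\ E_2(\phi)-F\left(\frac{V_{\mathcal N}}{V_{\mathcal M}}\right)\ \le\ \frac2{V_{\mathcal M}}\int_{\mathcal M}\operatorname{dist}^2(d\phi,K)+\frac{2(V_{\mathcal N}-V_{\phi(\mathcal M)})}{V_{\mathcal M}}.$$ Thus, for a sequence $\phi_n\in\operatorname{Lip}_+^{\mathrm{inj}}(\mathcal M,\mathcal N)$, $\lim_{n\to\infty}E_2(\phi_n)=F(V_{\mathcal N}/V_{\mathcal M})$ if and only if $V_{\phi_n(\mathcal M)}\to V_{\mathcal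 N}$ and $\operatorname{dist}(d\phi_n,K)\to0$ in $L^2$.
   Context: Write $\mathfrak g,\mathfrak h$ for the metrics of $\mathcal M,\mathcal N$; $V_X$ is the (Riemannian) area of $X$. $\operatorname{Lip}_+^{\mathrm{inj}}(\mathcal M,\mathcal N)$ is the set of Lipschitz maps $\phi:\mathcal M\to\mathcal N$ whose signed Jacobian $J\phi$ (determinant of $d\phi$ with respect to metrics and orientations) is $\ge0$ a.e. and with $|\phi^{-1}(q)|\le1$ for a.e. $q\in\mathcal N$. $\operatorname{SO}(\mathfrak g,\phi^*\mathfrak h)_x$ is the set of orientation-preserving linear isometries $T_x\mathcal M\to T_{\phi(x)}\mathcal N$; distances in $\operatorname{Hom}(T_x\mathcal M,T_{\phi(x)}\mathcal N)$ use the inner product induced by $\mathfrak g,\mathfrak h$. $E_2(\phi)=\frac1{V_{\mathcal M}}\int_{\mathcal M}\operatorname{dist}^2(d\phi,\operatorname{SO}(\mathfrak g,\phi^*\mathfrak h))$, with integration against the area form. $K$ is the set of linear maps $A$ between oriented $2$-dimensional inner product spaces with $\det A\ge0$ and $\sigma_1(A)+\sigma_2(A)=1$ ($\sigma_i$ the singular values); $\operatorname{dist}(d\phi_x,K)$ is the distance to the set of such maps $T_x\mathcal M\to T_{\phi(x)}\mathcal N$. $F:[0,\infty)\to\mathbb R$ is $F(s)=1-2s$ for $0\le s\le\frac14$, $F(s)=2(\sqrt s-1)^2$ for $s\ge\frac14$. *)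

theory Defs
  imports "HOL-Analysis.Analysis"
begin

section \<open>Smooth maps on subsets of Euclidean space\<close>

text \<open>\<^term>\<open>Ck_on k S f\<close> is meant for open \<^term>\<open>S\<close>.\<close>

primrec Ck_on ::
  "nat \<Rightarrow> 'a::real_normed_vector set \<Rightarrow> ('a \<Rightarrow> 'b::real_normed_vector) \<Rightarrow> bool"
where
  "Ck_on 0 S f \<longleftrightarrow> continuous_on S f"
| "Ck_on (Suc k) S f \<longleftrightarrow>
     (\<exists>f'. (\<forall>x\<in>S. (f has_derivative f' x) (at x)) \<and> (\<forall>v. Ck_on k S (\<lambda>x. f' x v)))"

text \<open>Smoothness on a set that need not be open (a chart domain containing boundary points):
  locally there is a smooth extension to an open set.\<close>

definition smooth_on ::
  "'a::real_normed_vector set \<Rightarrow> ('a \<Rightarrow> 'b::real_normed_vector) \<Rightarrow> bool"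
where
  "smooth_on S f \<longleftrightarrow>
     (\<forall>x\<in>S. \<exists>W F. open W \<and> x \<in> W \<and> (\<forall>k. Ck_on k W F) \<and> (\<forall>y\<in>S \<inter> W. F y = f y))"

section \<open>Oriented Riemannian surfaces with Lipschitz boundary\<close>

text \<open>Model sets for charts: near each of its points the set is either everything, or, after an
  orthogonal change of coordinates, the closed epigraph of a Lipschitz function.\<close>

definition lipschitz_patch :: "(real^2) set \<Rightarrow> bool" where
  "lipschitz_patch S \<longleftrightarrow>
     (\<forall>x\<in>S. \<exists>W. open W \<and> x \<in> W \<and>
        (W \<subseteq> S \<or>
         (\<exists>Q L \<gamma>. orthogonal_transformation (Q :: real^2 \<Rightarrow> real^2) \<and> L-lipschitz_on UNIV (\<gamma> :: real \<Rightarrow> real) \<and>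
            S \<inter> W = {y\<in>W. \<gamma> (Q y $ 1) \<le> Q y $ 2})))"

text \<open>A chart is a domain together with a coordinate map, which is only relevant on the domain.\<close>

type_synonym 'a chart = "'a set \<times> ('a \<Rightarrow> real^2)"

abbreviation dom_of :: "'a chart \<Rightarrow> 'a set" where "dom_of c \<equiv> fst c"
abbreviation coord :: "'a chart \<Rightarrow> 'a \<Rightarrow> real^2" where "coord c \<equiv> snd c"

definition chart_inv :: "'a chart \<Rightarrow> real^2 \<Rightarrow> 'a" where
  "chart_inv c = inv_into (dom_of c) (coord c)"

text \<open>\<open>riem M c p u v\<close> is the Riemannian inner product at the point \<^term>\<open>p\<close> of the tangent vectors
  with coordinates \<^term>\<open>u\<close> and \<^term>\<open>v\<close> in the chart \<^term>\<open>c\<close>.\<close>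

record 'a surface =
  surface_top :: "'a topology"
  atlas :: "'a chart set"
  riem :: "'a chart \<Rightarrow> 'a \<Rightarrow> real^2 \<Rightarrow> real^2 \<Rightarrow> real"

abbreviation points :: "'a surface \<Rightarrow> 'a set" where
  "points M \<equiv> topspace (surface_top M)"

definition inner_product :: "('v::real_vector \<Rightarrow> 'v \<Rightarrow> real) \<Rightarrow> bool" where
  "inner_product b \<longleftrightarrow>
     bilinear b \<and> (\<forall>u v. b u v = b v u) \<and> (\<forall>v. v \<noteq> 0 \<longrightarrow> 0 < b v v)"

definition chart_on :: "'a topology \<Rightarrow> 'a chart \<Rightarrow> bool" where
  "chart_on X c \<longleftrightarrow>
     openin X (dom_of c) \<and> lipschitz_patch (coord c ` dom_of c) \<and>
     homeomorphic_map (subtopology X (dom_of c)) (top_of_set (coord c ` dom_of c)) (coord c)"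

text \<open>Coordinate changes are smooth, orientation preserving and intertwine the local expressions
  of the metric.\<close>

definition charts_compatible :: "'a surface \<Rightarrow> 'a chart \<Rightarrow> 'a chart \<Rightarrow> bool" where
  "charts_compatible M c d \<longleftrightarrow>
     (let S = coord c ` (dom_of c \<inter> dom_of d); \<tau> = coord d \<circ> chart_inv c in
        smooth_on S \<tau> \<and>
        (\<forall>p \<in> dom_of c \<inter> dom_of d. \<exists>D.
           (\<tau> has_derivative D) (at (coord c p) within S) \<and> det (matrix D) > 0 \<and>
           (\<forall>u v. riem M c p u v = riem M d p (D u) (D v))))"

text \<open>Since the coordinate changes of the atlas are orientation preserving, the atlas also carries
  the orientation. Nonemptiness is part of the definition: areas of surfaces occur as denominators.\<close>

definition oriented_riemannian_surface :: "'a surface \<Rightarrow> bool" where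
  "oriented_riemannian_surface M \<longleftrightarrow>
     points M \<noteq> {} \<and> Hausdorff_space (surface_top M) \<and> second_countable (surface_top M) \<and>
     (\<Union>c\<in>atlas M. dom_of c) = points M \<and>
     (\<forall>c\<in>atlas M. chart_on (surface_top M) c) \<and>
     (\<forall>c\<in>atlas M. \<forall>d\<in>atlas M. charts_compatible M c d) \<and>
     (\<forall>c\<in>atlas M. \<forall>p\<in>dom_of c. inner_product (riem M c p)) \<and>
     (\<forall>c\<in>atlas M. \<forall>u v. smooth_on (coord c ` dom_of c) (\<lambda>x. riem M c (chart_inv c x) u v))"

subsection \<open>Tangent spaces\<close>

text \<open>The tangent space at \<^term>\<open>p\<close> is \<^typ>\<open>real^2\<close>, by means of the coordinates of one selected chart
  around \<^term>\<open>p\<close>, with the standard orientation and the inner product \<open>metric_at M p\<close>.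
  Another selection changes the tangent spaces by orientation preserving isometries only.\<close>

definition chart_at :: "'a surface \<Rightarrow> 'a \<Rightarrow> 'a chart" where
  "chart_at M p = (SOME c. c \<in> atlas M \<and> p \<in> dom_of c)"

definition metric_at :: "'a surface \<Rightarrow> 'a \<Rightarrow> real^2 \<Rightarrow> real^2 \<Rightarrow> real" where
  "metric_at M p = riem M (chart_at M p) p"

text \<open>The differential \<open>d\<phi>\<^sub>p\<close>; it is set to 0 where \<^term>\<open>\<phi>\<close> is not differentiable.\<close>

definition differential ::
  "'a surface \<Rightarrow> 'b surface \<Rightarrow> ('a \<Rightarrow> 'b) \<Rightarrow> 'a \<Rightarrow> real^2 \<Rightarrow> real^2"
where
  "differential M N \<phi> p =
     (let c = chart_at M p; d = chart_at N (\<phi> p);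
          is_diff = (\<lambda>A. (coord d \<circ> \<phi> \<circ> chart_inv c has_derivative A)
                          (at (coord c p) within coord c ` dom_of c))
      in if \<exists>A. is_diff A then SOME A. is_diff A else (\<lambda>v. 0))"

subsection \<open>Area\<close>

definition area_density :: "'a surface \<Rightarrow> 'a chart \<Rightarrow> 'a \<Rightarrow> real" where
  "area_density M c p = sqrt (det (\<chi> i j. riem M c p (axis i 1) (axis j 1)))"

text \<open>The Riemannian area measure, first on Borel sets, then completed.\<close>

definition borel_area_measure :: "'a surface \<Rightarrow> 'a measure" where
  "borel_area_measure M =
     (THE \<mu>. sets \<mu> = sets (sigma (points M) {U. openin (surface_top M) U}) \<and>
        (\<forall>c\<in>atlas M. \<forall>E\<in>sets \<mu>. E \<subseteq> dom_of c \<longrightarrow>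
           emeasure \<mu> E =
             (\<integral>\<^sup>+ x. ennreal (area_density M c (chart_inv c x)) * indicator (coord c ` E) x \<partial>lborel)))"

definition area_measure :: "'a surface \<Rightarrow> 'a measure" where
  "area_measure M = completion (borel_area_measure M)"

definition area :: "'a surface \<Rightarrow> 'a set \<Rightarrow> real" where
  "area M X = measure (area_measure M) X"

abbreviation total_area :: "'a surface \<Rightarrow> real" where
  "total_area M \<equiv> area M (points M)"

subsection \<open>Geodesic distance and Lipschitz maps\<close>

definition piecewise_C1_curve :: "'a surface \<Rightarrow> (real \<Rightarrow> 'a) \<Rightarrow> bool" where
  "piecewise_C1_curve M \<gamma> \<longleftrightarrow>
     continuous_map (top_of_set {0..1}) (surface_top M) \<gamma> \<and>
     (\<forall>c\<in>atlas M. \<forall>a b. 0 \<le> a \<and> a \<le> b \<and> b \<le> 1 \<and> \<gamma> ` {a..b} \<subseteq> dom_of c \<longrightarrow>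
        (coord c \<circ> \<gamma>) piecewise_C1_differentiable_on {a..b})"

definition speed :: "'a surface \<Rightarrow> (real \<Rightarrow> 'a) \<Rightarrow> real \<Rightarrow> real" where
  "speed M \<gamma> t =
     (let v = vector_derivative (coord (chart_at M (\<gamma> t)) \<circ> \<gamma>) (at t)
      in sqrt (metric_at M (\<gamma> t) v v))"

definition curve_length :: "'a surface \<Rightarrow> (real \<Rightarrow> 'a) \<Rightarrow> ennreal" where
  "curve_length M \<gamma> = (\<integral>\<^sup>+ t\<in>{0..1}. ennreal (speed M \<gamma> t) \<partial>lborel)"

definition geodesic_dist :: "'a surface \<Rightarrow> 'a \<Rightarrow> 'a \<Rightarrow> ennreal" where
  "geodesic_dist M p q =
     (INF \<gamma> \<in> {\<gamma>. piecewise_C1_curve M \<gamma> \<and> \<gamma> 0 = p \<and> \<gamma> 1 = q}. curve_length M \<gamma>)"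

definition lipschitz_map :: "'a surface \<Rightarrow> 'b surface \<Rightarrow> ('a \<Rightarrow> 'b) \<Rightarrow> bool" where
  "lipschitz_map M N \<phi> \<longleftrightarrow>
     \<phi> ` points M \<subseteq> points N \<and>
     (\<exists>L\<ge>0. \<forall>p\<in>points M. \<forall>q\<in>points M.
        geodesic_dist N (\<phi> p) (\<phi> q) \<le> ennreal L * geodesic_dist M p q)"

section \<open>Linear maps between oriented two-dimensional inner product spaces\<close>

text \<open>The two spaces are \<^typ>\<open>real^2\<close> with its standard orientation and with the inner products
  \<^term>\<open>g\<close> on the source and \<^term>\<open>h\<close> on the target.\<close>

definition orthonormal_basis :: "(real^2 \<Rightarrow> real^2 \<Rightarrow> real) \<Rightarrow> (2 \<Rightarrow> real^2) \<Rightarrow> bool" where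
  "orthonormal_basis b e \<longleftrightarrow> (\<forall>i j. b (e i) (e j) = (if i = j then 1 else 0))"

definition oriented_frame :: "(real^2 \<Rightarrow> real^2 \<Rightarrow> real) \<Rightarrow> 2 \<Rightarrow> real^2" where
  "oriented_frame b = (SOME e. orthonormal_basis b e \<and> det (\<chi> i j. e j $ i) > 0)"

text \<open>Determinant with respect to the inner products and the orientations.\<close>

definition hom_det ::
  "(real^2 \<Rightarrow> real^2 \<Rightarrow> real) \<Rightarrow> (real^2 \<Rightarrow> real^2 \<Rightarrow> real) \<Rightarrow> (real^2 \<Rightarrow> real^2) \<Rightarrow> real"
where
  "hom_det g h A = det (\<chi> i j. h (oriented_frame h i) (A (oriented_frame g j)))"

text \<open>The norm of the inner product \<open>\<langle>A, B\<rangle> = tr (A\<^sup>* B)\<close> induced on linear maps.\<close>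

definition hom_norm ::
  "(real^2 \<Rightarrow> real^2 \<Rightarrow> real) \<Rightarrow> (real^2 \<Rightarrow> real^2 \<Rightarrow> real) \<Rightarrow> (real^2 \<Rightarrow> real^2) \<Rightarrow> real"
where
  "hom_norm g h A = sqrt (\<Sum>j\<in>UNIV. h (A (oriented_frame g j)) (A (oriented_frame g j)))"

definition hom_setdist ::
  "(real^2 \<Rightarrow> real^2 \<Rightarrow> real) \<Rightarrow> (real^2 \<Rightarrow> real^2 \<Rightarrow> real) \<Rightarrow>
     (real^2 \<Rightarrow> real^2) \<Rightarrow> (real^2 \<Rightarrow> real^2) set \<Rightarrow> real"
where
  "hom_setdist g h A S = (INF B\<in>S. hom_norm g h (\<lambda>v. A v - B v))"

text \<open>Singular values are the square roots of the eigenvalues of \<open>A\<^sup>* A\<close>, with multiplicity; the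
  equation \<open>A\<^sup>* A u\<^sub>i = (\<sigma>\<^sub>i)\<^sup>2 u\<^sub>i\<close> is tested against all \<^term>\<open>w\<close>.\<close>

definition singular_values ::
  "(real^2 \<Rightarrow> real^2 \<Rightarrow> real) \<Rightarrow> (real^2 \<Rightarrow> real^2 \<Rightarrow> real) \<Rightarrow> (real^2 \<Rightarrow> real^2) \<Rightarrow> (2 \<Rightarrow> real) \<Rightarrow> bool"
where
  "singular_values g h A \<sigma> \<longleftrightarrow>
     (\<forall>i. 0 \<le> \<sigma> i) \<and>
     (\<exists>u. orthonormal_basis g u \<and> (\<forall>i w. h (A (u i)) (A w) = (\<sigma> i)\<^sup>2 * g (u i) w))"

definition SO_set ::
  "(real^2 \<Rightarrow> real^2 \<Rightarrow> real) \<Rightarrow> (real^2 \<Rightarrow> real^2 \<Rightarrow> real) \<Rightarrow> (real^2 \<Rightarrow> real^2) set"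
where
  "SO_set g h = {A. linear A \<and> (\<forall>u v. h (A u) (A v) = g u v) \<and> 0 < hom_det g h A}"

definition K_set ::
  "(real^2 \<Rightarrow> real^2 \<Rightarrow> real) \<Rightarrow> (real^2 \<Rightarrow> real^2 \<Rightarrow> real) \<Rightarrow> (real^2 \<Rightarrow> real^2) set"
where
  "K_set g h =
     {A. linear A \<and> 0 \<le> hom_det g h A \<and> (\<exists>\<sigma>. singular_values g h A \<sigma> \<and> \<sigma> 1 + \<sigma> 2 = 1)}"

section \<open>Energies\<close>

definition jacobian :: "'a surface \<Rightarrow> 'b surface \<Rightarrow> ('a \<Rightarrow> 'b) \<Rightarrow> 'a \<Rightarrow> real" where
  "jacobian M N \<phi> p =
     hom_det (metric_at M p) (metric_at N (\<phi> p)) (differential M N \<phi> p)"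

definition dist_SO :: "'a surface \<Rightarrow> 'b surface \<Rightarrow> ('a \<Rightarrow> 'b) \<Rightarrow> 'a \<Rightarrow> real" where
  "dist_SO M N \<phi> p =
     (let g = metric_at M p; h = metric_at N (\<phi> p)
      in hom_setdist g h (differential M N \<phi> p) (SO_set g h))"

definition dist_K :: "'a surface \<Rightarrow> 'b surface \<Rightarrow> ('a \<Rightarrow> 'b) \<Rightarrow> 'a \<Rightarrow> real" where
  "dist_K M N \<phi> p =
     (let g = metric_at M p; h = metric_at N (\<phi> p)
      in hom_setdist g h (differential M N \<phi> p) (K_set g h))"

definition E2 :: "'a surface \<Rightarrow> 'b surface \<Rightarrow> ('a \<Rightarrow> 'b) \<Rightarrow> real" where
  "E2 M N \<phi> = 1 / total_area M * (\<integral>p. (dist_SO M N \<phi> p)\<^sup>2 \<partial>area_measure M)"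

definition Lip_inj_plus :: "'a surface \<Rightarrow> 'b surface \<Rightarrow> ('a \<Rightarrow> 'b) set" where
  "Lip_inj_plus M N =
     {\<phi>. lipschitz_map M N \<phi> \<and>
         (AE p in area_measure M. 0 \<le> jacobian M N \<phi> p) \<and>
         (AE q in area_measure N. finite {p\<in>points M. \<phi> p = q} \<and> card {p\<in>points M. \<phi> p = q} \<le> 1)}"

text \<open>\<^term>\<open>F_fun s\<close> is only used for \<^prop>\<open>0 \<le> s\<close>.\<close>

definition F_fun :: "real \<Rightarrow> real" where
  "F_fun s = (if s \<le> 1/4 then 1 - 2 * s else 2 * (sqrt s - 1)\<^sup>2)"

definition L2_norm :: "'a measure \<Rightarrow> ('a \<Rightarrow> real) \<Rightarrow> real" where
  "L2_norm \<mu> f = sqrt (\<integral>p. (f p)\<^sup>2 \<partial>\<mu>)"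

end

theory Submission
  imports Defs
begin

text \<open>Pointwise, let \<open>s = \<sigma>\<^sub>1 + \<sigma>\<^sub>2\<close> and \<open>J \<ge> 0\<close> be the sum of the singular values and the Jacobian of the
  differential. Its squared distance to \<open>SO\<close> is \<open>(s - 1)\<^sup>2 + 1 - 2 J\<close>, and \<open>(s - 1)\<^sup>2\<close> lies between the squared
  distance to \<open>K\<close> and twice that number. Integrate this identity: by the area formula and injectivity,
  \<open>J\<close> integrates to the area of the image, and \<open>F\<close> is the affine function \<open>1 - 2 t\<close> of \<open>t\<close> on \<open>[0, 1/4]\<close>.

  The area formula rests on Rademacher's theorem. In dimension one it follows from the
  Radon-Nikodym theorem; in the plane, Lebesgue points of the partial derivatives are points of
  differentiability, as one sees by integrating along axis-parallel lines. Maps that are Lipschitz for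
  the geodesic distances are locally Lipschitz in charts, also at the boundary, because the
  Lipschitz patches are locally quasiconvex.\<close>

section \<open>Linear maps between oriented two-dimensional inner product spaces\<close>

text \<open>The distance formulas come from splitting a linear map into a conformal part
  \<open>z\<close> and an anticonformal part \<open>w\<close>, which range over orthogonal planes.
  There \<open>SO\<close> is a circle times a point and \<open>K\<close> is a circle times a disc.
  The condition J >= 0 says |w| <= |z|, and then the disc contributes at most as much to the squared
  distance to \<open>K\<close> as the circle does: this is the origin of the factor 2. The obstacle
  is that the definitions hide choices: frames, charts and derivatives are selected by SOME, the
  area measure by THE, and a Bochner integral defaults to 0. Hence the coordinate formulas free of
  these choices, which also yield measurability, and the check that every integrand is measurable
  and almost everywhere bounded. Injectivity holds only over almost every point of the target. The
  preimage of the exceptional null set may have positive area, but the Jacobian vanishes almost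
  everywhere on it. Compactness enters through finite Borel partitions into pieces that lie in
  charts and on which the estimates are uniform.\<close>

definition gram_det :: "(real^2 \<Rightarrow> real^2 \<Rightarrow> real) \<Rightarrow> real" where
  "gram_det b = b (axis 1 1) (axis 1 1) * b (axis 2 1) (axis 2 1) - (b (axis 1 1) (axis 2 1))\<^sup>2"

text \<open>\<open>tr (G\<inverse> A\<^sup>T H A)\<close>, where \<open>G\<close> and \<open>H\<close> are the Gram matrices of the inner products.\<close>

definition hom_norm_sq ::
  "(real^2 \<Rightarrow> real^2 \<Rightarrow> real) \<Rightarrow> (real^2 \<Rightarrow> real^2 \<Rightarrow> real) \<Rightarrow> (real^2 \<Rightarrow> real^2) \<Rightarrow> real"
where
  "hom_norm_sq g h A =
     (g (axis 2 1) (axis 2 1) * h (A (axis 1 1)) (A (axis 1 1))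
      - 2 * g (axis 1 1) (axis 2 1) * h (A (axis 1 1)) (A (axis 2 1))
      + g (axis 1 1) (axis 1 1) * h (A (axis 2 1)) (A (axis 2 1))) / gram_det g"

section \<open>Gram matrices and orthonormal frames\<close>

lemma real2_expand: "v = v $ 1 *\<^sub>R axis 1 1 + v $ 2 *\<^sub>R (axis 2 1 :: real^2)"
  by (simp add: vec_eq_iff forall_2 axis_def)

lemma bilinear_real2:
  fixes b :: "real^2 \<Rightarrow> real^2 \<Rightarrow> real"
  assumes "bilinear b"
  shows "b v w = v$1 * w$1 * b (axis 1 1) (axis 1 1) + v$1 * w$2 * b (axis 1 1) (axis 2 1)
     + v$2 * w$1 * b (axis 2 1) (axis 1 1) + v$2 * w$2 * b (axis 2 1) (axis 2 1)"
proof -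
  have "b v w = b (v $ 1 *\<^sub>R axis 1 1 + v $ 2 *\<^sub>R axis 2 1) (w $ 1 *\<^sub>R axis 1 1 + w $ 2 *\<^sub>R axis 2 1)"
    by (metis real2_expand)
  then show ?thesis
    by (simp add: bilinear_ladd[OF assms] bilinear_radd[OF assms] bilinear_lmul[OF assms] bilinear_rmul[OF assms] algebra_simps)
qed

lemma inner_productD:
  assumes "inner_product b"
  shows "bilinear b" "b u v = b v u" "v \<noteq> 0 \<Longrightarrow> 0 < b v v"
  using assms by (auto simp: inner_product_def)

lemma inner_product_real2:
  fixes b :: "real^2 \<Rightarrow> real^2 \<Rightarrow> real"
  assumes "inner_product b"
  shows "b v w = v$1 * w$1 * b (axis 1 1) (axis 1 1) + (v$1 * w$2 + v$2 * w$1) * b (axis 1 1) (axis 2 1)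
     + v$2 * w$2 * b (axis 2 1) (axis 2 1)"
  using bilinear_real2[OF inner_productD(1)[OF assms], of v w] inner_productD(2)[OF assms, of "axis 2 1" "axis 1 1"]
  by (simp add: algebra_simps)

lemma gram_det_pos:
  assumes b: "inner_product b"
  shows "0 < b (axis 1 1) (axis 1 1)" "0 < b (axis 2 1) (axis 2 1)" "0 < gram_det b"
proof -
  show 1: "0 < b (axis 1 1) (axis 1 1)" "0 < b (axis 2 1) (axis 2 1)"
    using inner_productD(3)[OF b] by (auto simp: axis_eq_0_iff)
  let ?G = "b (axis 1 1) (axis 1 1)" and ?H = "b (axis 1 1) (axis 2 1)" and ?K = "b (axis 2 1) (axis 2 1)"
  define v :: "real^2" where "v = vector [- ?H, ?G]"
  have "v \<noteq> 0" using 1 by (auto simp: v_def vec_eq_iff forall_2)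
  then have "0 < b v v" by (rule inner_productD(3)[OF b])
  also have "b v v = ?G * gram_det b"
    by (subst inner_product_real2[OF b]) (simp add: v_def gram_det_def algebra_simps power2_eq_square)
  finally show "0 < gram_det b" using 1 by (simp add: zero_less_mult_iff)
qed

text \<open>Let \<open>E\<close> be the matrix with columns \<open>(a, b)\<close> and
  \<open>(c, d)\<close>, and let \<open>B\<close> be the Gram matrix with entries
  \<open>G, H, H, K\<close>. The hypotheses say that \<open>E\<close> is orthonormal for
  \<open>B\<close>, so the transpose of \<open>E\<close> times \<open>B\<close> times
  \<open>E\<close> is the identity. Hence \<open>E\<close> times its transpose is the inverse of
  \<open>B\<close>; the last three equations are Cramer's formula for that inverse.\<close>

lemma orthonormal_algebra:
  fixes a b c d G H K :: real
  assumes 1: "a*a*G + 2*a*b*H + b*b*K = 1" and 2: "c*c*G + 2*c*d*H + d*d*K = 1"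
    and 3: "a*c*G + (a*d + b*c)*H + b*d*K = 0"
  shows "(a*d - c*b)\<^sup>2 * (G*K - H\<^sup>2) = 1"
    "(a*a + c*c)*G + (a*b + c*d)*H = 1" "(a*a + c*c)*H + (a*b + c*d)*K = 0"
    "(a*b + c*d)*G + (b*b + d*d)*H = 0" "(a*b + c*d)*H + (b*b + d*d)*K = 1"
    "(a*a + c*c) * (G*K - H\<^sup>2) = K" "(a*b + c*d) * (G*K - H\<^sup>2) = - H" "(b*b + d*d) * (G*K - H\<^sup>2) = G"
proof -
  have "(a*d - c*b)\<^sup>2 * (G*K - H\<^sup>2) = (a*a*G + 2*a*b*H + b*b*K) * (c*c*G + 2*c*d*H + d*d*K)
     - (a*c*G + (a*d + b*c)*H + b*d*K)\<^sup>2"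
    by (simp add: algebra_simps power2_eq_square)
  then show D: "(a*d - c*b)\<^sup>2 * (G*K - H\<^sup>2) = 1" unfolding 1 2 3 by simp
  then have \<delta>: "a*d - c*b \<noteq> 0" by auto
  \<comment> \<open>A covector \<open>(p, q)\<close> is determined by its values on the two
    independent vectors; here these are the values of the first coordinate, and in the next fact
    those of the second.\<close>
  have *: "p = 1 \<and> q = 0" if "p*a + q*b = a" "p*c + q*d = c" for p q
  proof -
    have "(p - 1) * (a*d - c*b) = (p*a + q*b - a) * d - (p*c + q*d - c) * b" by (simp add: algebra_simps)
    then have "p = 1" using that \<delta> by simp
    have "q * (a*d - c*b) = (p*c + q*d - c) * a - (p*a + q*b - a) * c" by (simp add: algebra_simps)
    also have "\<dots> = 0" using that by simp
    finally show ?thesis using \<open>p = 1\<close> \<delta> by simp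
  qed
  have **: "p = 0 \<and> q = 1" if "p*a + q*b = b" "p*c + q*d = d" for p q
  proof -
    have "(q - 1) * (a*d - c*b) = (p*c + q*d - d) * a - (p*a + q*b - b) * c" by (simp add: algebra_simps)
    then have "q = 1" using that \<delta> by simp
    have "p * (a*d - c*b) = (p*a + q*b - b) * d - (p*c + q*d - d) * b" by (simp add: algebra_simps)
    also have "\<dots> = 0" using that by simp
    finally show ?thesis using \<open>q = 1\<close> \<delta> by simp
  qed
  have "((a*a + c*c)*G + (a*b + c*d)*H)*a + ((a*a + c*c)*H + (a*b + c*d)*K)*b
     = a * (a*a*G + 2*a*b*H + b*b*K) + c * (a*c*G + (a*d + b*c)*H + b*d*K)" by (simp add: algebra_simps)
  moreover have "((a*a + c*c)*G + (a*b + c*d)*H)*c + ((a*a + c*c)*H + (a*b + c*d)*K)*d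
     = a * (a*c*G + (a*d + b*c)*H + b*d*K) + c * (c*c*G + 2*c*d*H + d*d*K)" by (simp add: algebra_simps)
  ultimately show p1: "(a*a + c*c)*G + (a*b + c*d)*H = 1" and p2: "(a*a + c*c)*H + (a*b + c*d)*K = 0"
    unfolding 1 2 3 using * by auto
  have "((a*b + c*d)*G + (b*b + d*d)*H)*a + ((a*b + c*d)*H + (b*b + d*d)*K)*b
     = b * (a*a*G + 2*a*b*H + b*b*K) + d * (a*c*G + (a*d + b*c)*H + b*d*K)" by (simp add: algebra_simps)
  moreover have "((a*b + c*d)*G + (b*b + d*d)*H)*c + ((a*b + c*d)*H + (b*b + d*d)*K)*d
     = b * (a*c*G + (a*d + b*c)*H + b*d*K) + d * (c*c*G + 2*c*d*H + d*d*K)" by (simp add: algebra_simps)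
  ultimately show p3: "(a*b + c*d)*G + (b*b + d*d)*H = 0" and p4: "(a*b + c*d)*H + (b*b + d*d)*K = 1"
    unfolding 1 2 3 using ** by auto
  have "(a*a + c*c) * (G*K - H\<^sup>2) = K * ((a*a + c*c)*G + (a*b + c*d)*H) - H * ((a*a + c*c)*H + (a*b + c*d)*K)"
    by (simp add: algebra_simps power2_eq_square)
  then show "(a*a + c*c) * (G*K - H\<^sup>2) = K" unfolding p1 p2 by simp
  have "(a*b + c*d) * (G*K - H\<^sup>2) = K * ((a*b + c*d)*G + (b*b + d*d)*H) - H * ((a*b + c*d)*H + (b*b + d*d)*K)"
    by (simp add: algebra_simps power2_eq_square)
  then show "(a*b + c*d) * (G*K - H\<^sup>2) = - H" unfolding p3 p4 by simp
  have "(b*b + d*d) * (G*K - H\<^sup>2) = G * ((a*b + c*d)*H + (b*b + d*d)*K) - H * ((a*b + c*d)*G + (b*b + d*d)*H)"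
    by (simp add: algebra_simps power2_eq_square)
  then show "(b*b + d*d) * (G*K - H\<^sup>2) = G" unfolding p3 p4 by simp
qed

lemma orthonormal_basis_components:
  assumes b: "inner_product b" and e: "orthonormal_basis b e"
  shows "e 1$1*e 1$1*b (axis 1 1) (axis 1 1) + 2*e 1$1*e 1$2*b (axis 1 1) (axis 2 1) + e 1$2*e 1$2*b (axis 2 1) (axis 2 1) = 1"
    "e 2$1*e 2$1*b (axis 1 1) (axis 1 1) + 2*e 2$1*e 2$2*b (axis 1 1) (axis 2 1) + e 2$2*e 2$2*b (axis 2 1) (axis 2 1) = 1"
    "e 1$1*e 2$1*b (axis 1 1) (axis 1 1) + (e 1$1*e 2$2 + e 1$2*e 2$1)*b (axis 1 1) (axis 2 1) + e 1$2*e 2$2*b (axis 2 1) (axis 2 1) = 0"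
proof -
  have "b (e 1) (e 1) = 1" "b (e 2) (e 2) = 1" "b (e 1) (e 2) = 0" using e by (auto simp: orthonormal_basis_def)
  then show "e 1$1*e 1$1*b (axis 1 1) (axis 1 1) + 2*e 1$1*e 1$2*b (axis 1 1) (axis 2 1) + e 1$2*e 1$2*b (axis 2 1) (axis 2 1) = 1"
    "e 2$1*e 2$1*b (axis 1 1) (axis 1 1) + 2*e 2$1*e 2$2*b (axis 1 1) (axis 2 1) + e 2$2*e 2$2*b (axis 2 1) (axis 2 1) = 1"
    "e 1$1*e 2$1*b (axis 1 1) (axis 1 1) + (e 1$1*e 2$2 + e 1$2*e 2$1)*b (axis 1 1) (axis 2 1) + e 1$2*e 2$2*b (axis 2 1) (axis 2 1) = 0"
    using inner_product_real2[OF b, of "e 1" "e 1"] inner_product_real2[OF b, of "e 2" "e 2"] inner_product_real2[OF b, of "e 1" "e 2"]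
    by (simp_all add: algebra_simps)
qed

text \<open>In coordinates the left side is \<open>E\<close> times its transpose times the Gram
  matrix, applied to \<open>v\<close>, and by \<open>orthonormal_algebra\<close> this product of
  matrices is the identity.\<close>

lemma orthonormal_basis_expand:
  assumes b: "inner_product b" and e: "orthonormal_basis b e"
  shows "b (e 1) v *\<^sub>R e 1 + b (e 2) v *\<^sub>R e 2 = v"
proof -
  note A = orthonormal_algebra[OF orthonormal_basis_components[OF b e]]
  let ?G = "b (axis 1 1) (axis 1 1)" and ?H = "b (axis 1 1) (axis 2 1)" and ?K = "b (axis 2 1) (axis 2 1)"
  have B: "b (e i) v = (e i$1*?G + e i$2*?H) * v$1 + (e i$1*?H + e i$2*?K) * v$2" for i
    by (subst inner_product_real2[OF b]) (simp add: algebra_simps)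
  have "b (e 1) v * e 1$1 + b (e 2) v * e 2$1 =
     ((e 1$1*e 1$1 + e 2$1*e 2$1)*?G + (e 1$1*e 1$2 + e 2$1*e 2$2)*?H) * v$1
     + ((e 1$1*e 1$1 + e 2$1*e 2$1)*?H + (e 1$1*e 1$2 + e 2$1*e 2$2)*?K) * v$2"
    unfolding B by (simp add: algebra_simps)
  also have "\<dots> = v$1" unfolding A(2,3) by simp
  finally have 1: "b (e 1) v * e 1$1 + b (e 2) v * e 2$1 = v$1" .
  have "b (e 1) v * e 1$2 + b (e 2) v * e 2$2 =
     ((e 1$1*e 1$2 + e 2$1*e 2$2)*?G + (e 1$2*e 1$2 + e 2$2*e 2$2)*?H) * v$1
     + ((e 1$1*e 1$2 + e 2$1*e 2$2)*?H + (e 1$2*e 1$2 + e 2$2*e 2$2)*?K) * v$2"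
    unfolding B by (simp add: algebra_simps)
  also have "\<dots> = v$2" unfolding A(4,5) by simp
  finally show ?thesis using 1 by (simp add: vec_eq_iff forall_2)
qed

text \<open>Existence is what gives the SOME in \<open>oriented_frame\<close> a meaning;
  Gram-Schmidt applied to the coordinate axes provides it.\<close>

lemma oriented_frame:
  assumes b: "inner_product b"
  shows "orthonormal_basis b (oriented_frame b)" "det (\<chi> i j. oriented_frame b j $ i) > 0"
proof -
  let ?G = "b (axis 1 1) (axis 1 1)" and ?H = "b (axis 1 1) (axis 2 1)" and ?K = "b (axis 2 1) (axis 2 1)"
  define s where "s = sqrt ?G"
  define t where "t = sqrt (?G * gram_det b)"
  have s: "s > 0" "s * s = ?G" and t: "t > 0" "t * t = ?G * (?G * ?K - ?H * ?H)"
    using gram_det_pos[OF b] by (auto simp: s_def t_def gram_det_def power2_eq_square)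
  \<comment> \<open>The vector \<open>(-H, G)\<close> is orthogonal to the first axis and has square
    length \<open>G * gram_det b\<close>, whence the normalisation by \<open>t\<close>.\<close>
  define e :: "2 \<Rightarrow> real^2" where "e i = (if i = 1 then vector [1 / s, 0] else vector [- ?H / t, ?G / t])" for i
  have e: "e 1 $ 1 = 1/s" "e 1 $ 2 = 0" "e 2 $ 1 = - ?H/t" "e 2 $ 2 = ?G/t" by (auto simp: e_def)
  have "b (e 1) (e 1) = 1" using s(1) by (subst inner_product_real2[OF b]) (simp add: e s(2)[symmetric])
  moreover have "b (e 1) (e 2) = 0" using s t by (subst inner_product_real2[OF b]) (simp add: e field_simps)
  moreover have "b (e 2) (e 1) = 0" using s t by (subst inner_product_real2[OF b]) (simp add: e field_simps)
  moreover have "b (e 2) (e 2) = (?G * (?G * ?K - ?H * ?H)) / (t * t)"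
    using t(1) by (subst inner_product_real2[OF b]) (simp add: e field_simps)
  ultimately have 1: "orthonormal_basis b e"
    using t by (auto simp: orthonormal_basis_def forall_2)
  have "det (\<chi> i j. e j $ i) > 0" using s t gram_det_pos[OF b] by (simp add: det_2 e)
  then have "\<exists>e. orthonormal_basis b e \<and> det (\<chi> i j. e j $ i) > 0" using 1 by blast
  from someI_ex[OF this] show "orthonormal_basis b (oriented_frame b)" "det (\<chi> i j. oriented_frame b j $ i) > 0"
    by (simp_all add: oriented_frame_def)
qed

text \<open>The sum depends on the basis only through the sum of the matrices of products
  \<open>u j $ k * u j $ l\<close>, which is the inverse Gram matrix for every orthonormal basis.
  This frees \<open>hom_norm\<close> from the selected frame.\<close>

lemma sum_orthonormal_basis:
  assumes g: "inner_product g" and h: "inner_product h" and u: "orthonormal_basis g u" and A: "linear A"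
  shows "(\<Sum>j\<in>UNIV. h (A (u j)) (A (u j))) = hom_norm_sq g h A"
proof -
  note * = orthonormal_algebra[OF orthonormal_basis_components[OF g u]]
  have Au: "A (u j) = u j $ 1 *\<^sub>R A (axis 1 1) + u j $ 2 *\<^sub>R A (axis 2 1)" for j
    by (subst real2_expand) (simp add: linear_add[OF A] linear_cmul[OF A])
  note bh = inner_productD(1)[OF h]
  let ?P = "h (A (axis 1 1)) (A (axis 1 1))" and ?Q = "h (A (axis 1 1)) (A (axis 2 1))" and ?R = "h (A (axis 2 1)) (A (axis 2 1))"
  have "h (A (u j)) (A (u j)) = u j$1*u j$1*?P + 2*(u j$1*u j$2)*?Q + u j$2*u j$2*?R" for j
    unfolding Au using inner_productD(2)[OF h, of "A (axis 2 1)" "A (axis 1 1)"]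
    by (simp add: bilinear_ladd[OF bh] bilinear_radd[OF bh] bilinear_lmul[OF bh] bilinear_rmul[OF bh] algebra_simps)
  then have "(\<Sum>j\<in>UNIV. h (A (u j)) (A (u j))) =
     (u 1$1*u 1$1 + u 2$1*u 2$1)*?P + 2*(u 1$1*u 1$2 + u 2$1*u 2$2)*?Q + (u 1$2*u 1$2 + u 2$2*u 2$2)*?R"
    by (simp add: sum_2 algebra_simps)
  moreover have "g (axis 2 1) (axis 2 1) * ?P - 2 * g (axis 1 1) (axis 2 1) * ?Q + g (axis 1 1) (axis 1 1) * ?R =
     ((u 1$1*u 1$1 + u 2$1*u 2$1)*?P + 2*(u 1$1*u 1$2 + u 2$1*u 2$2)*?Q + (u 1$2*u 1$2 + u 2$2*u 2$2)*?R) * gram_det g"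
  proof -
    have K: "g (axis 2 1) (axis 2 1) = (u 1$1*u 1$1 + u 2$1*u 2$1) * gram_det g"
      and H: "- g (axis 1 1) (axis 2 1) = (u 1$1*u 1$2 + u 2$1*u 2$2) * gram_det g"
      and G: "g (axis 1 1) (axis 1 1) = (u 1$2*u 1$2 + u 2$2*u 2$2) * gram_det g"
      using *(6-8) by (simp_all add: gram_det_def)
    have "g (axis 2 1) (axis 2 1) * ?P - 2 * g (axis 1 1) (axis 2 1) * ?Q + g (axis 1 1) (axis 1 1) * ?R =
       g (axis 2 1) (axis 2 1) * ?P + 2 * (- g (axis 1 1) (axis 2 1)) * ?Q + g (axis 1 1) (axis 1 1) * ?R" by simp
    also have "\<dots> = ((u 1$1*u 1$1 + u 2$1*u 2$1) * gram_det g) * ?P + 2 * ((u 1$1*u 1$2 + u 2$1*u 2$2) * gram_det g) * ?Q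
       + ((u 1$2*u 1$2 + u 2$2*u 2$2) * gram_det g) * ?R" by (simp only: K[symmetric] H[symmetric] G[symmetric])
    finally show ?thesis by (simp only: distrib_right mult.assoc mult.commute[of "gram_det g"])
  qed
  ultimately show ?thesis using gram_det_pos(3)[OF g] by (simp add: hom_norm_sq_def)
qed

lemma hom_norm_eq: 
  assumes "inner_product g" "inner_product h" "linear A"
  shows "hom_norm g h A = sqrt (hom_norm_sq g h A)"
  using sum_orthonormal_basis[OF assms(1,2) oriented_frame(1)[OF assms(1)] assms(3)] by (simp add: hom_norm_def)

lemma det_oriented_frame:
  assumes b: "inner_product b"
  shows "det (\<chi> i j. oriented_frame b j $ i) = 1 / sqrt (gram_det b)"
proof -
  let ?d = "det (\<chi> i j. oriented_frame b j $ i)"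
  have "?d\<^sup>2 * gram_det b = 1"
    using orthonormal_algebra(1)[OF orthonormal_basis_components[OF b oriented_frame(1)[OF b]]] by (simp add: det_2 gram_det_def mult.commute)
  then have "(?d * sqrt (gram_det b))\<^sup>2 = 1\<^sup>2" using gram_det_pos[OF b] by (simp add: power_mult_distrib)
  then have "?d * sqrt (gram_det b) = 1"
    by (rule power2_eq_imp_eq) (use oriented_frame(2)[OF b] gram_det_pos(3)[OF b] in auto)
  then show ?thesis using gram_det_pos(3)[OF b] by (simp add: field_simps)
qed

text \<open>The matrix in \<open>hom_det\<close> is the product of the transposed frame of
  \<open>h\<close>, the Gram matrix of \<open>h\<close>, the matrix of \<open>A\<close> and the
  frame of \<open>g\<close>. Both frames have determinant one over the root of the Gram determinant,
  so only the quotient of the area densities is left.\<close>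

lemma hom_det_eq:
  assumes g: "inner_product g" and h: "inner_product h" and A: "linear A"
  shows "hom_det g h A = det (matrix A) * sqrt (gram_det h) / sqrt (gram_det g)"
proof -
  define E :: "real^2^2" where "E = (\<chi> i j. oriented_frame g j $ i)"
  define F :: "real^2^2" where "F = (\<chi> i j. oriented_frame h j $ i)"
  define H :: "real^2^2" where "H = (\<chi> i j. h (axis i 1) (axis j 1))"
  have "(\<chi> i j. h (oriented_frame h i) (A (oriented_frame g j))) = transpose F ** H ** matrix A ** E"
  proof -
    have "h (oriented_frame h i) (A (oriented_frame g j)) = (transpose F ** H ** matrix A ** E) $ i $ j" for i j
    proof -
      have Aw: "A (oriented_frame g j) = matrix A *v oriented_frame g j" by (simp add: A matrix_works)
      have "h (oriented_frame h i) w = (\<Sum>k\<in>UNIV. \<Sum>l\<in>UNIV. F$k$i * H$k$l * w$l)" for w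
        by (subst bilinear_real2[OF inner_productD(1)[OF h]]) (simp add: sum_2 F_def H_def algebra_simps)
      then show ?thesis
        unfolding Aw by (simp add: matrix_matrix_mult_def matrix_vector_mult_def sum_2 transpose_def E_def algebra_simps)
    qed
    then show ?thesis by (simp add: vec_eq_iff)
  qed
  then have "hom_det g h A = det F * det H * det (matrix A) * det E"
    by (simp add: hom_det_def det_mul)
  moreover have "det H = gram_det h"
    using inner_productD(2)[OF h, of "axis 2 1" "axis 1 1"] by (simp add: det_2 H_def gram_det_def power2_eq_square)
  moreover have "det E = 1 / sqrt (gram_det g)" "det F = 1 / sqrt (gram_det h)"
    using det_oriented_frame[OF g] det_oriented_frame[OF h] by (simp_all add: E_def F_def)
  moreover have "gram_det h / sqrt (gram_det h) = sqrt (gram_det h)"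
    using gram_det_pos(3)[OF h] by (simp add: real_div_sqrt)
  ultimately show ?thesis by (simp add: field_simps)
qed

section \<open>Invariance under changes of coordinates\<close>

lemma gram_det_pullback:
  assumes D: "linear D" and b: "inner_product b" and eq: "\<And>u v. b (D u) (D v) = b' u v"
  shows "gram_det b' = (det (matrix D))\<^sup>2 * gram_det b"
  unfolding gram_det_def eq[symmetric]
  by (subst (1 2 3) inner_product_real2[OF b]) (simp add: det_2 matrix_def algebra_simps power2_eq_square)

text \<open>\<open>D\<close> and \<open>E\<close> play the part of coordinate changes in source and
  target. An isometry \<open>D\<close> carries orthonormal bases to orthonormal bases, and the sum
  over a basis does not see which one is taken.\<close>

lemma hom_norm_sq_change:
  assumes g: "inner_product g" "inner_product g'" and h: "inner_product h" "inner_product h'"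
    and lin: "linear A" "linear A'"
    and D: "\<And>u v. g' (D u) (D v) = g u v" and E: "\<And>u v. h' (E u) (E v) = h u v"
    and AD: "\<And>v. A' (D v) = E (A v)"
  shows "hom_norm_sq g' h' A' = hom_norm_sq g h A"
proof -
  have "orthonormal_basis g' (D \<circ> oriented_frame g)"
    using oriented_frame(1)[OF g(1)] by (simp add: orthonormal_basis_def D)
  from sum_orthonormal_basis[OF g(2) h(2) this lin(2)] show ?thesis
    using sum_orthonormal_basis[OF g(1) h(1) oriented_frame(1)[OF g(1)] lin(1)] by (simp add: AD E)
qed

lemma hom_det_change:
  assumes g: "inner_product g" "inner_product g'" and h: "inner_product h" "inner_product h'"
    and lin: "linear A" "linear A'" "linear D" "linear E"
    and D: "\<And>u v. g' (D u) (D v) = g u v" and E: "\<And>u v. h' (E u) (E v) = h u v"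
    and AD: "\<And>v. A' (D v) = E (A v)" and pos: "det (matrix D) > 0" "det (matrix E) > 0"
  shows "hom_det g' h' A' = hom_det g h A"
proof -
  have "matrix A' ** matrix D = matrix E ** matrix A"
  proof -
    have "A' \<circ> D = E \<circ> A" by (simp add: fun_eq_iff AD)
    then have "matrix (A' \<circ> D) = matrix (E \<circ> A)" by simp
    then show ?thesis by (simp add: matrix_compose lin)
  qed
  then have "det (matrix A') * det (matrix D) = det (matrix E) * det (matrix A)"
    by (metis det_mul)
  then have A': "det (matrix A') = det (matrix E) * det (matrix A) / det (matrix D)" using pos by (simp add: field_simps)
  have "sqrt (gram_det g) = det (matrix D) * sqrt (gram_det g')" "sqrt (gram_det h) = det (matrix E) * sqrt (gram_det h')"
    using gram_det_pullback[OF lin(3) g(2) D] gram_det_pullback[OF lin(4) h(2) E] pos by (simp_all add: real_sqrt_mult)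
  then show ?thesis
    unfolding hom_det_eq[OF g(1) h(1) lin(1)] hom_det_eq[OF g(2) h(2) lin(2)] A' using pos
    by (simp add: field_simps)
qed

subsection \<open>Complex coordinates\<close>

text \<open>In oriented orthonormal coordinates a linear map takes the form \<open>\<zeta> \<mapsto> z \<zeta> + w \<zeta>\<^bsup>*\<^esup>\<close>, and
  then \<open>\<bar>A\<bar>\<^sup>2 = 2 \<bar>z\<bar>\<^sup>2 + 2 \<bar>w\<bar>\<^sup>2\<close>, \<open>det A = \<bar>z\<bar>\<^sup>2 - \<bar>w\<bar>\<^sup>2\<close>, the singular values are
  \<open>\<bar>\<bar>z\<bar> \<plusminus> \<bar>w\<bar>\<bar>\<close>, the set \<open>SO\<close> is given by \<open>\<bar>z\<bar> = 1\<close>, \<open>w = 0\<close> and \<open>K\<close> by \<open>\<bar>z\<bar> = 1/2\<close>, \<open>\<bar>w\<bar> \<le> 1/2\<close>.\<close>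

definition frame_coord :: "(real^2 \<Rightarrow> real^2 \<Rightarrow> real) \<Rightarrow> real^2 \<Rightarrow> complex" where
  "frame_coord b v = Complex (b (oriented_frame b 1) v) (b (oriented_frame b 2) v)"

definition frame_vec :: "(real^2 \<Rightarrow> real^2 \<Rightarrow> real) \<Rightarrow> complex \<Rightarrow> real^2" where
  "frame_vec b \<zeta> = Re \<zeta> *\<^sub>R oriented_frame b 1 + Im \<zeta> *\<^sub>R oriented_frame b 2"

definition hom_coord ::
  "(real^2 \<Rightarrow> real^2 \<Rightarrow> real) \<Rightarrow> (real^2 \<Rightarrow> real^2 \<Rightarrow> real) \<Rightarrow> complex \<Rightarrow> complex \<Rightarrow> real^2 \<Rightarrow> real^2"
where
  "hom_coord g h z w v = frame_vec h (z * frame_coord g v + w * cnj (frame_coord g v))"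

lemma frame_vec_coord: "inner_product b \<Longrightarrow> frame_vec b (frame_coord b v) = v"
  using orthonormal_basis_expand[OF _ oriented_frame(1)] by (simp add: frame_vec_def frame_coord_def)

lemma frame_coord_linear:
  assumes "inner_product b"
  shows "frame_coord b (u + v) = frame_coord b u + frame_coord b v"
    "frame_coord b (u - v) = frame_coord b u - frame_coord b v"
    "frame_coord b (c *\<^sub>R v) = c *\<^sub>R frame_coord b v"
  using inner_productD(1)[OF assms]
  by (simp_all add: frame_coord_def bilinear_radd bilinear_rmul bilinear_rsub complex_eq_iff)

lemma frame_coord_frame:
  assumes "inner_product b"
  shows "frame_coord b (oriented_frame b 1) = 1" "frame_coord b (oriented_frame b 2) = \<i>"
  using oriented_frame(1)[OF assms] by (auto simp: frame_coord_def orthonormal_basis_def complex_eq_iff)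

lemma frame_coord_vec: "inner_product b \<Longrightarrow> frame_coord b (frame_vec b \<zeta>) = \<zeta>"
  by (simp add: frame_vec_def frame_coord_linear frame_coord_frame) (simp add: complex_eq_iff)

lemma frame_vec_linear:
  "frame_vec b (x + y) = frame_vec b x + frame_vec b y"
  "frame_vec b (c *\<^sub>R x) = c *\<^sub>R frame_vec b x"
  by (simp_all add: frame_vec_def algebra_simps)

lemma inner_product_coord:
  assumes b: "inner_product b"
  shows "b u v = Re (frame_coord b u * cnj (frame_coord b v))"
proof -
  have "b u v = b (b (oriented_frame b 1) u *\<^sub>R oriented_frame b 1 + b (oriented_frame b 2) u *\<^sub>R oriented_frame b 2) v"
    by (simp add: orthonormal_basis_expand[OF b oriented_frame(1)[OF b]])
  also have "\<dots> = b (oriented_frame b 1) u * b (oriented_frame b 1) v + b (oriented_frame b 2) u * b (oriented_frame b 2) v"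
    using inner_productD(1)[OF b] by (simp add: bilinear_ladd bilinear_lmul)
  finally show ?thesis by (simp add: frame_coord_def)
qed

lemma inner_product_coord_norm: "inner_product b \<Longrightarrow> b v v = (cmod (frame_coord b v))\<^sup>2"
  by (subst inner_product_coord, assumption, unfold cmod_power2) (simp add: power2_eq_square)

lemma linear_hom_coord:
  assumes g: "inner_product g"
  shows "linear (hom_coord g h z w)"
proof (rule linearI)
  fix u v and c :: real
  show "hom_coord g h z w (u + v) = hom_coord g h z w u + hom_coord g h z w v"
    unfolding hom_coord_def frame_coord_linear[OF g] frame_vec_linear[symmetric] by (simp add: algebra_simps)
  show "hom_coord g h z w (c *\<^sub>R v) = c *\<^sub>R hom_coord g h z w v"
    unfolding hom_coord_def frame_coord_linear[OF g] frame_vec_linear[symmetric]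
    by (simp add: scaleR_conv_of_real algebra_simps)
qed

lemma linear_eq_hom_coord:
  assumes g: "inner_product g" and h: "inner_product h" and A: "linear A"
  obtains z w where "A = hom_coord g h z w"
proof -
  let ?p = "frame_coord h (A (oriented_frame g 1))" and ?q = "frame_coord h (A (oriented_frame g 2))"
  \<comment> \<open>As for Wirtinger derivatives: \<open>p\<close> and \<open>q\<close> are the
    images of 1 and \<i>, and the two coefficients solve z + w = p and \<i> (z - w) = q.\<close>
  have "A v = hom_coord g h ((?p - \<i> * ?q) / 2) ((?p + \<i> * ?q) / 2) v" for v
  proof -
    let ?\<zeta> = "frame_coord g v"
    have "A v = A (Re ?\<zeta> *\<^sub>R oriented_frame g 1 + Im ?\<zeta> *\<^sub>R oriented_frame g 2)"
      using frame_vec_coord[OF g, of v] by (simp add: frame_vec_def)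
    also have "frame_coord h \<dots> = Re ?\<zeta> *\<^sub>R ?p + Im ?\<zeta> *\<^sub>R ?q"
      by (simp add: linear_add[OF A] linear_cmul[OF A] frame_coord_linear[OF h])
    also have "\<dots> = (?p - \<i> * ?q) / 2 * ?\<zeta> + (?p + \<i> * ?q) / 2 * cnj ?\<zeta>"
      by (simp add: complex_eq_iff field_simps)
    finally have "frame_coord h (A v) = (?p - \<i> * ?q) / 2 * ?\<zeta> + (?p + \<i> * ?q) / 2 * cnj ?\<zeta>" .
    then show ?thesis using frame_vec_coord[OF h, of "A v"] by (simp add: hom_coord_def)
  qed
  then show thesis using that by blast
qed

lemma frame_coord_hom_coord:
  "inner_product h \<Longrightarrow> frame_coord h (hom_coord g h z w v) = z * frame_coord g v + w * cnj (frame_coord g v)"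
  by (simp add: hom_coord_def frame_coord_vec)

lemma hom_coord_diff:
  "hom_coord g h z w v - hom_coord g h z' w' v = hom_coord g h (z - z') (w - w') v"
  by (simp add: hom_coord_def frame_vec_def algebra_simps)

lemma hom_norm_sq_hom_coord:
  assumes g: "inner_product g" and h: "inner_product h"
  shows "hom_norm_sq g h (hom_coord g h z w) = 2 * (cmod z)\<^sup>2 + 2 * (cmod w)\<^sup>2"
proof -
  have "hom_norm_sq g h (hom_coord g h z w) = (cmod (z + w))\<^sup>2 + (cmod (z * \<i> - w * \<i>))\<^sup>2"
    by (simp add: sum_orthonormal_basis[OF g h oriented_frame(1)[OF g] linear_hom_coord[OF g], symmetric] sum_2
       inner_product_coord_norm[OF h] frame_coord_hom_coord[OF h] frame_coord_frame[OF g])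
  also have "\<dots> = 2 * (cmod z)\<^sup>2 + 2 * (cmod w)\<^sup>2"
    unfolding cmod_power2 by (simp add: algebra_simps power2_eq_square)
  finally show ?thesis .
qed

lemma hom_norm_hom_coord:
  assumes g: "inner_product g" and h: "inner_product h"
  shows "hom_norm g h (hom_coord g h z w) = sqrt (2 * (cmod z)\<^sup>2 + 2 * (cmod w)\<^sup>2)"
  by (simp add: hom_norm_eq[OF g h linear_hom_coord[OF g]] hom_norm_sq_hom_coord[OF g h])

lemma hom_det_hom_coord:
  assumes g: "inner_product g" and h: "inner_product h"
  shows "hom_det g h (hom_coord g h z w) = (cmod z)\<^sup>2 - (cmod w)\<^sup>2"
proof -
  have c: "h (oriented_frame h 1) v = Re (frame_coord h v)" "h (oriented_frame h 2) v = Im (frame_coord h v)" for v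
    by (simp_all add: frame_coord_def)
  show ?thesis
    unfolding hom_det_def det_2 cmod_power2
    by (simp add: c frame_coord_hom_coord[OF h] frame_coord_frame[OF g] algebra_simps power2_eq_square)
qed

section \<open>The sets \<open>SO\<close> and \<open>K\<close> in complex coordinates\<close>

lemma hom_coord_in_SO:
  assumes g: "inner_product g" and h: "inner_product h"
  shows "hom_coord g h z w \<in> SO_set g h \<longleftrightarrow> cmod z = 1 \<and> w = 0"
proof
  assume A: "hom_coord g h z w \<in> SO_set g h"
  then have iso: "h (hom_coord g h z w v) (hom_coord g h z w v) = g v v" for v by (simp add: SO_set_def)
  have *: "(cmod (z * \<zeta> + w * cnj \<zeta>))\<^sup>2 = (cmod \<zeta>)\<^sup>2" for \<zeta>
    using iso[of "frame_vec g \<zeta>"]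
    by (simp add: inner_product_coord_norm g h frame_coord_hom_coord frame_coord_vec)
  \<comment> \<open>Three test vectors determine the pulled back quadratic form: 1 and \<i> give the
    sum of squares and the real part of \<open>z * cnj w\<close>, and \<open>1 + \<i>\<close> gives
    its imaginary part. The sign of the determinant then rules out z = 0.\<close>
  have 1: "(cmod (z + w))\<^sup>2 = 1" "(cmod (z - w))\<^sup>2 = 1" "(cmod (z * (1 + \<i>) + w * (1 - \<i>)))\<^sup>2 = 2"
    using *[of 1] *[of \<i>] *[of "1 + \<i>"] by (simp_all add: cmod_power2 left_diff_distrib[symmetric] norm_mult power_mult_distrib)
  have "Re (z * cnj w) = 0" "Im (z * cnj w) = 0" "(cmod z)\<^sup>2 + (cmod w)\<^sup>2 = 1"
    using 1 unfolding cmod_power2 by (simp_all add: power2_eq_square algebra_simps)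
  then have "z * cnj w = 0" by (simp add: complex_eq_iff)
  moreover have "(cmod z)\<^sup>2 - (cmod w)\<^sup>2 > 0" using A hom_det_hom_coord[OF g h] by (auto simp: SO_set_def)
  ultimately have w: "w = 0" by auto
  then have "(cmod z)\<^sup>2 = 1\<^sup>2" using \<open>(cmod z)\<^sup>2 + (cmod w)\<^sup>2 = 1\<close> by simp
  then show "cmod z = 1 \<and> w = 0" using w by (auto intro: power2_eq_imp_eq)
next
  assume A: "cmod z = 1 \<and> w = 0"
  have "h (hom_coord g h z w u) (hom_coord g h z w v) = g u v" for u v
  proof -
    have "z * frame_coord g u * cnj (z * frame_coord g v) = (z * cnj z) * (frame_coord g u * cnj (frame_coord g v))"
      by (simp add: algebra_simps)
    also have "z * cnj z = 1" using A complex_norm_square[of z] by simp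
    finally have "z * frame_coord g u * cnj (z * frame_coord g v) = frame_coord g u * cnj (frame_coord g v)" by simp
    moreover have "frame_coord h (hom_coord g h z w x) = z * frame_coord g x" for x
      using A by (simp add: frame_coord_hom_coord[OF h])
    ultimately show ?thesis by (simp only: inner_product_coord[OF h] inner_product_coord[OF g, of u v])
  qed
  then show "hom_coord g h z w \<in> SO_set g h"
    using A linear_hom_coord[OF g] by (simp add: SO_set_def hom_det_hom_coord[OF g h])
qed

text \<open>The squares of the singular values add up to the squared norm, and for a nonnegative
  determinant their product is the determinant. So the square of their sum is the squared norm plus
  twice the determinant, which is 4 |z|^2.\<close>

lemma K_set_hom_coordD:
  assumes g: "inner_product g" and h: "inner_product h" and K: "hom_coord g h z w \<in> K_set g h"
  shows "cmod z = 1/2" "cmod w \<le> 1/2"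
proof -
  let ?B = "hom_coord g h z w"
  obtain \<sigma> u where \<sigma>: "\<And>i. 0 \<le> \<sigma> i" "\<sigma> 1 + \<sigma> 2 = 1" and u: "orthonormal_basis g u"
    and sv: "\<And>i v. h (?B (u i)) (?B v) = (\<sigma> i)\<^sup>2 * g (u i) v" and det: "0 \<le> hom_det g h ?B"
    using K unfolding K_set_def singular_values_def by blast
  have gu: "g (u i) (u j) = (if i = j then 1 else 0)" for i j using u by (simp add: orthonormal_basis_def)
  have norm: "2 * (cmod z)\<^sup>2 + 2 * (cmod w)\<^sup>2 = (\<sigma> 1)\<^sup>2 + (\<sigma> 2)\<^sup>2"
    using sum_orthonormal_basis[OF g h u linear_hom_coord[OF g, of h z w]]
    by (simp add: sv gu sum_2 hom_norm_sq_hom_coord[OF g h])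
  define \<alpha> where "\<alpha> = frame_coord g (u 1)"
  define \<beta> where "\<beta> = frame_coord g (u 2)"
  have 1: "cmod \<alpha> = 1" "cmod \<beta> = 1"
    using gu[of 1 1] gu[of 2 2] norm_ge_zero[of \<alpha>] norm_ge_zero[of \<beta>]
    unfolding inner_product_coord_norm[OF g] \<alpha>_def[symmetric] \<beta>_def[symmetric] by (auto simp: power2_eq_1_iff)
  have 2: "Re (\<alpha> * cnj \<beta>) = 0" using gu[of 1 2] by (simp add: inner_product_coord[OF g] \<alpha>_def \<beta>_def)
  define p where "p = z * \<alpha> + w * cnj \<alpha>"
  define q where "q = z * \<beta> + w * cnj \<beta>"
  have 3: "(cmod p)\<^sup>2 = (\<sigma> 1)\<^sup>2" "(cmod q)\<^sup>2 = (\<sigma> 2)\<^sup>2" "Re (p * cnj q) = 0"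
    using sv[of 1 "u 1"] sv[of 2 "u 2"] sv[of 1 "u 2"]
    by (simp_all add: gu inner_product_coord_norm[OF h] inner_product_coord[OF h, of "?B (u 1)" "?B (u 2)"]
        frame_coord_hom_coord[OF h] p_def q_def \<alpha>_def \<beta>_def)
  \<comment> \<open>\<open>Im (cnj x * y)\<close> is the oriented area spanned by \<open>x\<close>
    and \<open>y\<close>, which the map multiplies by its determinant; the next fact is Lagrange's
    identity for this area.\<close>
  have "Im (cnj p * q) = ((cmod z)\<^sup>2 - (cmod w)\<^sup>2) * Im (cnj \<alpha> * \<beta>)"
    unfolding p_def q_def cmod_power2 by (simp add: algebra_simps power2_eq_square)
  moreover have "(Im (cnj x * y))\<^sup>2 = (cmod x)\<^sup>2 * (cmod y)\<^sup>2 - (Re (x * cnj y))\<^sup>2" for x y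
    unfolding cmod_power2 by (simp add: algebra_simps power2_eq_square)
  ultimately have "((cmod z)\<^sup>2 - (cmod w)\<^sup>2)\<^sup>2 * 1 = (\<sigma> 1)\<^sup>2 * (\<sigma> 2)\<^sup>2"
    using 1 2 3 by (metis power_mult_distrib diff_zero mult.right_neutral power_one zero_power2)
  then have "((cmod z)\<^sup>2 - (cmod w)\<^sup>2)\<^sup>2 = (\<sigma> 1 * \<sigma> 2)\<^sup>2" by (simp add: power_mult_distrib)
  then have D: "(cmod z)\<^sup>2 - (cmod w)\<^sup>2 = \<sigma> 1 * \<sigma> 2"
    using det \<sigma>(1) by (simp add: hom_det_hom_coord[OF g h] power2_eq_iff_nonneg)
  have "(2 * cmod z)\<^sup>2 = (\<sigma> 1 + \<sigma> 2)\<^sup>2" using D norm by (simp add: power2_eq_square algebra_simps)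
  then have "(2 * cmod z)\<^sup>2 = 1\<^sup>2" using \<sigma>(2) by simp
  then have "2 * cmod z = 1" by (rule power2_eq_imp_eq) auto
  then show z: "cmod z = 1/2" by simp
  have "(cmod w)\<^sup>2 \<le> (cmod z)\<^sup>2" using D mult_nonneg_nonneg[OF \<sigma>(1)[of 1] \<sigma>(1)[of 2]] by linarith
  then show "cmod w \<le> 1/2" using z by (metis norm_ge_zero power2_le_imp_le)
qed

text \<open>Singular vectors have to be exhibited. The map stretches most in a direction
  \<open>u\<close> in which the conformal and the anticonformal part of the image are parallel, and
  least in the direction \<i> u, where they are opposite.\<close>

lemma K_set_hom_coordI:
  assumes g: "inner_product g" and h: "inner_product h" and z: "cmod z = 1/2" and w: "cmod w \<le> 1/2"
  shows "hom_coord g h z w \<in> K_set g h"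
proof -
  let ?B = "hom_coord g h z w"
  define \<omega> where "\<omega> = cmod w"
  have \<omega>: "0 \<le> \<omega>" "\<omega> \<le> 1/2" using w by (simp_all add: \<omega>_def)
  define \<zeta> where "\<zeta> = 2 * z"
  have \<zeta>: "cmod \<zeta> = 1" "z = \<zeta> / 2" using z by (simp_all add: \<zeta>_def norm_mult)
  \<comment> \<open>This choice makes \<open>w * cnj u\<close> equal to \<omega> \<zeta> u, a
    nonnegative multiple of \<open>z * u\<close>, so the stretching factors of \<open>u\<close> and
    \<open>\<i> * u\<close> are 1/2 + \<omega> and 1/2 - \<omega>.\<close>
  obtain u where u: "cmod u = 1" "w = of_real \<omega> * u\<^sup>2 * \<zeta>"
  proof (cases "w = 0")
    case True then show ?thesis using that[of 1] by (simp add: \<omega>_def)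
  next
    case False
    let ?u = "csqrt (w / (of_real \<omega> * \<zeta>))"
    have "?u\<^sup>2 = w / (of_real \<omega> * \<zeta>)" by simp
    moreover have "cmod (?u\<^sup>2) = 1" using False \<zeta> by (simp add: norm_divide norm_mult \<omega>_def)
    then have "(cmod ?u)\<^sup>2 = 1\<^sup>2" by (simp only: norm_power one_power2)
    then have "cmod ?u = 1" by (rule power2_eq_imp_eq) auto
    moreover have "\<zeta> \<noteq> 0" using \<zeta> by auto
    ultimately show ?thesis using that[of ?u] False by (simp add: \<omega>_def del: power2_csqrt)
  qed
  have uu: "u * cnj u = 1" "\<zeta> * cnj \<zeta> = 1" using u \<zeta> complex_norm_square[of u] complex_norm_square[of \<zeta>] by simp_all
  define e where "e i = frame_vec g (if i = (1::2) then u else \<i> * u)" for i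
  define \<sigma> where "\<sigma> i = (if i = (1::2) then 1/2 + \<omega> else 1/2 - \<omega>)" for i
  have ec: "frame_coord g (e 1) = u" "frame_coord g (e 2) = \<i> * u" by (simp_all add: e_def frame_coord_vec[OF g])
  have e: "orthonormal_basis g e"
    using uu(1) by (auto simp: orthonormal_basis_def forall_2 inner_product_coord[OF g] ec complex_eq_iff algebra_simps)
  have B1: "frame_coord h (?B (e 1)) = of_real (\<sigma> 1) * (\<zeta> * u)"
  proof -
    have "frame_coord h (?B (e 1)) = \<zeta> * u / 2 + of_real \<omega> * u * \<zeta> * (u * cnj u)"
      unfolding frame_coord_hom_coord[OF h] ec \<zeta>(2) u(2) by (simp add: power2_eq_square)
    then show ?thesis by (simp add: uu \<sigma>_def algebra_simps)
  qed
  have B2: "frame_coord h (?B (e 2)) = of_real (\<sigma> 2) * (\<i> * \<zeta> * u)"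
  proof -
    have "frame_coord h (?B (e 2)) = \<i> * \<zeta> * u / 2 - \<i> * of_real \<omega> * u * \<zeta> * (u * cnj u)"
      unfolding frame_coord_hom_coord[OF h] ec \<zeta>(2) u(2) by (simp add: power2_eq_square)
    then show ?thesis by (simp add: uu \<sigma>_def algebra_simps)
  qed
  have on: "h (?B (e i)) (?B (e j)) = (if i = j then (\<sigma> i)\<^sup>2 else 0)" for i j
  proof -
    have P: "Re (\<zeta> * u) * Re (\<zeta> * u) + Im (\<zeta> * u) * Im (\<zeta> * u) = 1"
      using u(1) \<zeta>(1) cmod_power2[of "\<zeta> * u"] by (simp add: norm_mult power2_eq_square)
    have "h (?B (e 1)) (?B (e 1)) = (\<sigma> 1)\<^sup>2 * (Re (\<zeta> * u) * Re (\<zeta> * u) + Im (\<zeta> * u) * Im (\<zeta> * u))"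
      unfolding inner_product_coord[OF h] B1 by (simp add: power2_eq_square algebra_simps)
    moreover have "h (?B (e 2)) (?B (e 2)) = (\<sigma> 2)\<^sup>2 * (Re (\<zeta> * u) * Re (\<zeta> * u) + Im (\<zeta> * u) * Im (\<zeta> * u))"
      unfolding inner_product_coord[OF h] B2 by (simp add: power2_eq_square algebra_simps)
    moreover have "h (?B (e 1)) (?B (e 2)) = 0" "h (?B (e 2)) (?B (e 1)) = 0"
      unfolding inner_product_coord[OF h] B1 B2 by (simp_all add: algebra_simps)
    ultimately show ?thesis unfolding P using exhaust_2[of i] exhaust_2[of j] by auto
  qed
  have sv: "h (?B (e i)) (?B v) = (\<sigma> i)\<^sup>2 * g (e i) v" for i v
  proof -
    have "?B v = ?B (g (e 1) v *\<^sub>R e 1 + g (e 2) v *\<^sub>R e 2)"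
      by (simp add: orthonormal_basis_expand[OF g e])
    also have "\<dots> = g (e 1) v *\<^sub>R ?B (e 1) + g (e 2) v *\<^sub>R ?B (e 2)"
      using linear_hom_coord[OF g] by (simp add: linear_add linear_cmul)
    finally have "h (?B (e i)) (?B v) = g (e 1) v * h (?B (e i)) (?B (e 1)) + g (e 2) v * h (?B (e i)) (?B (e 2))"
      using inner_productD(1)[OF h] by (simp add: bilinear_radd bilinear_rmul)
    then show ?thesis unfolding on using exhaust_2[of i] by auto
  qed
  have "singular_values g h ?B \<sigma>"
    using e sv \<omega> by (auto simp: singular_values_def \<sigma>_def)
  moreover have "\<sigma> 1 + \<sigma> 2 = 1" by (simp add: \<sigma>_def)
  moreover have "0 \<le> hom_det g h ?B"
    using z w by (simp add: hom_det_hom_coord[OF g h] power_mono)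
  ultimately show ?thesis unfolding K_set_def using linear_hom_coord[OF g] by blast
qed

section \<open>Distances to \<open>SO\<close> and \<open>K\<close>\<close>

lemma hom_setdist_eqI:
  assumes "B \<in> S" "hom_norm g h (\<lambda>v. A v - B v) = r" "\<And>B. B \<in> S \<Longrightarrow> r \<le> hom_norm g h (\<lambda>v. A v - B v)"
  shows "hom_setdist g h A S = r"
  unfolding hom_setdist_def using assms by (intro cInf_eq_minimum) auto

lemma hom_coord_cases:
  assumes "inner_product g" "inner_product h" "linear A"
  obtains z w where "A = hom_coord g h z w"
    "hom_norm_sq g h A = 2 * (cmod z)\<^sup>2 + 2 * (cmod w)\<^sup>2" "hom_det g h A = (cmod z)\<^sup>2 - (cmod w)\<^sup>2"
  using linear_eq_hom_coord[OF assms] hom_norm_sq_hom_coord[OF assms(1,2)] hom_det_hom_coord[OF assms(1,2)]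
  by metis

lemma hom_norm_hom_coord_diff:
  assumes "inner_product g" "inner_product h"
  shows "hom_norm g h (\<lambda>v. hom_coord g h z w v - hom_coord g h z' w' v)
    = sqrt (2 * (cmod (z - z'))\<^sup>2 + 2 * (cmod (w - w'))\<^sup>2)"
  using hom_norm_hom_coord[OF assms, of "z - z'" "w - w'"] by (simp add: hom_coord_diff)

lemma hom_norm_sq_plus_det_nonneg:
  assumes "inner_product g" "inner_product h" "linear A"
  shows "0 \<le> hom_norm_sq g h A + 2 * hom_det g h A" "0 \<le> hom_norm_sq g h A - 2 * hom_det g h A"
  by (rule hom_coord_cases[OF assms]; simp)+

text \<open>\<open>u\<close> is the radial projection of \<open>z\<close> to the circle of radius
  \<open>r\<close>; from the centre all points of the circle are equally far.\<close>

lemma norm_diff_scaled_unit: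
  fixes z :: complex
  assumes "r \<ge> 0"
  obtains u where "cmod u = r" "cmod (z - u) = \<bar>cmod z - r\<bar>"
proof (cases "z = 0")
  case True
  then show ?thesis using that[of "of_real r"] assms by simp
next
  case False
  let ?u = "of_real (r / cmod z) * z"
  have "z - ?u = of_real ((cmod z - r) / cmod z) * z" using False by (simp add: field_simps)
  then have "cmod (z - ?u) = \<bar>(cmod z - r) / cmod z\<bar> * cmod z" by (simp only: norm_mult norm_of_real)
  then have "cmod (z - ?u) = \<bar>cmod z - r\<bar>" using False by simp
  moreover have "cmod ?u = r" using False assms by (simp add: norm_mult norm_divide)
  ultimately show ?thesis using that by blast
qed

text \<open>In the coordinates \<open>(z, w)\<close> the set is the unit circle times the origin, so
  the closest element is the radial projection in the first component. Since s = 2 |z| whatever the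
  sign of the determinant, one formula covers all linear maps.\<close>

theorem hom_setdist_SO:
  assumes g: "inner_product g" and h: "inner_product h" and A: "linear A"
  defines "s \<equiv> sqrt (hom_norm_sq g h A + 2 * hom_det g h A)"
  shows "(hom_setdist g h A (SO_set g h))\<^sup>2 = (s - 1)\<^sup>2 + 1 - 2 * hom_det g h A"
proof -
  obtain z w where A': "A = hom_coord g h z w" and n: "hom_norm_sq g h A = 2 * (cmod z)\<^sup>2 + 2 * (cmod w)\<^sup>2"
    and d: "hom_det g h A = (cmod z)\<^sup>2 - (cmod w)\<^sup>2" by (rule hom_coord_cases[OF g h A])
  have s: "s = 2 * cmod z"
    unfolding s_def by (rule real_sqrt_unique) (simp_all add: n d power2_eq_square)
  obtain u where u: "cmod u = 1" "cmod (z - u) = \<bar>cmod z - 1\<bar>" using norm_diff_scaled_unit[of 1 z] by auto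
  define r where "r = sqrt (2 * (cmod z - 1)\<^sup>2 + 2 * (cmod w)\<^sup>2)"
  have "hom_setdist g h A (SO_set g h) = r"
  proof (rule hom_setdist_eqI)
    show "hom_coord g h u 0 \<in> SO_set g h" using hom_coord_in_SO[OF g h] u by simp
    show "hom_norm g h (\<lambda>v. A v - hom_coord g h u 0 v) = r"
      unfolding A' hom_norm_hom_coord_diff[OF g h] r_def using u by simp
    fix B assume B: "B \<in> SO_set g h"
    then obtain z' w' where B': "B = hom_coord g h z' w'"
      using linear_eq_hom_coord[OF g h, of B] by (auto simp: SO_set_def)
    then have *: "cmod z' = 1" "w' = 0" using B hom_coord_in_SO[OF g h] by auto
    have "\<bar>cmod z - 1\<bar> \<le> cmod (z - z')" using norm_triangle_ineq3[of z z'] * by simp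
    then have "(cmod z - 1)\<^sup>2 \<le> (cmod (z - z'))\<^sup>2" by (metis abs_ge_zero power2_abs power_mono)
    then show "r \<le> hom_norm g h (\<lambda>v. A v - B v)"
      unfolding A' B' hom_norm_hom_coord_diff[OF g h] r_def using * by simp
  qed
  then have "(hom_setdist g h A (SO_set g h))\<^sup>2 = 2 * (cmod z - 1)\<^sup>2 + 2 * (cmod w)\<^sup>2" by (simp add: r_def)
  then show ?thesis unfolding s d by (simp add: power2_eq_square algebra_simps)
qed

text \<open>In the coordinates \<open>(z, w)\<close> the set is a circle times a disc, both of
  radius 1/2, so the two components are projected separately. Here s = 2 |z| and d = 2 |w|; the
  halves arise since the squared norm is twice the sum of squares of \<open>z\<close> and
  \<open>w\<close>.\<close>

theorem hom_setdist_K: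
  assumes g: "inner_product g" and h: "inner_product h" and A: "linear A"
  defines "s \<equiv> sqrt (hom_norm_sq g h A + 2 * hom_det g h A)" and "d \<equiv> sqrt (hom_norm_sq g h A - 2 * hom_det g h A)"
  shows "(hom_setdist g h A (K_set g h))\<^sup>2 = (s - 1)\<^sup>2 / 2 + (max (d - 1) 0)\<^sup>2 / 2"
proof -
  obtain z w where A': "A = hom_coord g h z w" and n: "hom_norm_sq g h A = 2 * (cmod z)\<^sup>2 + 2 * (cmod w)\<^sup>2"
    and det: "hom_det g h A = (cmod z)\<^sup>2 - (cmod w)\<^sup>2" by (rule hom_coord_cases[OF g h A])
  have s: "s = 2 * cmod z"
    unfolding s_def by (rule real_sqrt_unique) (simp_all add: n det power2_eq_square)
  have d: "d = 2 * cmod w"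
    unfolding d_def by (rule real_sqrt_unique) (simp_all add: n det power2_eq_square)
  obtain u where u: "cmod u = 1/2" "cmod (z - u) = \<bar>cmod z - 1/2\<bar>" using norm_diff_scaled_unit[of "1/2" z] by auto
  obtain v where v: "cmod v \<le> 1/2" "cmod (w - v) = max (cmod w - 1/2) 0"
  proof (cases "cmod w \<le> 1/2")
    case True then show ?thesis using that[of w] by simp
  next
    case False
    obtain v where "cmod v = 1/2" "cmod (w - v) = \<bar>cmod w - 1/2\<bar>" using norm_diff_scaled_unit[of "1/2" w] by auto
    then show ?thesis using that[of v] False by simp
  qed
  define r where "r = sqrt (2 * (cmod z - 1/2)\<^sup>2 + 2 * (max (cmod w - 1/2) 0)\<^sup>2)"
  have "hom_setdist g h A (K_set g h) = r"
  proof (rule hom_setdist_eqI)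
    show "hom_coord g h u v \<in> K_set g h" using K_set_hom_coordI[OF g h] u v by simp
    show "hom_norm g h (\<lambda>x. A x - hom_coord g h u v x) = r"
      unfolding A' hom_norm_hom_coord_diff[OF g h] r_def u v by simp
    fix B assume B: "B \<in> K_set g h"
    then obtain z' w' where B': "B = hom_coord g h z' w'"
      using linear_eq_hom_coord[OF g h, of B] by (auto simp: K_set_def)
    then have *: "cmod z' = 1/2" "cmod w' \<le> 1/2" using B K_set_hom_coordD[OF g h] by auto
    have "\<bar>cmod z - 1/2\<bar> \<le> cmod (z - z')" using norm_triangle_ineq3[of z z'] * by simp
    then have 1: "(cmod z - 1/2)\<^sup>2 \<le> (cmod (z - z'))\<^sup>2" by (metis abs_ge_zero power2_abs power_mono)
    have "max (cmod w - 1/2) 0 \<le> cmod (w - w')" using norm_triangle_ineq2[of w w'] *(2) norm_ge_zero[of "w - w'"] by linarith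
    then have 2: "(max (cmod w - 1/2) 0)\<^sup>2 \<le> (cmod (w - w'))\<^sup>2" by (intro power_mono) auto
    show "r \<le> hom_norm g h (\<lambda>v. A v - B v)"
      unfolding A' B' hom_norm_hom_coord_diff[OF g h] r_def by (intro real_sqrt_le_mono add_mono mult_left_mono 1 2) auto
  qed
  then have "(hom_setdist g h A (K_set g h))\<^sup>2 = 2 * (cmod z - 1/2)\<^sup>2 + 2 * (max (cmod w - 1/2) 0)\<^sup>2"
    by (simp add: r_def)
  moreover have "max (d - 1) 0 = 2 * max (cmod w - 1/2) 0" unfolding d by (simp add: max_def)
  moreover have "(2 * cmod z - 1)\<^sup>2 / 2 = 2 * (cmod z - 1/2)\<^sup>2" by (simp add: power2_eq_square field_simps)
  moreover have "(2 * m)\<^sup>2 / 2 = 2 * m\<^sup>2" for m :: real by (simp add: power2_eq_square)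
  ultimately show ?thesis unfolding s by (simp only:)
qed

text \<open>A nonnegative determinant gives \<open>d \<le> s\<close>; hence the second summand of
  \<open>hom_setdist_K\<close> lies between 0 and the first one.\<close>

lemma hom_setdist_K_bounds:
  assumes g: "inner_product g" and h: "inner_product h" and A: "linear A" and det: "0 \<le> hom_det g h A"
  defines "s \<equiv> sqrt (hom_norm_sq g h A + 2 * hom_det g h A)"
  shows "(hom_setdist g h A (K_set g h))\<^sup>2 \<le> (s - 1)\<^sup>2" "(s - 1)\<^sup>2 \<le> 2 * (hom_setdist g h A (K_set g h))\<^sup>2"
proof -
  define d where "d = sqrt (hom_norm_sq g h A - 2 * hom_det g h A)"
  have eq: "(hom_setdist g h A (K_set g h))\<^sup>2 = (s - 1)\<^sup>2 / 2 + (max (d - 1) 0)\<^sup>2 / 2"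
    unfolding s_def d_def by (rule hom_setdist_K[OF g h A])
  have "d \<le> s" unfolding d_def s_def using det by simp
  then have "(max (d - 1) 0)\<^sup>2 \<le> (s - 1)\<^sup>2" by (cases "d \<le> 1") (auto intro!: power_mono simp: max_def)
  then show "(hom_setdist g h A (K_set g h))\<^sup>2 \<le> (s - 1)\<^sup>2" "(s - 1)\<^sup>2 \<le> 2 * (hom_setdist g h A (K_set g h))\<^sup>2"
    unfolding eq by (auto simp: field_simps)
qed

section \<open>Rademacher's theorem in the plane\<close>

lemma negligible_lipschitz_image_real:
  fixes F :: "real \<Rightarrow> real"
  assumes F: "\<And>x y. \<bar>F x - F y\<bar> \<le> C * \<bar>x - y\<bar>" and A: "negligible A"
  shows "negligible (F ` A)"
proof (rule negligible_locally_Lipschitz_image[OF _ A])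
  fix x assume "x \<in> A"
  show "\<exists>T B. open T \<and> x \<in> T \<and> (\<forall>y\<in>A \<inter> T. norm (F y - F x) \<le> B * norm (y - x))"
    using F by (intro exI[of _ UNIV] exI[of _ C]) auto
qed auto

text \<open>\<^term>\<open>\<lambda>x. h x + (L + 1) * x\<close> is a bi-Lipschitz homeomorphism; the image of Lebesgue measure
  under its inverse has a density, whose Lebesgue points are points of right differentiability.\<close>

lemma lipschitz_real_right_derivative:
  fixes h :: "real \<Rightarrow> real"
  assumes L: "\<And>x y. \<bar>h x - h y\<bar> \<le> L * \<bar>x - y\<bar>"
  obtains N k where "negligible N"
    "\<And>s. s \<notin> N \<Longrightarrow> (\<lambda>n. (h (s + 1 / (real n + 1)) - h s) * (real n + 1)) \<longlonglongrightarrow> k s"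
    "\<And>a b. a \<le> b \<Longrightarrow> (k has_integral (h b - h a)) {a..b}"
proof -
  have L0: "L \<ge> 0" using L[of 1 0] by (metis abs_ge_zero abs_one diff_zero mult.right_neutral order_trans)
  \<comment> \<open>The added slope \<open>L + 1\<close> outweighs the Lipschitz constant by one, so
    \<open>F\<close> does not contract distances and its inverse \<open>G\<close> is
    1-Lipschitz.\<close>
  define F where "F = (\<lambda>x. h x + (L + 1) * x)"
  have Fge: "F y - F x \<ge> y - x" if "x \<le> y" for x y
  proof -
    have "h x - h y \<le> L * (y - x)" using L[of x y] that by (simp add: abs_if split: if_splits)
    then show ?thesis unfolding F_def by (simp add: algebra_simps)
  qed
  have Flip: "\<bar>F x - F y\<bar> \<le> (2 * L + 1) * \<bar>x - y\<bar>" for x y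
  proof -
    have "\<bar>F x - F y\<bar> \<le> \<bar>h x - h y\<bar> + \<bar>(L + 1) * (x - y)\<bar>" unfolding F_def by (simp add: algebra_simps)
    also have "\<dots> \<le> L * \<bar>x - y\<bar> + (L + 1) * \<bar>x - y\<bar>" using L[of x y] L0 by (simp add: abs_mult)
    finally show ?thesis by (simp add: algebra_simps)
  qed
  have Fcont: "continuous_on UNIV F"
    by (rule lipschitz_on_continuous_on[of "2 * L + 1"]) (use Flip L0 in \<open>auto intro!: lipschitz_onI simp: dist_real_def\<close>)
  have Fmono: "x < y \<Longrightarrow> F x < F y" for x y using Fge[of x y] by simp
  have Finj: "inj F" by (metis Fmono injI linorder_neqE_linordered_idom order_less_irrefl)
  have Fsurj: "surj F"
  proof -
    have "\<exists>x. F x = y" for y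
    proof -
      define r where "r = \<bar>y - F 0\<bar>"
      have 1: "F r \<ge> y" using Fge[of 0 r] unfolding r_def by auto
      have 2: "F (- r) \<le> y" using Fge[of "-r" 0] unfolding r_def by auto
      have "\<exists>x. -r \<le> x \<and> x \<le> r \<and> F x = y"
        by (rule IVT') (use 1 2 Fcont continuous_on_subset in \<open>auto simp: r_def\<close>)
      then show ?thesis by blast
    qed
    then show ?thesis by (metis surjI)
  qed
  have Flt: "F x < F y \<longleftrightarrow> x < y" for x y by (metis Fmono linorder_neqE_linordered_idom order_less_asym)
  have Fle: "F x \<le> F y \<longleftrightarrow> x \<le> y" for x y using Flt by (meson not_less)
  define G where "G = inv F"
  have GF: "G (F x) = x" and FG: "F (G y) = y" for x y
    using Finj Fsurj by (simp_all add: G_def surj_f_inv_f)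
  have Glip: "\<bar>G x - G y\<bar> \<le> \<bar>x - y\<bar>" for x y
    using Fge[of "G x" "G y"] Fge[of "G y" "G x"] by (cases "G x \<le> G y") (auto simp: FG)
  have Gcont: "continuous_on UNIV G"
    by (rule lipschitz_on_continuous_on[of 1]) (use Glip in \<open>auto intro!: lipschitz_onI simp: dist_real_def\<close>)
  have Gm[measurable]: "G \<in> borel_measurable borel" by (rule borel_measurable_continuous_onI[OF Gcont])
  define N where "N = distr lborel borel G"
  have GA: "G -` A = F ` A" for A by (auto simp: image_iff FG GF) (metis FG)
  \<comment> \<open>The preimage of \<open>A\<close> under \<open>G\<close> is the image of
    \<open>A\<close> under the Lipschitz map \<open>F\<close>, which preserves null sets.\<close>
  have ac: "absolutely_continuous lborel N"
    unfolding absolutely_continuous_def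
  proof
    fix A assume A: "A \<in> null_sets (lborel :: real measure)"
    then have "negligible A" by (simp add: negligible_iff_null_sets null_sets_completionI)
    then have "negligible (F ` A)" using Flip by (rule negligible_lipschitz_image_real[rotated])
    then have *: "F ` A \<in> null_sets (completion lborel)" by (simp add: negligible_iff_null_sets)
    have Ab: "A \<in> sets borel" using A by auto
    then have B: "F ` A \<in> sets lborel" using measurable_sets_borel[OF Gm Ab] by (simp add: GA)
    then have "F ` A \<in> null_sets lborel" using * null_sets_completion_iff[OF B] by blast
    then show "A \<in> null_sets N"
      unfolding N_def using Ab by (auto simp: null_sets_def emeasure_distr GA)
  qed
  obtain k0 where k0[measurable]: "k0 \<in> borel_measurable lborel" and Nk: "density lborel k0 = N"
    using sigma_finite_measure.Radon_Nikodym[OF sigma_finite_lborel ac] by (auto simp: N_def)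
  \<comment> \<open>The preimage of an interval under \<open>G\<close> is the interval of its
    \<open>F\<close>-values, so the density integrates to increments of \<open>F\<close>.\<close>
  have int_k0: "(\<integral>\<^sup>+x. k0 x * indicator {a..b} x \<partial>lborel) = ennreal (F b - F a)" if "a \<le> b" for a b
  proof -
    have "(\<integral>\<^sup>+x. k0 x * indicator {a..b} x \<partial>lborel) = emeasure (density lborel k0) {a..b}"
      by (simp add: emeasure_density)
    also have "\<dots> = emeasure lborel (G -` {a..b})" unfolding Nk N_def by (simp add: emeasure_distr)
    also have "G -` {a..b} = {F a..F b}"
      by (auto, (metis FG Fle)+)
    finally show ?thesis using that by (simp add: Fle)
  qed
  define k1 where "k1 x = enn2real (k0 x)" for x
  have k1m[measurable]: "k1 \<in> borel_measurable borel" unfolding k1_def by measurable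
  have fin: "AE x in lborel. k0 x \<noteq> \<infinity>"
  proof -
    have "AE x in lborel. k0 x * indicator {- real n..real n} x \<noteq> \<infinity>" for n
      by (rule nn_integral_PInf_AE) (simp_all add: int_k0)
    then have "AE x in lborel. \<forall>n. k0 x * indicator {- real n..real n} x \<noteq> \<infinity>"
      by (simp add: AE_all_countable)
    then show ?thesis
    proof eventually_elim
      case (elim x)
      obtain n where "\<bar>x\<bar> \<le> real n" using real_arch_simple by blast
      then have "x \<in> {-real n..real n}" by auto
      then show ?case using elim[rule_format, of n] by simp
    qed
  qed
  have k1int: "(k1 has_integral (F b - F a)) {a..b}" if "a \<le> b" for a b
  proof -
    have "(\<integral>\<^sup>+x. ennreal (k1 x * indicator {a..b} x) \<partial>lborel) = (\<integral>\<^sup>+x. k0 x * indicator {a..b} x \<partial>lborel)"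
      by (rule nn_integral_cong_AE) (use fin in \<open>eventually_elim, auto simp: k1_def indicator_def top.not_eq_extremum\<close>)
    then have "((\<lambda>x. k1 x * indicator {a..b} x) has_integral (F b - F a)) UNIV"
      by (intro nn_integral_has_integral) (use int_k0[OF that] that in \<open>auto simp: Fle k1_def\<close>)
    then have "((\<lambda>x. if x \<in> {a..b} then k1 x else 0) has_integral (F b - F a)) UNIV"
      by (rule has_integral_cong[THEN iffD1, rotated]) (auto simp: indicator_def)
    then show ?thesis by (simp only: has_integral_restrict_UNIV)
  qed
  have "k1 integrable_on cbox a b" for a b
    by (cases "a \<le> b") (use k1int in \<open>auto simp: cbox_interval integrable_on_def\<close>)
  \<comment> \<open>The differentiation theorem averages over intervals that start at
    \<open>x\<close>, and therefore yields derivatives from the right.\<close>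
  then obtain M where M: "negligible M"
     "\<And>x e. \<lbrakk>x \<notin> M; 0 < e\<rbrakk> \<Longrightarrow> \<exists>d>0. \<forall>h. 0 < h \<and> h < d \<longrightarrow>
                         norm(integral (cbox x (x + h *\<^sub>R One)) k1 /\<^sub>R h ^ DIM(real) - k1 x) < e"
    using integrable_ccontinuous_explicit[of k1] by blast
  show ?thesis
  proof
    show "negligible M" by fact
    show "((\<lambda>x. k1 x - (L + 1)) has_integral (h b - h a)) {a..b}" if "a \<le> b" for a b
    proof -
      have "((\<lambda>x. k1 x - (L + 1)) has_integral (F b - F a - (b - a) *\<^sub>R (L + 1))) {a..b}"
        by (intro has_integral_diff k1int that) (use has_integral_const_real[of "L+1" a b] that in simp)
      then show ?thesis by (simp add: F_def algebra_simps)
    qed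
    show "(\<lambda>n. (h (s + 1 / (real n + 1)) - h s) * (real n + 1)) \<longlonglongrightarrow> k1 s - (L + 1)" if s: "s \<notin> M" for s
    proof (rule LIMSEQ_I)
      fix e :: real assume "e > 0"
      then obtain d where d: "d > 0" "\<And>h. 0 < h \<Longrightarrow> h < d \<Longrightarrow>
                         norm(integral (cbox s (s + h *\<^sub>R One)) k1 /\<^sub>R h ^ DIM(real) - k1 s) < e"
        using M(2)[OF s] by blast
      obtain n0 where n0: "1 / (real n0 + 1) < d"
        using reals_Archimedean[OF d(1)] by (auto simp: inverse_eq_divide add.commute)
      show "\<exists>no. \<forall>n\<ge>no. norm ((h (s + 1 / (real n + 1)) - h s) * (real n + 1) - (k1 s - (L + 1))) < e"
      proof (intro exI[of _ n0] allI impI)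
        fix n assume "n \<ge> n0"
        define t where "t = 1 / (real n + 1)"
        have t: "0 < t" "t < d"
          using n0 \<open>n \<ge> n0\<close> unfolding t_def by (auto intro!: order.strict_trans1[OF _ n0] frac_le)
        have "integral (cbox s (s + t *\<^sub>R One)) k1 = F (s + t) - F s"
          using k1int[of s "s + t"] t by (simp add: cbox_interval integral_unique)
        then have "norm ((F (s + t) - F s) / t - k1 s) < e" using d(2)[OF t] by (simp add: divide_inverse mult.commute)
        moreover have "(F (s + t) - F s) / t = (h (s + t) - h s) * (real n + 1) + (L + 1)"
        proof -
          have "(F (s + t) - F s) / t = (h (s + t) - h s + (L + 1) * t) / t" by (simp add: F_def algebra_simps)
          also have "\<dots> = (h (s + t) - h s) * (1 / t) + (L + 1)" using t by (simp add: add_divide_distrib)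
          also have "1 / t = real n + 1" by (simp add: t_def)
          finally show ?thesis .
        qed
        ultimately show "norm ((h (s + 1 / (real n + 1)) - h s) * (real n + 1) - (k1 s - (L + 1))) < e"
          by (simp add: t_def algebra_simps)
      qed
    qed
  qed
qed

text \<open>The one-dimensional result produces a derivative on each line separately. Defining
  \<open>g\<close> as the limit of one fixed sequence of difference quotients makes it a single
  Borel function of both variables that agrees almost everywhere on each line with the derivative
  there.\<close>

lemma lipschitz_partial_derivative_fst:
  fixes f :: "real \<times> real \<Rightarrow> real"
  assumes L: "\<And>x y. \<bar>f x - f y\<bar> \<le> L * dist x y"
  obtains g where "g \<in> borel_measurable borel" "\<And>x. \<bar>g x\<bar> \<le> L"
    "\<And>a b t. a \<le> b \<Longrightarrow> ((\<lambda>s. g (s, t)) has_integral (f (b, t) - f (a, t))) {a..b}"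
proof -
  have L0: "L \<ge> 0" using L[of "(0,0)" "(1,0)"] by (simp add: dist_Pair_Pair)
  have "continuous_on UNIV f"
    by (rule lipschitz_on_continuous_on[of L]) (use L L0 in \<open>auto intro!: lipschitz_onI simp: dist_real_def\<close>)
  then have fm[measurable]: "f \<in> borel_measurable borel" by (rule borel_measurable_continuous_onI)
  define q where "q n x = (f (x + (1 / (real n + 1), 0)) - f x) * (real n + 1)" for n x
  have qm[measurable]: "q n \<in> borel_measurable borel" for n unfolding q_def by measurable
  have qL: "\<bar>q n x\<bar> \<le> L" for n x
  proof -
    have "\<bar>q n x\<bar> = \<bar>f (x + (1 / (real n + 1), 0)) - f x\<bar> * (real n + 1)" by (simp add: q_def abs_mult)
    also have "\<dots> \<le> (L * dist (x + (1 / (real n + 1), 0)) x) * (real n + 1)"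
      by (intro mult_right_mono L) auto
    also have "dist (x + (1 / (real n + 1), 0)) x = 1 / (real n + 1)"
      by (cases x) (simp add: dist_Pair_Pair dist_real_def)
    finally show ?thesis by simp
  qed
  \<comment> \<open>Where the quotients diverge, \<open>lim\<close> is an arbitrary value; cutting
    off at -L and L keeps the bound at every point and changes nothing where they converge.\<close>
  define g where "g x = max (- L) (min L (lim (\<lambda>n. q n x)))" for x
  show ?thesis
  proof
    show "g \<in> borel_measurable borel" unfolding g_def by measurable
    show "\<bar>g x\<bar> \<le> L" for x using L0 by (auto simp: g_def max_def min_def abs_if)
    fix a b t :: real assume ab: "a \<le> b"
    have 1: "\<bar>f (x, t) - f (y, t)\<bar> \<le> L * \<bar>x - y\<bar>" for x y
      using L[of "(x, t)" "(y, t)"] by (simp add: dist_Pair_Pair dist_real_def)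
    obtain N k where N: "negligible N"
      and k: "\<And>s. s \<notin> N \<Longrightarrow> (\<lambda>n. (f (s + 1 / (real n + 1), t) - f (s, t)) * (real n + 1)) \<longlonglongrightarrow> k s"
      and int: "\<And>a b. a \<le> b \<Longrightarrow> (k has_integral (f (b, t) - f (a, t))) {a..b}"
      by (rule lipschitz_real_right_derivative[of "\<lambda>s. f (s, t)", OF 1]) blast
    show "((\<lambda>s. g (s, t)) has_integral (f (b, t) - f (a, t))) {a..b}"
    proof (rule has_integral_spike[OF N _ int[OF ab]])
      fix s assume "s \<in> {a..b} - N"
      then have lim: "(\<lambda>n. q n (s, t)) \<longlonglongrightarrow> k s" using k[of s] by (simp add: q_def)
      have "\<bar>k s\<bar> \<le> L"
        by (rule LIMSEQ_le_const2[OF tendsto_rabs[OF lim]]) (use qL in auto)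
      then show "g (s, t) = k s" using limI[OF lim] by (simp add: g_def)
    qed
  qed
qed

section \<open>Lebesgue points, slices and differentiability on quadrants\<close>

lemma nn_integral_eq_HK_integral:
  fixes u :: "'a::euclidean_space \<Rightarrow> real"
  assumes "\<And>x. 0 \<le> u x" "u integrable_on S"
  shows "(\<integral>\<^sup>+z. ennreal (u z) * indicator S z \<partial>lborel) = ennreal (integral S u)"
proof -
  have "(\<integral>\<^sup>+z. ennreal (indicator S z * u z) \<partial>lborel) = ennreal (integral S u)"
    by (rule nn_integral_has_integral_lebesgue) (use assms in auto)
  moreover have "ennreal (indicator S z * u z) = ennreal (u z) * indicator S z" for z
    by (simp add: indicator_def)
  ultimately show ?thesis by simp
qed

lemma bounded_borel_integrable_on_cbox:
  fixes u :: "'a::euclidean_space \<Rightarrow> real"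
  assumes u: "u \<in> borel_measurable borel" and "\<And>x. \<bar>u x\<bar> \<le> K"
  shows "u integrable_on cbox a b"
proof (rule measurable_bounded_by_integrable_imp_integrable_real)
  show "u \<in> borel_measurable (lebesgue_on (cbox a b))"
    using u by (simp add: measurable_completion measurable_restrict_space1)
  show "(\<lambda>x. K) integrable_on cbox a b" by (rule integrable_const)
qed (use assms in auto)

text \<open>The differentiation theorem is applied to |g - q| for each rational \<open>q\<close>,
  which discards countably many null sets. Then \<open>q\<close> is chosen close to the value of
  \<open>g\<close> at the point.\<close>

lemma lebesgue_points_corner:
  fixes g :: "'a::euclidean_space \<Rightarrow> real"
  assumes g[measurable]: "g \<in> borel_measurable borel" and K: "\<And>x. \<bar>g x\<bar> \<le> K"
  obtains N where "negligible N"
    "\<And>x e. \<lbrakk>x \<notin> N; 0 < e\<rbrakk> \<Longrightarrow> \<exists>d>0. \<forall>h. 0 < h \<and> h < d \<longrightarrow>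
       (\<integral>\<^sup>+z. ennreal \<bar>g z - g x\<bar> * indicator (cbox x (x + h *\<^sub>R One)) z \<partial>lborel) \<le> ennreal (e * h ^ DIM('a))"
proof -
  have bd: "\<bar>\<bar>g x - q\<bar>\<bar> \<le> K + \<bar>q\<bar>" for x q using K[of x] by (simp add: abs_if split: if_splits)
  have int: "(\<lambda>x. \<bar>g x - q\<bar>) integrable_on cbox a b" for a b q
    by (rule bounded_borel_integrable_on_cbox[OF _ bd]) simp
  have "\<exists>N. negligible N \<and> (\<forall>x e. x \<notin> N \<longrightarrow> 0 < e \<longrightarrow> (\<exists>d>0. \<forall>h. 0 < h \<and> h < d \<longrightarrow>
          norm (integral (cbox x (x + h *\<^sub>R One)) (\<lambda>x. \<bar>g x - q\<bar>) /\<^sub>R h ^ DIM('a) - \<bar>g x - q\<bar>) < e))" for q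
    by (rule integrable_ccontinuous_explicit[OF int[of q]]) blast
  then obtain N where N: "\<And>q. negligible (N q)" and Nq: "\<And>q x e. x \<notin> N q \<Longrightarrow> 0 < e \<Longrightarrow> (\<exists>d>0. \<forall>h. 0 < h \<and> h < d \<longrightarrow>
          norm (integral (cbox x (x + h *\<^sub>R One)) (\<lambda>x. \<bar>g x - q\<bar>) /\<^sub>R h ^ DIM('a) - \<bar>g x - q\<bar>) < e)"
    by metis
  show ?thesis
  proof
    show "negligible (\<Union>q\<in>\<rat>. N q)" by (rule negligible_countable_Union) (auto simp: N countable_rat)
    fix x e assume x: "x \<notin> (\<Union>q\<in>\<rat>. N q)" and e: "0 < (e::real)"
    \<comment> \<open>The average of |g - q| is close to |g x - q|, hence below 2 e / 3, and
      replacing \<open>q\<close> by \<open>g x\<close> costs another e / 3.\<close>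
    obtain q where q: "q \<in> \<rat>" "g x < q" "q < g x + e/3"
      using Rats_dense_in_real[of "g x" "g x + e/3"] e by auto
    obtain d where d: "d > 0" and dh: "\<And>h. 0 < h \<Longrightarrow> h < d \<Longrightarrow>
          norm (integral (cbox x (x + h *\<^sub>R One)) (\<lambda>x. \<bar>g x - q\<bar>) /\<^sub>R h ^ DIM('a) - \<bar>g x - q\<bar>) < e/3"
      using Nq[of x q "e/3"] x q e by auto
    show "\<exists>d>0. \<forall>h. 0 < h \<and> h < d \<longrightarrow>
       (\<integral>\<^sup>+z. ennreal \<bar>g z - g x\<bar> * indicator (cbox x (x + h *\<^sub>R One)) z \<partial>lborel) \<le> ennreal (e * h ^ DIM('a))"
    proof (intro exI[of _ d] conjI d allI impI)
      fix h assume h: "0 < h \<and> h < d"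
      let ?C = "cbox x (x + h *\<^sub>R One)"
      have hD: "h ^ DIM('a) > 0" using h by simp
      have cont: "measure lborel ?C = h ^ DIM('a)"
      proof -
        have "measure lborel ?C = (\<Prod>i\<in>Basis. (x + h *\<^sub>R One) \<bullet> i - x \<bullet> i)"
          using h by (intro content_cbox) (simp add: inner_add_left)
        also have "\<dots> = (\<Prod>i\<in>(Basis::'a set). h)" by (intro prod.cong) (simp_all add: inner_add_left)
        finally show ?thesis by simp
      qed
      have "integral ?C (\<lambda>x. \<bar>g x - q\<bar>) / h ^ DIM('a) < 2 * e / 3"
      proof -
        have "\<bar>integral ?C (\<lambda>x. \<bar>g x - q\<bar>) / h ^ DIM('a) - \<bar>g x - q\<bar>\<bar> < e/3"
          using dh[of h] h unfolding real_norm_def real_scaleR_def by (simp only: divide_inverse mult.commute)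
        moreover have "\<bar>g x - q\<bar> < e/3" using q by linarith
        ultimately show ?thesis by linarith
      qed
      then have 1: "integral ?C (\<lambda>x. \<bar>g x - q\<bar>) \<le> (2 * e / 3) * h ^ DIM('a)"
        using hD by (simp add: field_simps)
      have "integral ?C (\<lambda>z. \<bar>g z - g x\<bar>) \<le> integral ?C (\<lambda>z. \<bar>g z - q\<bar> + e/3)"
        by (intro integral_le int integrable_add integrable_const) (use q in auto)
      also have "\<dots> = integral ?C (\<lambda>z. \<bar>g z - q\<bar>) + e/3 * h ^ DIM('a)"
        by (subst integral_add) (auto intro: int simp: cont)
      also have "\<dots> \<le> e * h ^ DIM('a)" using 1 by (simp add: field_simps)
      finally have 2: "integral ?C (\<lambda>z. \<bar>g z - g x\<bar>) \<le> e * h ^ DIM('a)" .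
      have "(\<integral>\<^sup>+z. ennreal \<bar>g z - g x\<bar> * indicator ?C z \<partial>lborel) = ennreal (integral ?C (\<lambda>z. \<bar>g z - g x\<bar>))"
        by (rule nn_integral_eq_HK_integral) (auto intro: int)
      then show "(\<integral>\<^sup>+z. ennreal \<bar>g z - g x\<bar> * indicator ?C z \<partial>lborel) \<le> ennreal (e * h ^ DIM('a))"
        using 2 by (simp add: ennreal_leI)
    qed
  qed
qed

text \<open>If \<open>u\<close> exceeded \<open>D\<close> on the whole interval, its integral would
  be at least D \<delta>, which is more than C \<delta>.\<close>

lemma small_slice_exists:
  fixes u :: "real \<Rightarrow> ennreal"
  assumes u[measurable]: "u \<in> borel_measurable borel" and d: "\<delta> > 0" and C: "C \<ge> 0"
    and le: "(\<integral>\<^sup>+t. u t * indicator {a..a + \<delta>} t \<partial>lborel) \<le> ennreal (C * \<delta>)" and D: "C < D"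
  obtains t where "a \<le> t" "t \<le> a + \<delta>" "u t \<le> ennreal D"
proof -
  have "\<exists>t\<in>{a..a+\<delta>}. u t \<le> ennreal D"
  proof (rule ccontr)
    assume "\<not> ?thesis"
    then have "(\<integral>\<^sup>+t. ennreal D * indicator {a..a + \<delta>} t \<partial>lborel) \<le> (\<integral>\<^sup>+t. u t * indicator {a..a + \<delta>} t \<partial>lborel)"
      by (intro nn_integral_mono) (auto simp: indicator_def not_le less_imp_le)
    also have "(\<integral>\<^sup>+t. ennreal D * indicator {a..a + \<delta>} t \<partial>lborel) = ennreal (D * \<delta>)"
      using d C D by (simp add: nn_integral_cmult_indicator ennreal_mult)
    finally have "ennreal (D * \<delta>) \<le> ennreal (C * \<delta>)" using le by (rule order_trans)
    then have "D * \<delta> \<le> C * \<delta>" using d C by simp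
    then show False using d D by simp
  qed
  then show thesis using that by auto
qed

lemma line_difference_bound:
  fixes g :: "real \<Rightarrow> real"
  assumes g[measurable]: "g \<in> borel_measurable borel" and K: "\<And>s. \<bar>g s\<bar> \<le> K"
    and int: "(g has_integral v) {p..q}" and sub: "c \<le> p" "p \<le> q" "q \<le> d" and B: "B \<ge> 0"
    and le: "(\<integral>\<^sup>+s. ennreal \<bar>g s - \<alpha>\<bar> * indicator {c..d} s \<partial>lborel) \<le> ennreal B"
  shows "\<bar>v - \<alpha> * (q - p)\<bar> \<le> B"
proof -
  have bd: "\<bar>\<bar>g s - \<alpha>\<bar>\<bar> \<le> K + \<bar>\<alpha>\<bar>" for s using K[of s] by (simp add: abs_if split: if_splits)
  have i1: "(\<lambda>s. \<bar>g s - \<alpha>\<bar>) integrable_on {a..b}" for a b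
    using bounded_borel_integrable_on_cbox[OF _ bd, where a=a and b=b] by (simp add: cbox_interval)
  have i2: "((\<lambda>s. g s - \<alpha>) has_integral (v - \<alpha> * (q - p))) {p..q}"
    using has_integral_diff[OF int has_integral_const_real[of \<alpha> p q]] sub by (simp add: mult.commute)
  have "norm (integral {p..q} (\<lambda>s. g s - \<alpha>)) \<le> integral {p..q} (\<lambda>s. \<bar>g s - \<alpha>\<bar>)"
    by (rule integral_norm_bound_integral) (use i1 i2 in auto)
  then have 1: "\<bar>v - \<alpha> * (q - p)\<bar> \<le> integral {p..q} (\<lambda>s. \<bar>g s - \<alpha>\<bar>)"
    using integral_unique[OF i2] by simp
  also have "\<dots> \<le> integral {c..d} (\<lambda>s. \<bar>g s - \<alpha>\<bar>)"
    by (rule integral_subset_le) (use sub i1 in auto)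
  finally have 2: "\<bar>v - \<alpha> * (q - p)\<bar> \<le> integral {c..d} (\<lambda>s. \<bar>g s - \<alpha>\<bar>)" .
  have "(\<integral>\<^sup>+z. ennreal \<bar>g z - \<alpha>\<bar> * indicator {c..d} z \<partial>lborel) = ennreal (integral {c..d} (\<lambda>s. \<bar>g s - \<alpha>\<bar>))"
    by (rule nn_integral_eq_HK_integral) (auto intro: i1)
  then have "ennreal (integral {c..d} (\<lambda>s. \<bar>g s - \<alpha>\<bar>)) \<le> ennreal B"
    using le by simp
  then show ?thesis using 2 B by simp
qed

lemma corner_square_pair:
  "cbox (x :: real \<times> real) (x + h *\<^sub>R One) = {fst x..fst x + h} \<times> {snd x..snd x + h}"
proof -
  have "One = ((1, 1) :: real \<times> real)"
    by (simp add: Basis_prod_def sum.union_disjoint sum.reindex inj_on_def disjoint_iff image_iff zero_prod_def)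
  then show ?thesis by (cases x) (auto simp: cbox_Pair_eq)
qed

text \<open>Compare \<^term>\<open>f (x + y) - f x\<close> with the difference along an axis-parallel broken line that
  starts at \<^term>\<open>x + t\<close>, where the shift \<^term>\<open>t\<close> is small compared to \<^term>\<open>y\<close> and chosen such that
  the partial derivatives are on average close to their values at \<^term>\<open>x\<close> along this line.\<close>

lemma lipschitz_quadrant_differentiable:
  fixes f :: "real \<times> real \<Rightarrow> real"
  assumes L: "\<And>x y. \<bar>f x - f y\<bar> \<le> L * dist x y"
    and g1[measurable]: "g1 \<in> borel_measurable borel" and K1: "\<And>x. \<bar>g1 x\<bar> \<le> L"
    and g2[measurable]: "g2 \<in> borel_measurable borel" and K2: "\<And>x. \<bar>g2 x\<bar> \<le> L"
    and F1: "\<And>a b t. a \<le> b \<Longrightarrow> ((\<lambda>s. g1 (s, t)) has_integral (f (b, t) - f (a, t))) {a..b}"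
    and F2: "\<And>a b t. a \<le> b \<Longrightarrow> ((\<lambda>s. g2 (t, s)) has_integral (f (t, b) - f (t, a))) {a..b}"
  obtains N where "negligible N"
    "\<And>x \<eta>. x \<notin> N \<Longrightarrow> 0 < \<eta> \<Longrightarrow> \<exists>d>0. \<forall>y1 y2. 0 \<le> y1 \<longrightarrow> 0 \<le> y2 \<longrightarrow> norm (y1, y2) < d \<longrightarrow>
       \<bar>f (x + (y1, y2)) - f x - (g1 x * y1 + g2 x * y2)\<bar> \<le> \<eta> * norm (y1, y2)"
proof -
  have L0: "L \<ge> 0" using K1[of 0] by linarith
  have D2: "DIM(real \<times> real) = 2" by simp
  obtain N1 where N1: "negligible N1" and P1: "\<And>x e. \<lbrakk>x \<notin> N1; 0 < e\<rbrakk> \<Longrightarrow> \<exists>d>0. \<forall>h. 0 < h \<and> h < d \<longrightarrow>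
       (\<integral>\<^sup>+z. ennreal \<bar>g1 z - g1 x\<bar> * indicator (cbox x (x + h *\<^sub>R One)) z \<partial>lborel) \<le> ennreal (e * h\<^sup>2)"
    by (rule lebesgue_points_corner[OF g1 K1, unfolded D2]) blast
  obtain N2 where N2: "negligible N2" and P2: "\<And>x e. \<lbrakk>x \<notin> N2; 0 < e\<rbrakk> \<Longrightarrow> \<exists>d>0. \<forall>h. 0 < h \<and> h < d \<longrightarrow>
       (\<integral>\<^sup>+z. ennreal \<bar>g2 z - g2 x\<bar> * indicator (cbox x (x + h *\<^sub>R One)) z \<partial>lborel) \<le> ennreal (e * h\<^sup>2)"
    by (rule lebesgue_points_corner[OF g2 K2, unfolded D2]) blast
  show ?thesis
  proof
    show "negligible (N1 \<union> N2)" using N1 N2 by (rule negligible_Un)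
    fix x and \<eta> :: real assume x: "x \<notin> N1 \<union> N2" and \<eta>: "0 < \<eta>"
    \<comment> \<open>Ratio of the shift to the size of the increment. The shift costs at most 4 L
      \<kappa> m in the end; the summand 1 in the denominator covers L = 0.\<close>
    define \<kappa> where "\<kappa> = min 1 (\<eta> / (2 * (8 * L + 1)))"
    have \<kappa>: "0 < \<kappa>" "\<kappa> \<le> 1" "8 * L * \<kappa> \<le> \<eta> / 2"
    proof -
      show "0 < \<kappa>" "\<kappa> \<le> 1" using \<eta> L0 by (auto simp: \<kappa>_def)
      have a: "8 * L * \<kappa> \<le> (8 * L + 1) * (\<eta> / (2 * (8 * L + 1)))"
        using L0 \<eta> by (intro mult_mono) (auto simp: \<kappa>_def)
      have M: "M * (\<eta> / (2 * M)) = \<eta> / 2" if "M > 0" for M :: real using that by (simp add: field_simps)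
      have "8 * L + 1 > 0" using L0 by simp
      from M[OF this] a show "8 * L * \<kappa> \<le> \<eta> / 2" by (simp only:)
    qed
    \<comment> \<open>With h = 2 m and \<delta> = \<kappa> m this makes C = e h^2 / \<delta> equal
      to \<eta> m / 8, half of the bound \<open>D\<close> allowed for each leg of the broken
      line.\<close>
    define e where "e = \<eta> * \<kappa> / 32"
    have e: "e > 0" using \<eta> \<kappa> by (simp add: e_def)
    obtain d1 where d1: "d1 > 0" "\<And>h. 0 < h \<Longrightarrow> h < d1 \<Longrightarrow> (\<integral>\<^sup>+z. ennreal \<bar>g1 z - g1 x\<bar> * indicator (cbox x (x + h *\<^sub>R One)) z \<partial>lborel) \<le> ennreal (e * h\<^sup>2)"
      using P1[of x e] x e by auto
    obtain d2 where d2: "d2 > 0" "\<And>h. 0 < h \<Longrightarrow> h < d2 \<Longrightarrow> (\<integral>\<^sup>+z. ennreal \<bar>g2 z - g2 x\<bar> * indicator (cbox x (x + h *\<^sub>R One)) z \<partial>lborel) \<le> ennreal (e * h\<^sup>2)"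
      using P2[of x e] x e by auto
    obtain x1 x2 where xx: "x = (x1, x2)" by (cases x)
    show "\<exists>d>0. \<forall>y1 y2. 0 \<le> y1 \<longrightarrow> 0 \<le> y2 \<longrightarrow> norm (y1, y2) < d \<longrightarrow>
       \<bar>f (x + (y1, y2)) - f x - (g1 x * y1 + g2 x * y2)\<bar> \<le> \<eta> * norm (y1, y2)"
    proof (intro exI[of _ "min d1 d2 / 2"] conjI allI impI)
      show "min d1 d2 / 2 > 0" using d1 d2 by simp
      fix y1 y2 :: real assume y: "0 \<le> y1" "0 \<le> y2" and yd: "norm (y1, y2) < min d1 d2 / 2"
      define m where "m = max y1 y2"
      have m_norm: "m \<le> norm (y1, y2)"
        using real_sqrt_sum_squares_ge1[of y1 y2] real_sqrt_sum_squares_ge2[of y1 y2] by (simp add: norm_Pair m_def)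
      show "\<bar>f (x + (y1, y2)) - f x - (g1 x * y1 + g2 x * y2)\<bar> \<le> \<eta> * norm (y1, y2)"
      proof (cases "m = 0")
        case True
        then have "y1 = 0" "y2 = 0" using y by (auto simp: m_def max_def split: if_splits)
        then show ?thesis by (simp flip: zero_prod_def)
      next
        case False
        then have m: "m > 0" "y1 \<le> m" "y2 \<le> m" using y by (auto simp: m_def)
        \<comment> \<open>Both increments are at most \<open>m\<close> and the shift is at most
          \<open>m\<close> in each direction, so the square of side 2 m at \<open>x\<close> contains
          the broken line.\<close>
        define h where "h = 2 * m"
        define \<delta> where "\<delta> = \<kappa> * m"
        have \<delta>: "0 < \<delta>" "\<delta> \<le> m" using \<kappa> m by (auto simp: \<delta>_def mult_left_le_one_le)
        have h: "0 < h" "h < d1" "h < d2" using m m_norm yd by (auto simp: h_def)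
        define C where "C = e * h\<^sup>2 / \<delta>"
        have C: "C \<ge> 0" "C * \<delta> = e * h\<^sup>2" using e \<delta> by (auto simp: C_def)
        have C': "C = \<eta> * m / 8" using \<kappa> m by (simp add: C_def e_def h_def \<delta>_def power2_eq_square)
        define D where "D = \<eta> * m / 4"
        have CD: "C < D" using \<eta> m by (simp add: C' D_def)
        have box: "indicator (cbox x (x + h *\<^sub>R One)) (s, t) = (indicator {x1..x1+h} s * indicator {x2..x2+h} t :: ennreal)" for s t
          by (auto simp: corner_square_pair xx indicator_def)
        define U1 where "U1 t = (\<integral>\<^sup>+s. ennreal \<bar>g1 (s, t) - g1 x\<bar> * indicator {x1..x1+h} s \<partial>lborel)" for t
        have U1m[measurable]: "U1 \<in> borel_measurable borel" unfolding U1_def by measurable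
        have "(\<integral>\<^sup>+t. U1 t * indicator {x2..x2+\<delta>} t \<partial>lborel) \<le> (\<integral>\<^sup>+t. U1 t * indicator {x2..x2+h} t \<partial>lborel)"
          by (intro nn_integral_mono) (use \<delta> m in \<open>auto simp: indicator_def h_def\<close>)
        also have "\<dots> = (\<integral>\<^sup>+t. \<integral>\<^sup>+s. ennreal \<bar>g1 (s, t) - g1 x\<bar> * indicator (cbox x (x + h *\<^sub>R One)) (s, t) \<partial>lborel \<partial>lborel)"
          unfolding U1_def box by (intro nn_integral_cong) (simp add: nn_integral_multc mult.assoc[symmetric])
        also have "\<dots> = (\<integral>\<^sup>+z. ennreal \<bar>g1 z - g1 x\<bar> * indicator (cbox x (x + h *\<^sub>R One)) z \<partial>(lborel \<Otimes>\<^sub>M lborel))"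
          by (rule lborel_pair.nn_integral_snd, unfold lborel_prod) measurable
        also have "\<dots> \<le> ennreal (C * \<delta>)" unfolding C(2) lborel_prod by (rule d1(2)) (use h in auto)
        finally obtain t2 where t2: "x2 \<le> t2" "t2 \<le> x2 + \<delta>" "U1 t2 \<le> ennreal D"
          by (rule small_slice_exists[OF U1m \<delta>(1) C(1) _ CD])
        define U2 where "U2 s = (\<integral>\<^sup>+t. ennreal \<bar>g2 (s, t) - g2 x\<bar> * indicator {x2..x2+h} t \<partial>lborel)" for s
        have U2m[measurable]: "U2 \<in> borel_measurable borel" unfolding U2_def by measurable
        have "(\<integral>\<^sup>+s. U2 s * indicator {x1+y1..x1+y1+\<delta>} s \<partial>lborel) \<le> (\<integral>\<^sup>+s. U2 s * indicator {x1..x1+h} s \<partial>lborel)"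
          by (intro nn_integral_mono) (use \<delta> m y in \<open>auto simp: indicator_def h_def\<close>)
        also have "\<dots> = (\<integral>\<^sup>+s. \<integral>\<^sup>+t. ennreal \<bar>g2 (s, t) - g2 x\<bar> * indicator (cbox x (x + h *\<^sub>R One)) (s, t) \<partial>lborel \<partial>lborel)"
          unfolding U2_def box by (intro nn_integral_cong) (simp add: nn_integral_cmult[symmetric] ac_simps)
        also have "\<dots> = (\<integral>\<^sup>+z. ennreal \<bar>g2 z - g2 x\<bar> * indicator (cbox x (x + h *\<^sub>R One)) z \<partial>(lborel \<Otimes>\<^sub>M lborel))"
          by (rule lborel.nn_integral_fst, unfold lborel_prod) measurable
        also have "\<dots> \<le> ennreal (C * \<delta>)" unfolding C(2) lborel_prod by (rule d2(2)) (use h in auto)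
        finally obtain t1 where t1: "x1 + y1 \<le> t1" "t1 \<le> x1 + y1 + \<delta>" "U2 t1 \<le> ennreal D"
          by (rule small_slice_exists[OF U2m \<delta>(1) C(1) _ CD])
        have D0: "D \<ge> 0" using \<eta> m by (simp add: D_def)
        \<comment> \<open>The horizontal leg at height \<open>t2\<close>; the vertical leg above
          \<open>t1\<close> follows. Both heights were chosen such that the slice integrals are
          small.\<close>
        have A: "\<bar>f (t1, t2) - f (t1 - y1, t2) - g1 x * (t1 - (t1 - y1))\<bar> \<le> D"
          by (rule line_difference_bound[where g="\<lambda>s. g1 (s, t2)" and K=L and c=x1 and d="x1+h"])
             (use K1 F1 t1 t2 y m \<delta> D0 in \<open>auto simp: U1_def h_def\<close>)
        have B: "\<bar>f (t1, t2 + y2) - f (t1, t2) - g2 x * (t2 + y2 - t2)\<bar> \<le> D"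
          by (rule line_difference_bound[where g="\<lambda>s. g2 (t1, s)" and K=L and c=x2 and d="x2+h"])
             (use K2 F2 t1 t2 y m \<delta> D0 in \<open>auto simp: U2_def h_def\<close>)
        have near: "\<bar>f (a, b) - f (c, d)\<bar> \<le> 2 * L * \<delta>" if "\<bar>a - c\<bar> \<le> \<delta>" "\<bar>b - d\<bar> \<le> \<delta>" for a b c d
        proof -
          have "dist (a, b) (c, d) \<le> dist a c + dist b d"
            by (simp add: dist_Pair_Pair sqrt_sum_squares_le_sum)
          then have "L * dist (a, b) (c, d) \<le> L * (2 * \<delta>)"
            using that L0 by (intro mult_left_mono) (auto simp: dist_real_def)
          then show ?thesis using L[of "(a, b)" "(c, d)"] by simp
        qed
        \<comment> \<open>The endpoints of the broken line differ from \<open>x\<close> and from the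
          shifted point by at most \<delta> in each coordinate.\<close>
        have E1: "\<bar>f (x1 + y1, x2 + y2) - f (t1, t2 + y2)\<bar> \<le> 2 * L * \<delta>" by (rule near) (use t1 t2 in auto)
        have E2: "\<bar>f (x1, x2) - f (t1 - y1, t2)\<bar> \<le> 2 * L * \<delta>" by (rule near) (use t1 t2 in auto)
        have "\<bar>f (x1 + y1, x2 + y2) - f (x1, x2) - (g1 x * y1 + g2 x * y2)\<bar> \<le> 2 * D + 4 * L * \<delta>"
          using A B E1 E2 by (simp add: abs_le_iff)
        also have "\<dots> = \<eta> * m / 2 + (8 * L * \<kappa>) * m / 2" by (simp add: D_def \<delta>_def)
        also have "\<dots> \<le> \<eta> * m / 2 + (\<eta> / 2) * m / 2"
          using \<kappa>(3) m by (intro add_left_mono divide_right_mono mult_right_mono) auto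
        also have "\<dots> \<le> \<eta> * m" using \<eta> m by simp
        also have "\<dots> \<le> \<eta> * norm (y1, y2)" using m_norm \<eta> by simp
        finally show ?thesis by (simp add: xx)
      qed
    qed
  qed
qed

text \<open>Averages over squares with corner \<open>x\<close> see one quadrant only. The quadrant
  result is applied to the four functions obtained by reflecting the coordinates, with signs
  \<sigma> and \<tau>; all four give the same linear map, built from \<open>g1\<close> and
  \<open>g2\<close>.\<close>

lemma lipschitz_differentiable_ae_pair:
  fixes f :: "real \<times> real \<Rightarrow> real"
  assumes L: "\<And>x y. \<bar>f x - f y\<bar> \<le> L * dist x y"
  obtains N where "negligible N" "\<And>x. x \<notin> N \<Longrightarrow> f differentiable (at x)"
proof -
  obtain g1 where g1: "g1 \<in> borel_measurable borel" "\<And>x. \<bar>g1 x\<bar> \<le> L"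
    and F1: "\<And>a b t. a \<le> b \<Longrightarrow> ((\<lambda>s. g1 (s, t)) has_integral (f (b, t) - f (a, t))) {a..b}"
    using lipschitz_partial_derivative_fst[OF L] by blast
  have "\<bar>(f \<circ> prod.swap) x - (f \<circ> prod.swap) y\<bar> \<le> L * dist x y" for x y
    using L[of "prod.swap x" "prod.swap y"] by (cases x, cases y) (simp add: dist_Pair_Pair add.commute)
  then obtain g2' where g2': "g2' \<in> borel_measurable borel" "\<And>x. \<bar>g2' x\<bar> \<le> L"
    and F2': "\<And>a b t. a \<le> b \<Longrightarrow> ((\<lambda>s. g2' (s, t)) has_integral ((f \<circ> prod.swap) (b, t) - (f \<circ> prod.swap) (a, t))) {a..b}"
    using lipschitz_partial_derivative_fst[of "f \<circ> prod.swap" L] by blast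
  define g2 where "g2 = g2' \<circ> prod.swap"
  have swap[measurable]: "prod.swap \<in> borel_measurable (borel :: (real \<times> real) measure)"
    by (intro borel_measurable_continuous_onI continuous_on_swap)
  have g2: "g2 \<in> borel_measurable borel" "\<And>x. \<bar>g2 x\<bar> \<le> L"
    using measurable_compose[OF swap g2'(1)] g2'(2) by (simp_all add: g2_def comp_def)
  have F2: "((\<lambda>s. g2 (t, s)) has_integral (f (t, b) - f (t, a))) {a..b}" if "a \<le> b" for a b t
    using F2'[OF that, of t] by (simp add: g2_def)
  \<comment> \<open>The reflected partial derivatives still have to integrate to increments of the
    reflected function, which explains the factor \<sigma> in front.\<close>
  have reflect: "((\<lambda>s. \<sigma> * k (\<sigma> * s)) has_integral (K (\<sigma> * b) - K (\<sigma> * a))) {a..b}"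
    if k: "\<And>a b. a \<le> b \<Longrightarrow> (k has_integral (K b - K a)) {a..b}" and "a \<le> b" and \<sigma>: "\<sigma> = 1 \<or> \<sigma> = -1"
    for k K :: "real \<Rightarrow> real" and a b \<sigma>
  proof (cases "\<sigma> = 1")
    case True then show ?thesis using k[OF \<open>a \<le> b\<close>] by simp
  next
    case False
    then have s: "\<sigma> = -1" using \<sigma> by simp
    have "(k has_integral (K (- a) - K (- b))) {-b..-a}" using k[of "-b" "-a"] \<open>a \<le> b\<close> by simp
    then have "((\<lambda>s. k (- s)) has_integral (K (- a) - K (- b))) {a..b}"
      using has_integral_reflect_real[where f=k and a="-b" and b="-a"] by simp
    from has_integral_neg[OF this] show ?thesis by (simp add: s)
  qed
  define H where "H \<sigma> \<tau> x \<eta> d \<longleftrightarrow> (\<forall>y1 y2. 0 \<le> y1 \<longrightarrow> 0 \<le> y2 \<longrightarrow> norm (y1, y2) < d \<longrightarrow>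
       \<bar>f (x + (\<sigma> * y1, \<tau> * y2)) - f x - (g1 x * (\<sigma> * y1) + g2 x * (\<tau> * y2))\<bar> \<le> \<eta> * norm (y1, y2))"
    for \<sigma> \<tau> \<eta> d :: real and x
  have quad: "\<exists>N. negligible N \<and> (\<forall>x \<eta>. x \<notin> N \<longrightarrow> 0 < \<eta> \<longrightarrow> (\<exists>d>0. H \<sigma> \<tau> x \<eta> d))"
    if \<sigma>: "\<sigma> = 1 \<or> \<sigma> = -1" and \<tau>: "\<tau> = 1 \<or> \<tau> = -1" for \<sigma> \<tau> :: real
  proof -
    define R where "R = (\<lambda>x :: real \<times> real. (\<sigma> * fst x, \<tau> * snd x))"
    have RR: "R (R x) = x" for x using \<sigma> \<tau> by (auto simp: R_def)
    have Radd: "R (x + y) = R x + R y" for x y by (simp add: R_def algebra_simps)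
    have Rlin: "linear R" by (auto intro!: linearI simp: R_def algebra_simps)
    have Rdist: "dist (R x) (R y) = dist x y" for x y
      using \<sigma> \<tau> by (cases x, cases y) (auto simp: R_def dist_Pair_Pair dist_real_def abs_minus_commute power2_commute)
    have Rm[measurable]: "R \<in> borel_measurable borel"
      by (intro borel_measurable_continuous_onI linear_continuous_on linear_conv_bounded_linear[THEN iffD1] Rlin)
    have 1: "\<bar>(f \<circ> R) x - (f \<circ> R) y\<bar> \<le> L * dist x y" for x y using L[of "R x" "R y"] by (simp add: Rdist)
    have 2: "(\<lambda>x. \<sigma> * g1 (R x)) \<in> borel_measurable borel" "(\<lambda>x. \<tau> * g2 (R x)) \<in> borel_measurable borel"
      using g1(1) g2(1) by measurable
    have 3: "\<bar>\<sigma> * g1 (R x)\<bar> \<le> L" "\<bar>\<tau> * g2 (R x)\<bar> \<le> L" for x using \<sigma> \<tau> g1(2)[of "R x"] g2(2)[of "R x"] by (auto simp: abs_mult)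
    have 4: "((\<lambda>s. \<sigma> * g1 (R (s, t))) has_integral ((f \<circ> R) (b, t) - (f \<circ> R) (a, t))) {a..b}" if "a \<le> b" for a b t
      using reflect[OF F1 that \<sigma>] by (simp add: R_def)
    have 5: "((\<lambda>s. \<tau> * g2 (R (t, s))) has_integral ((f \<circ> R) (t, b) - (f \<circ> R) (t, a))) {a..b}" if "a \<le> b" for a b t
      using reflect[OF F2 that \<tau>] by (simp add: R_def)
    obtain N where N: "negligible N" and P:
      "\<And>x \<eta>. x \<notin> N \<Longrightarrow> 0 < \<eta> \<Longrightarrow> \<exists>d>0. \<forall>y1 y2. 0 \<le> y1 \<longrightarrow> 0 \<le> y2 \<longrightarrow> norm (y1, y2) < d \<longrightarrow>
       \<bar>(f \<circ> R) (x + (y1, y2)) - (f \<circ> R) x - (\<sigma> * g1 (R x) * y1 + \<tau> * g2 (R x) * y2)\<bar> \<le> \<eta> * norm (y1, y2)"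
      using lipschitz_quadrant_differentiable[OF 1 2(1) 3(1) 2(2) 3(2) 4 5] by blast
    show ?thesis
    proof (intro exI[of _ "R ` N"] conjI allI impI)
      show "negligible (R ` N)" by (rule negligible_differentiable_image_negligible[OF order_refl N]) (use Rlin in \<open>simp add: linear_conv_bounded_linear bounded_linear_imp_differentiable_on\<close>)
      fix x and \<eta> :: real assume x: "x \<notin> R ` N" and \<eta>: "0 < \<eta>"
      then have "R x \<notin> N" by (metis RR image_eqI)
      from P[OF this \<eta>] show "\<exists>d>0. H \<sigma> \<tau> x \<eta> d" unfolding H_def
        by (simp add: Radd RR) (simp add: R_def mult.assoc mult.left_commute)
    qed
  qed
  have "\<forall>\<sigma> \<tau>. \<exists>N. \<sigma> \<in> {1,-1} \<longrightarrow> \<tau> \<in> {1,-1} \<longrightarrow> negligible N \<and> (\<forall>x \<eta>. x \<notin> N \<longrightarrow> 0 < \<eta> \<longrightarrow> (\<exists>d>0. H \<sigma> \<tau> x \<eta> d))"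
  proof (intro allI)
    fix \<sigma> \<tau> :: real
    show "\<exists>N. \<sigma> \<in> {1,-1} \<longrightarrow> \<tau> \<in> {1,-1} \<longrightarrow> negligible N \<and> (\<forall>x \<eta>. x \<notin> N \<longrightarrow> 0 < \<eta> \<longrightarrow> (\<exists>d>0. H \<sigma> \<tau> x \<eta> d))"
    proof (cases "(\<sigma> = 1 \<or> \<sigma> = -1) \<and> (\<tau> = 1 \<or> \<tau> = -1)")
      case True
      then obtain N where "negligible N" "\<forall>x \<eta>. x \<notin> N \<longrightarrow> 0 < \<eta> \<longrightarrow> (\<exists>d>0. H \<sigma> \<tau> x \<eta> d)"
        using quad[OF conjunct1[OF True] conjunct2[OF True]] by (elim exE conjE)
      then show ?thesis by (intro exI[of _ N] impI conjI)
    next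
      case False
      then show ?thesis by (intro exI[of _ "{}"]) blast
    qed
  qed
  then obtain N where N: "\<And>\<sigma> \<tau>. \<sigma> \<in> {1,-1} \<Longrightarrow> \<tau> \<in> {1,-1} \<Longrightarrow> negligible (N \<sigma> \<tau>)"
    and P: "\<And>\<sigma> \<tau> x \<eta>. \<sigma> \<in> {1,-1} \<Longrightarrow> \<tau> \<in> {1,-1} \<Longrightarrow> x \<notin> N \<sigma> \<tau> \<Longrightarrow> 0 < \<eta> \<Longrightarrow> \<exists>d>0. H \<sigma> \<tau> x \<eta> d"
    by metis
  define M where "M = N 1 1 \<union> N 1 (-1) \<union> N (-1) 1 \<union> N (-1) (-1)"
  show ?thesis
  proof
    show "negligible M" unfolding M_def by (intro negligible_Un N) auto
    fix x assume x: "x \<notin> M"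
    have "(f has_derivative (\<lambda>y. g1 x * fst y + g2 x * snd y)) (at x)"
      unfolding has_derivative_at_alt
    proof (intro conjI allI impI)
      show "bounded_linear (\<lambda>y. g1 x * fst y + g2 x * snd y)"
        by (intro bounded_linear_add bounded_linear_mult_right[THEN bounded_linear_compose] bounded_linear_fst bounded_linear_snd)
      fix \<eta> :: real assume \<eta>: "0 < \<eta>"
      have "\<exists>d>0. H \<sigma> \<tau> x \<eta> d" if "\<sigma> \<in> {1,-1}" "\<tau> \<in> {1,-1}" for \<sigma> \<tau>
        by (rule P[OF that _ \<eta>]) (use that x in \<open>auto simp: M_def\<close>)
      then have "\<forall>\<sigma> \<tau>. \<exists>d. \<sigma> \<in> {1,-1} \<longrightarrow> \<tau> \<in> {1,-1} \<longrightarrow> 0 < d \<and> H \<sigma> \<tau> x \<eta> d" by blast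
      then obtain d where d: "\<And>\<sigma> \<tau>. \<sigma> \<in> {1,-1} \<Longrightarrow> \<tau> \<in> {1,-1} \<Longrightarrow> 0 < d \<sigma> \<tau>"
        and dP: "\<And>\<sigma> \<tau>. \<sigma> \<in> {1,-1} \<Longrightarrow> \<tau> \<in> {1,-1} \<Longrightarrow> H \<sigma> \<tau> x \<eta> (d \<sigma> \<tau>)"
        by metis
      \<comment> \<open>Every increment lies in one of the four closed quadrants, so the smallest of
        the four radii serves them all.\<close>
      define d0 where "d0 = min (min (d 1 1) (d 1 (-1))) (min (d (-1) 1) (d (-1) (-1)))"
      show "\<exists>d>0. \<forall>y. norm (y - x) < d \<longrightarrow> norm (f y - f x - (g1 x * fst (y - x) + g2 x * snd (y - x))) \<le> \<eta> * norm (y - x)"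
      proof (intro exI[of _ d0] conjI allI impI)
        show "0 < d0" using d by (simp add: d0_def)
        fix y assume y: "norm (y - x) < d0"
        define a where "a = fst (y - x)"
        define b where "b = snd (y - x)"
        have ab: "y = x + (a, b)" by (simp add: a_def b_def prod_eq_iff)
        define \<sigma> where "\<sigma> = (if a \<ge> 0 then 1 else -1 :: real)"
        define \<tau> where "\<tau> = (if b \<ge> 0 then 1 else -1 :: real)"
        have st: "\<sigma> \<in> {1,-1}" "\<tau> \<in> {1,-1}" by (auto simp: \<sigma>_def \<tau>_def)
        have *: "\<sigma> * \<bar>a\<bar> = a" "\<tau> * \<bar>b\<bar> = b" by (auto simp: \<sigma>_def \<tau>_def)
        have nn: "norm (\<bar>a\<bar>, \<bar>b\<bar>) = norm (y - x)" by (simp add: ab norm_Pair)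
        have "d0 \<le> d \<sigma> \<tau>" using st by (auto simp: d0_def)
        then have "\<bar>f (x + (\<sigma> * \<bar>a\<bar>, \<tau> * \<bar>b\<bar>)) - f x - (g1 x * (\<sigma> * \<bar>a\<bar>) + g2 x * (\<tau> * \<bar>b\<bar>))\<bar> \<le> \<eta> * norm (\<bar>a\<bar>, \<bar>b\<bar>)"
          using y nn dP[OF st, unfolded H_def, rule_format, of "\<bar>a\<bar>" "\<bar>b\<bar>"] by simp
        then show "norm (f y - f x - (g1 x * fst (y - x) + g2 x * snd (y - x))) \<le> \<eta> * norm (y - x)"
          unfolding * nn by (simp add: ab)
      qed
    qed
    then show "f differentiable (at x)" by (rule differentiableI)
  qed
qed

section \<open>From pairs to vectors, and from global to local Lipschitz maps\<close>

lemma negligible_pair_image_real2: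
  fixes N :: "(real \<times> real) set"
  assumes "negligible N"
  shows "negligible ((\<lambda>x. vector [fst x, snd x] :: real^2) ` N)"
proof (rule negligible_differentiable_image_negligible[OF _ assms])
  have "linear (\<lambda>x :: real \<times> real. vector [fst x, snd x] :: real^2)"
    by (rule linearI) (simp_all add: vec_eq_iff forall_2)
  then show "(\<lambda>x :: real \<times> real. vector [fst x, snd x] :: real^2) differentiable_on N"
    by (simp add: linear_conv_bounded_linear bounded_linear_imp_differentiable_on)
qed simp

theorem rademacher_real2:
  fixes f :: "real^2 \<Rightarrow> real^2"
  assumes L: "L-lipschitz_on UNIV f"
  obtains N where "negligible N" "\<And>x. x \<notin> N \<Longrightarrow> f differentiable (at x)"
proof -
  define P where "P = (\<lambda>x :: real \<times> real. vector [fst x, snd x] :: real^2)"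
  define Q where "Q = (\<lambda>x :: real^2. (x $ 1, x $ 2))"
  have PQ: "P (Q x) = x" for x by (simp add: P_def Q_def vec_eq_iff forall_2)
  have dP: "dist (P x) (P y) = dist x y" for x y
    by (cases x, cases y) (simp add: P_def dist_vec_def L2_set_def sum_2 dist_Pair_Pair)
  have L0: "L \<ge> 0" using L by (rule lipschitz_on_nonneg)
  have "\<bar>f (P x) $ i - f (P y) $ i\<bar> \<le> L * dist x y" for i x y
  proof -
    have "\<bar>f (P x) $ i - f (P y) $ i\<bar> \<le> dist (f (P x)) (f (P y))"
      by (metis dist_real_def dist_vec_nth_le)
    also have "\<dots> \<le> L * dist (P x) (P y)" using lipschitz_onD[OF L] by simp
    finally show ?thesis by (simp add: dP)
  qed
  note lip = this
  have "\<exists>N. negligible N \<and> (\<forall>x. x \<notin> N \<longrightarrow> (\<lambda>x. f (P x) $ i) differentiable (at x))" for i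
    by (rule lipschitz_differentiable_ae_pair[of "\<lambda>x. f (P x) $ i" L, OF lip]) blast
  then obtain N where N: "\<And>i. negligible (N i)" "\<And>i x. x \<notin> N i \<Longrightarrow> (\<lambda>x. f (P x) $ i) differentiable (at x)"
    by metis
  show ?thesis
  proof
    show "negligible (P ` N 1 \<union> P ` N 2)"
      unfolding P_def by (intro negligible_Un negligible_pair_image_real2 N)
    fix x assume "x \<notin> P ` N 1 \<union> P ` N 2"
    then have "Q x \<notin> N i" for i using PQ exhaust_2[of i] by (metis UnCI image_eqI)
    then have "(\<lambda>x. f (P x) $ i) differentiable (at (Q x))" for i by (rule N(2))
    moreover have "Q differentiable (at x)"
    proof -
      have "linear Q" by (rule linearI) (simp_all add: Q_def)
      then show ?thesis by (simp add: linear_conv_bounded_linear bounded_linear_imp_differentiable)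
    qed
    ultimately have "((\<lambda>x. f (P x) $ i) \<circ> Q) differentiable (at x)" for i by (intro differentiable_chain_at)
    then have "(\<lambda>x. f x $ i) differentiable (at x)" for i by (simp add: comp_def PQ)
    then show "f differentiable (at x)"
      by (subst differentiable_componentwise_within) (auto simp: Basis_vec_def inner_axis)
  qed
qed

text \<open>Composing with the projection to a small closed ball, which is 1-Lipschitz, extends the
  restriction of \<open>f\<close> to a Lipschitz map of the whole plane and leaves \<open>f\<close>
  unchanged inside the ball.\<close>

corollary rademacher_locally:
  fixes f :: "real^2 \<Rightarrow> real^2"
  assumes S: "open S" and L: "\<And>x. x \<in> S \<Longrightarrow> \<exists>e>0. \<exists>L. L-lipschitz_on (S \<inter> ball x e) f"
  shows "negligible {x\<in>S. \<not> f differentiable (at x)}"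
proof (rule locally_negligible_alt[THEN iffD2], rule ballI)
  fix x assume "x \<in> {x\<in>S. \<not> f differentiable (at x)}"
  then have x: "x \<in> S" "\<not> f differentiable (at x)" by auto
  obtain e L where e: "e > 0" "L-lipschitz_on (S \<inter> ball x e) f" using L[OF x(1)] by blast
  obtain r0 where r0: "r0 > 0" "ball x r0 \<subseteq> S" using S x(1) by (auto simp: open_contains_ball)
  define r where "r = min e r0 / 2"
  have r: "r > 0" "cball x r \<subseteq> S \<inter> ball x e" using e r0 by (force simp: r_def)+
  let ?c = "closest_point (cball x r)"
  have c: "?c y \<in> cball x r" for y using r by (intro closest_point_in_set) auto
  have "L-lipschitz_on UNIV (f \<circ> ?c)"
  proof (rule lipschitz_onI)
    show "0 \<le> L" using e(2) by (rule lipschitz_on_nonneg)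
    fix y z
    have "dist (f (?c y)) (f (?c z)) \<le> L * dist (?c y) (?c z)"
      using lipschitz_onD[OF e(2)] c r by blast
    also have "\<dots> \<le> L * dist y z"
      using r \<open>0 \<le> L\<close> by (intro mult_left_mono closest_point_lipschitz) auto
    finally show "dist ((f \<circ> ?c) y) ((f \<circ> ?c) z) \<le> L * dist y z" by simp
  qed
  then obtain N where N: "negligible N" "\<And>x. x \<notin> N \<Longrightarrow> (f \<circ> ?c) differentiable (at x)"
    using rademacher_real2 by blast
  let ?U = "{x\<in>S. \<not> f differentiable (at x)}"
  show "\<exists>V. openin (top_of_set ?U) V \<and> x \<in> V \<and> negligible V"
  proof (intro exI[of _ "?U \<inter> ball x r"] conjI)
    show "openin (top_of_set ?U) (?U \<inter> ball x r)" by (intro openin_open_Int) simp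
    show "x \<in> ?U \<inter> ball x r" using x r by simp
    have "?U \<inter> ball x r \<subseteq> N"
    proof safe
      fix y assume y: "y \<in> S" "\<not> f differentiable (at y)" "y \<in> ball x r"
      show "y \<in> N"
      proof (rule ccontr)
        assume "y \<notin> N"
        then have "(f \<circ> ?c) differentiable (at y)" by (rule N)
        then obtain D where "((f \<circ> ?c) has_derivative D) (at y)" unfolding differentiable_def by blast
        then have "(f has_derivative D) (at y)"
          by (rule has_derivative_transform_within_open[of _ _ _ _ "ball x r"])
             (use y in \<open>auto simp: closest_point_self\<close>)
        then show False using y(2) by (auto simp: differentiable_def)
      qed
    qed
    then show "negligible (?U \<inter> ball x r)" using N(1) negligible_subset by blast
  qed
qed

section \<open>Change of variables\<close>

text \<open>A bridge: the change of variables formula speaks of absolute integrability and gauge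
  integrals, the area measure of nonnegative integrals.\<close>

lemma absolutely_integrable_nn_integral_iff:
  fixes u :: "'a::euclidean_space \<Rightarrow> real"
  assumes u: "\<And>x. 0 \<le> u x" and meas: "(\<lambda>x. indicator T x * u x) \<in> borel_measurable lebesgue" and b: "0 \<le> b"
  shows "u absolutely_integrable_on T \<and> integral T u = b \<longleftrightarrow>
    (\<integral>\<^sup>+x. ennreal (u x) * indicator T x \<partial>lborel) = ennreal b"
proof -
  have eq: "(\<integral>\<^sup>+x. ennreal (u x) * indicator T x \<partial>lborel) = (\<integral>\<^sup>+x. ennreal (indicator T x * u x) \<partial>lebesgue)"
    by (simp add: nn_integral_completion) (auto intro!: nn_integral_cong simp: indicator_def)
  show ?thesis
  proof
    assume *: "u absolutely_integrable_on T \<and> integral T u = b"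
    then have "(u has_integral b) T" by (auto simp: absolutely_integrable_on_def has_integral_iff)
    then have "(\<integral>\<^sup>+x. ennreal (indicator T x * u x) \<partial>lborel) = ennreal b"
      by (intro nn_integral_has_integral_lebesgue u)
    then show "(\<integral>\<^sup>+x. ennreal (u x) * indicator T x \<partial>lborel) = ennreal b"
      by (simp add: eq nn_integral_completion)
  next
    assume *: "(\<integral>\<^sup>+x. ennreal (u x) * indicator T x \<partial>lborel) = ennreal b"
    then have fin: "(\<integral>\<^sup>+x. ennreal (indicator T x * u x) \<partial>lebesgue) = ennreal b" by (simp add: eq)
    have int: "integrable lebesgue (\<lambda>x. indicator T x * u x)"
      by (rule integrableI_nonneg[OF meas]) (use u fin in auto)
    then have ai: "u absolutely_integrable_on T" by (simp add: set_integrable_def)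
    then have "(u has_integral integral T u) T" by (auto simp: absolutely_integrable_on_def)
    then have "(\<integral>\<^sup>+x. ennreal (indicator T x * u x) \<partial>lborel) = ennreal (integral T u)"
      by (intro nn_integral_has_integral_lebesgue u)
    then have "ennreal (integral T u) = ennreal b" using fin by (simp add: nn_integral_completion)
    moreover have "0 \<le> integral T u" using u by (intro integral_nonneg) (use ai in \<open>auto simp: absolutely_integrable_on_def\<close>)
    ultimately show "u absolutely_integrable_on T \<and> integral T u = b" using ai b by simp
  qed
qed

text \<open>A Lebesgue set is a countable union of compact sets up to a null set; continuous images
  of compact sets are compact, and differentiable images of null sets are null.\<close>

lemma lebesgue_measurable_differentiable_image:
  fixes g :: "'a::euclidean_space \<Rightarrow> 'a"
  assumes S: "S \<in> sets lebesgue" and g: "g differentiable_on S"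
  shows "g ` S \<in> sets lebesgue"
proof -
  obtain C N where C: "fsigma C" "N \<in> null_sets lebesgue" "C \<union> N = S" "disjnt C N"
    using lebesgue_set_almost_fsigma[OF S] .
  then obtain F :: "nat \<Rightarrow> 'a set" where F: "range F \<subseteq> Collect compact" "C = \<Union>(range F)"
    using fsigma_Union_compact by metis
  have "g ` N \<in> sets lebesgue"
  proof -
    have "negligible (g ` N)"
      by (rule negligible_differentiable_image_negligible)
         (use C g differentiable_on_subset in \<open>auto simp: negligible_iff_null_sets\<close>)
    then show ?thesis by (rule negligible_imp_sets)
  qed
  moreover have "g ` F n \<in> sets lebesgue" for n
  proof -
    have "F n \<subseteq> S" using C(3) F(2) by auto
    then have "continuous_on (F n) g" using g by (meson differentiable_imp_continuous_on continuous_on_subset)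
    then have "compact (g ` F n)" using F(1) by (intro compact_continuous_image) auto
    then show ?thesis by (simp add: borel_compact)
  qed
  moreover have "g ` S = (\<Union>n. g ` F n) \<union> g ` N" using C(3) F(2) by auto
  ultimately show ?thesis by auto
qed

text \<open>The classical formula says that one side is integrable with integral \<open>b\<close>
  iff the other is. So each finite value of one side is attained by the other, and the infinite case
  is what remains.\<close>

theorem nn_integral_change_of_variables:
  fixes g :: "real^2 \<Rightarrow> real^2" and f :: "real^2 \<Rightarrow> real"
  assumes S: "S \<in> sets lebesgue" and der: "\<And>x. x \<in> S \<Longrightarrow> (g has_derivative g' x) (at x within S)"
    and inj: "inj_on g S" and f: "f \<in> borel_measurable borel" and f0: "\<And>y. 0 \<le> f y"
  shows "(\<integral>\<^sup>+x. ennreal (\<bar>det (matrix (g' x))\<bar> * f (g x)) * indicator S x \<partial>lborel) =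
    (\<integral>\<^sup>+y. ennreal (f y) * indicator (g ` S) y \<partial>lborel)" (is "?I = ?J")
proof -
  let ?h = "\<lambda>x. \<bar>det (matrix (g' x))\<bar> * f (g x)"
  have diff: "g differentiable_on S" using der by (auto simp: differentiable_on_def differentiable_def)
  have gS: "g ` S \<in> sets lebesgue" by (rule lebesgue_measurable_differentiable_image[OF S diff])
  have cv: "?h absolutely_integrable_on S \<and> integral S ?h = b \<longleftrightarrow> f absolutely_integrable_on (g ` S) \<and> integral (g ` S) f = b" for b
  proof -
    \<comment> \<open>The classical formula is about vector valued functions; real functions enter
      as maps to \<open>real^1\<close>.\<close>
    have "(\<lambda>x. \<bar>det (matrix (g' x))\<bar> *\<^sub>R (vec (f (g x)) :: real^1)) absolutely_integrable_on S \<and>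
       integral S (\<lambda>x. \<bar>det (matrix (g' x))\<bar> *\<^sub>R (vec (f (g x)) :: real^1)) = vec b
       \<longleftrightarrow> (\<lambda>x. vec (f x) :: real^1) absolutely_integrable_on (g ` S) \<and> integral (g ` S) (\<lambda>x. vec (f x) :: real^1) = vec b"
      by (rule has_absolute_integral_change_of_variables[OF S der inj])
    then show ?thesis
      unfolding absolutely_integrable_on_1_iff integral_on_1_eq by (auto simp: absolutely_integrable_on_def)
  qed
  have m1: "(\<lambda>y. indicator (g ` S) y * f y) \<in> borel_measurable lebesgue"
    using gS f by (intro borel_measurable_times borel_measurable_indicator) (simp_all add: measurable_completion)
  have m2: "(\<lambda>x. indicator S x * ?h x) \<in> borel_measurable lebesgue"
  proof -
    have "g \<in> borel_measurable (lebesgue_on S)"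
      by (rule continuous_imp_measurable_on_sets_lebesgue[OF differentiable_imp_continuous_on[OF diff] S])
    then have "(\<lambda>x. f (g x)) \<in> borel_measurable (lebesgue_on S)" using f by (rule measurable_compose)
    moreover have "(\<lambda>x. det (matrix (g' x))) \<in> borel_measurable (lebesgue_on S)"
      by (rule borel_measurable_det_Jacobian[OF S der])
    ultimately have "?h \<in> borel_measurable (lebesgue_on S)" by measurable
    then show ?thesis using S by (simp add: borel_measurable_restrict_space_iff ac_simps)
  qed
  have iff: "?I = ennreal b \<longleftrightarrow> ?J = ennreal b" if "0 \<le> b" for b
    using cv[of b] absolutely_integrable_nn_integral_iff[of ?h S b, OF _ m2 that] f0
      absolutely_integrable_nn_integral_iff[of f "g ` S" b, OF f0 m1 that] by simp
  show ?thesis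
  proof (cases ?I)
    case (real r) then show ?thesis using iff[of r] by simp
  next
    case I: top
    show ?thesis
    proof (cases ?J)
      case (real r) then show ?thesis using iff[of r] by simp
    next
      case top then show ?thesis using I by simp
    qed
  qed
qed

text \<open>Locally, the inverse of \<^term>\<open>g\<close> is Lipschitz on the set of points where the derivative is
  invertible, up to a countable decomposition of this set.\<close>

lemma negligible_image_imp_det_zero:
  fixes g :: "real^2 \<Rightarrow> real^2"
  assumes der: "\<And>x. x \<in> S \<Longrightarrow> (g has_derivative g' x) (at x within S)" and neg: "negligible (g ` S)"
  shows "negligible {x\<in>S. det (matrix (g' x)) \<noteq> 0}"
proof -
  define T where "T = {x\<in>S. det (matrix (g' x)) \<noteq> 0}"
  \<comment> \<open>The points of \<open>T\<close> at which distances up to 1 / (n + 1) shrink at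
    most by the factor n + 1. An invertible derivative is bounded below, so these sets cover
    \<open>T\<close>.\<close>
  define U where "U n = {x\<in>T. \<forall>y\<in>T. dist x y < 1 / (real n + 1) \<longrightarrow> dist x y \<le> (real n + 1) * dist (g x) (g y)}" for n
  have "negligible (U n)" for n
  proof (rule locally_negligible_alt[THEN iffD2], rule ballI)
    fix x assume x: "x \<in> U n"
    \<comment> \<open>Half the radius, so that any two points of \<open>V\<close> are closer than 1
      / (n + 1) and the inverse of \<open>g\<close> is Lipschitz on the image of
      \<open>V\<close>.\<close>
    define V where "V = U n \<inter> ball x (1 / (2 * (real n + 1)))"
    have V: "dist a b \<le> (real n + 1) * dist (g a) (g b)" if "a \<in> V" "b \<in> V" for a b
    proof -
      have "dist a b \<le> dist x a + dist x b" by (metis dist_commute dist_triangle)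
      also have "\<dots> < 1 / (2 * (real n + 1)) + 1 / (2 * (real n + 1))" using that by (auto simp: V_def)
      also have "\<dots> = 1 / (real n + 1)" by (simp add: field_simps)
      finally show ?thesis using that by (auto simp: V_def U_def)
    qed
    then have inj: "inj_on g V" by (intro inj_onI) (metis dist_eq_0_iff dist_le_zero_iff mult_zero_right)
    have "g ` V \<subseteq> g ` S" by (auto simp: V_def U_def T_def)
    then have "negligible (g ` V)" using neg negligible_subset by blast
    then have "negligible (inv_into V g ` (g ` V))"
    proof (rule negligible_locally_Lipschitz_image[rotated])
      fix y assume y: "y \<in> g ` V"
      show "\<exists>T B. open T \<and> y \<in> T \<and> (\<forall>z\<in>g ` V \<inter> T. norm (inv_into V g z - inv_into V g y) \<le> B * norm (z - y))"
      proof (intro exI[of _ UNIV] exI[of _ "real n + 1"] conjI ballI)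
        fix z assume "z \<in> g ` V \<inter> UNIV"
        then show "norm (inv_into V g z - inv_into V g y) \<le> (real n + 1) * norm (z - y)"
          using V[of "inv_into V g z" "inv_into V g y"] y
          by (simp add: inv_into_into f_inv_into_f dist_norm)
      qed auto
    qed auto
    moreover have "inv_into V g ` (g ` V) = V" using inj by (rule inv_into_image_cancel) simp
    ultimately have "negligible V" by simp
    moreover have "openin (top_of_set (U n)) V" unfolding V_def by (intro openin_open_Int) simp
    moreover have "x \<in> V" using x by (simp add: V_def)
    ultimately show "\<exists>V. openin (top_of_set (U n)) V \<and> x \<in> V \<and> negligible V" by blast
  qed
  moreover have "T \<subseteq> (\<Union>n. U n)"
  proof
    fix x assume x: "x \<in> T"
    then have lin: "linear (g' x)" and D: "(g has_derivative g' x) (at x within S)" and d0: "det (matrix (g' x)) \<noteq> 0"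
      using der has_derivative_linear by (auto simp: T_def)
    from d0 have "inj (g' x)" using lin by (simp add: det_nz_iff_inj)
    then obtain B where B: "B > 0" "\<And>v. B * norm v \<le> norm (g' x v)"
      using linear_inj_bounded_below_pos[OF lin] by metis
    obtain d where d: "d > 0" "\<And>y. y \<in> S \<Longrightarrow> norm (y - x) < d \<Longrightarrow> norm (g y - g x - g' x (y - x)) \<le> B/2 * norm (y - x)"
      using D B(1) unfolding has_derivative_within_alt by (meson half_gt_zero)
    obtain n :: nat where n: "1 / (real n + 1) < min d (B/2)"
      using reals_Archimedean[of "min d (B/2)"] d B by (auto simp: inverse_eq_divide add.commute)
    have "x \<in> U n"
      unfolding U_def
    proof (intro CollectI conjI x ballI impI)
      fix y assume y: "y \<in> T" "dist x y < 1 / (real n + 1)"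
      then have "norm (g y - g x - g' x (y - x)) \<le> B/2 * norm (y - x)"
        using n by (intro d) (auto simp: T_def dist_norm norm_minus_commute)
      then have "B/2 * norm (y - x) \<le> norm (g y - g x)"
        using B(2)[of "y - x"] norm_triangle_ineq3[of "g y - g x" "g' x (y - x)"] by linarith
      moreover have "norm (y - x) / (real n + 1) \<le> B/2 * norm (y - x)"
        using mult_right_mono[of "1 / (real n + 1)" "B/2" "norm (y - x)"] n by simp
      ultimately have "norm (y - x) / (real n + 1) \<le> norm (g y - g x)" by (rule order_trans[rotated])
      then show "dist x y \<le> (real n + 1) * dist (g x) (g y)"
        by (simp add: dist_norm norm_minus_commute field_simps)
    qed
    then show "x \<in> (\<Union>n. U n)" by blast
  qed
  ultimately have "negligible T" using negligible_subset[OF negligible_countable_Union[of "range U"]] by auto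
  then show ?thesis by (simp add: T_def)
qed

section \<open>Lipschitz patches\<close>

lemma lipschitz_patchE:
  assumes "lipschitz_patch S" "x \<in> S"
  obtains W where "open W" "x \<in> W" "W \<subseteq> S"
  | W Q L \<gamma> where "open W" "x \<in> W" "orthogonal_transformation (Q :: real^2 \<Rightarrow> real^2)"
      "L-lipschitz_on UNIV (\<gamma> :: real \<Rightarrow> real)" "S \<inter> W = {y\<in>W. \<gamma> (Q y $ 1) \<le> Q y $ 2}"
proof -
  obtain W where W: "open W" "x \<in> W" "W \<subseteq> S \<or>
         (\<exists>Q L \<gamma>. orthogonal_transformation (Q :: real^2 \<Rightarrow> real^2) \<and> L-lipschitz_on UNIV (\<gamma> :: real \<Rightarrow> real) \<and>
            S \<inter> W = {y\<in>W. \<gamma> (Q y $ 1) \<le> Q y $ 2})"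
    using assms unfolding lipschitz_patch_def by meson
  from W(3) show thesis
  proof
    assume "W \<subseteq> S" then show thesis using W that(1) by simp
  next
    assume "\<exists>Q L \<gamma>. orthogonal_transformation (Q :: real^2 \<Rightarrow> real^2) \<and> L-lipschitz_on UNIV (\<gamma> :: real \<Rightarrow> real) \<and>
            S \<inter> W = {y\<in>W. \<gamma> (Q y $ 1) \<le> Q y $ 2}"
    then show thesis using W that(2) by (elim exE conjE)
  qed
qed

lemma continuous_on_orthogonal_nth:
  fixes Q :: "real^2 \<Rightarrow> real^2"
  assumes "orthogonal_transformation Q"
  shows "continuous_on UNIV (\<lambda>y. Q y $ i)"
  using linear_continuous_on[of Q UNIV] orthogonal_transformation_linear[OF assms]
  by (simp add: linear_conv_bounded_linear continuous_on_component)

lemma open_strict_epigraph: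
  fixes Q :: "real^2 \<Rightarrow> real^2"
  assumes Q: "orthogonal_transformation Q" and L: "L-lipschitz_on UNIV (\<gamma> :: real \<Rightarrow> real)"
  shows "open {y. \<gamma> (Q y $ 1) < Q y $ 2}" "open {y. Q y $ 2 < \<gamma> (Q y $ 1)}"
proof -
  have c: "continuous_on UNIV (\<lambda>y. \<gamma> (Q y $ 1))"
    using continuous_on_compose2[OF lipschitz_on_continuous_on[OF L] continuous_on_orthogonal_nth[OF Q]] by simp
  show "open {y. \<gamma> (Q y $ 1) < Q y $ 2}" "open {y. Q y $ 2 < \<gamma> (Q y $ 1)}"
    by (rule open_Collect_less[OF c continuous_on_orthogonal_nth[OF Q]],
        rule open_Collect_less[OF continuous_on_orthogonal_nth[OF Q] c])
qed

lemma strict_epigraph_subset_interior: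
  fixes Q :: "real^2 \<Rightarrow> real^2"
  assumes W: "open W" and Q: "orthogonal_transformation Q" and L: "L-lipschitz_on UNIV (\<gamma> :: real \<Rightarrow> real)"
    and S: "S \<inter> W = {y\<in>W. \<gamma> (Q y $ 1) \<le> Q y $ 2}"
  shows "W \<inter> {y. \<gamma> (Q y $ 1) < Q y $ 2} \<subseteq> interior S"
proof (rule interior_maximal)
  show "open (W \<inter> {y. \<gamma> (Q y $ 1) < Q y $ 2})" using W open_strict_epigraph(1)[OF Q L] by (rule open_Int)
  show "W \<inter> {y. \<gamma> (Q y $ 1) < Q y $ 2} \<subseteq> S"
  proof
    fix y assume "y \<in> W \<inter> {y. \<gamma> (Q y $ 1) < Q y $ 2}"
    then have "y \<in> S \<inter> W" unfolding S by simp
    then show "y \<in> S" by simp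
  qed
qed

text \<open>A patch is in general neither open nor closed. That it is closed relative to a
  neighbourhood of each of its points makes it a Borel set and locally compact.\<close>

lemma lipschitz_patch_locally_closed:
  assumes "lipschitz_patch S" "x \<in> S"
  obtains W where "open W" "x \<in> W" "open (W - S)"
  using assms
proof (cases rule: lipschitz_patchE)
  case (1 W)
  then show ?thesis using that[of W] by (simp add: Diff_eq_empty_iff[THEN iffD2])
next
  case (2 W Q L \<gamma>)
  have "y \<in> S \<longleftrightarrow> \<gamma> (Q y $ 1) \<le> Q y $ 2" if "y \<in> W" for y
    using that arg_cong[OF 2(5), of "\<lambda>X. y \<in> X"] by simp
  then have "W - S = W \<inter> {y. Q y $ 2 < \<gamma> (Q y $ 1)}" by (auto simp: not_le)
  then have "open (W - S)" using open_strict_epigraph(2)[OF 2(3,4)] 2(1) by auto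
  then show ?thesis by (rule that[OF 2(1,2)])
qed

lemma lipschitz_patch_borel:
  assumes "lipschitz_patch S"
  shows "S \<in> sets borel"
proof -
  have "\<forall>x\<in>S. \<exists>W. open W \<and> x \<in> W \<and> open (W - S)"
    using lipschitz_patch_locally_closed[OF assms] by blast
  then obtain W where W: "\<And>x. x \<in> S \<Longrightarrow> open (W x) \<and> x \<in> W x \<and> open (W x - S)" by metis
  have "S = (\<Union>x\<in>S. W x) - (\<Union>x\<in>S. W x - S)" using W by blast
  moreover have "open (\<Union>x\<in>S. W x)" "open (\<Union>x\<in>S. W x - S)" by (rule open_UN, use W in blast)+
  ultimately show ?thesis by (metis borel_open sets.Diff)
qed

lemma lipschitz_patch_locally_compact:
  assumes "lipschitz_patch S" "x \<in> S"
  obtains r where "r > 0" "\<And>e. e \<le> r \<Longrightarrow> compact (S \<inter> cball x e)"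
proof -
  obtain W where W: "open W" "x \<in> W" "open (W - S)" by (rule lipschitz_patch_locally_closed[OF assms])
  then obtain r where r: "r > 0" "cball x r \<subseteq> W" by (auto simp: open_contains_cball)
  show thesis
  proof
    show "r > 0" by fact
    fix e assume "e \<le> r"
    then have "S \<inter> cball x e = cball x e - (W - S)" using r subset_cball[of e r x] by auto
    then show "compact (S \<inter> cball x e)" using W(3) by (simp add: compact_diff)
  qed
qed

text \<open>The graph is the image of a coordinate line under a Lipschitz shear followed by the
  inverse of \<open>Q\<close>.\<close>

lemma negligible_lipschitz_graph:
  fixes Q :: "real^2 \<Rightarrow> real^2"
  assumes Q: "orthogonal_transformation Q" and L: "L-lipschitz_on UNIV (\<gamma> :: real \<Rightarrow> real)"
  shows "negligible {y. Q y $ 2 = \<gamma> (Q y $ 1)}"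
proof -
  define \<Psi> where "\<Psi> = (\<lambda>z :: real^2. inv Q (vector [z$1, z$2 + \<gamma> (z$1)]))"
  have Q': "orthogonal_transformation (inv Q)" using Q by (rule orthogonal_transformation_inv)
  have invQ: "inv Q (Q y) = y" "Q (inv Q y) = y" for y
    using orthogonal_transformation_bij[OF Q] by (simp_all add: bij_is_inj bij_is_surj surj_f_inv_f)
  have L0: "L \<ge> 0" using L by (rule lipschitz_on_nonneg)
  have "negligible {z :: real^2. z \<bullet> axis 2 1 = 0}" by (rule negligible_standard_hyperplane) (auto simp: Basis_vec_def)
  then have "negligible (\<Psi> ` {z. z \<bullet> axis 2 1 = 0})"
  proof (rule negligible_locally_Lipschitz_image[rotated])
    fix x :: "real^2"
    show "\<exists>T B. open T \<and> x \<in> T \<and> (\<forall>y\<in>{z. z \<bullet> axis 2 1 = 0} \<inter> T. norm (\<Psi> y - \<Psi> x) \<le> B * norm (y - x))"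
    proof (intro exI[of _ UNIV] exI[of _ "2 + L"] conjI ballI)
      fix y :: "real^2"
      have "norm (\<Psi> y - \<Psi> x) = norm (vector [y$1, y$2 + \<gamma> (y$1)] - vector [x$1, x$2 + \<gamma> (x$1)] :: real^2)"
        unfolding \<Psi>_def linear_diff[OF orthogonal_transformation_linear[OF Q'], symmetric]
        by (rule orthogonal_transformation_norm[OF Q'])
      also have "\<dots> \<le> \<bar>y$1 - x$1\<bar> + \<bar>y$2 + \<gamma> (y$1) - (x$2 + \<gamma> (x$1))\<bar>"
        using norm_le_l1_cart[of "vector [y$1, y$2 + \<gamma> (y$1)] - vector [x$1, x$2 + \<gamma> (x$1)] :: real^2"]
        by (simp add: sum_2)
      also have "\<dots> \<le> \<bar>y$1 - x$1\<bar> + (\<bar>y$2 - x$2\<bar> + L * \<bar>y$1 - x$1\<bar>)"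
        using lipschitz_onD[OF L, of "y$1" "x$1"] by (simp add: dist_real_def)
      also have "\<dots> \<le> norm (y - x) + (norm (y - x) + L * norm (y - x))"
        using component_le_norm_cart[of "y - x" 1] component_le_norm_cart[of "y - x" 2] L0
        by (intro add_mono mult_left_mono) auto
      finally show "norm (\<Psi> y - \<Psi> x) \<le> (2 + L) * norm (y - x)" by (simp add: algebra_simps)
    qed auto
  qed auto
  moreover have "{y. Q y $ 2 = \<gamma> (Q y $ 1)} \<subseteq> \<Psi> ` {z. z \<bullet> axis 2 1 = 0}"
  proof
    fix y assume y: "y \<in> {y. Q y $ 2 = \<gamma> (Q y $ 1)}"
    have "(vector [Q y $ 1, 0 + \<gamma> (Q y $ 1)] :: real^2) = Q y" using y by (simp add: vec_eq_iff forall_2)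
    then have "y = \<Psi> (vector [Q y $ 1, 0])" by (simp add: \<Psi>_def invQ)
    then show "y \<in> \<Psi> ` {z. z \<bullet> axis 2 1 = 0}" by (rule image_eqI) (simp add: inner_axis)
  qed
  ultimately show ?thesis by (rule negligible_subset)
qed

text \<open>Near such a point the strict epigraph consists of interior points, so what is left lies
  on the Lipschitz graph. Almost everywhere statements may therefore be proved at interior
  points.\<close>

lemma lipschitz_patch_negligible_boundary:
  assumes "lipschitz_patch S"
  shows "negligible (S - interior S)"
proof (rule locally_negligible_alt[THEN iffD2], rule ballI)
  fix x assume "x \<in> S - interior S"
  then have x: "x \<in> S" "x \<notin> interior S" by auto
  from assms x(1) show "\<exists>V. openin (top_of_set (S - interior S)) V \<and> x \<in> V \<and> negligible V"
  proof (cases rule: lipschitz_patchE)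
    case (1 W)
    then show ?thesis using x interiorI by blast
  next
    case (2 W Q L \<gamma>)
    let ?V = "(S - interior S) \<inter> W"
    have sub: "W \<inter> {y. \<gamma> (Q y $ 1) < Q y $ 2} \<subseteq> interior S"
      by (rule strict_epigraph_subset_interior[OF 2(1,3,4,5)])
    have "Q y $ 2 = \<gamma> (Q y $ 1)" if y: "y \<in> ?V" for y
    proof -
      have "y \<in> S \<inter> W" using y by auto
      then have "\<gamma> (Q y $ 1) \<le> Q y $ 2" unfolding 2(5) by auto
      moreover have "\<not> \<gamma> (Q y $ 1) < Q y $ 2" using sub y by auto
      ultimately show ?thesis by simp
    qed
    then have "negligible ?V"
      by (intro negligible_subset[OF negligible_lipschitz_graph[OF 2(3,4)]]) auto
    moreover have "openin (top_of_set (S - interior S)) ?V" using 2(1) by (intro openin_open_Int)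
    ultimately show ?thesis using x 2(2) by blast
  qed
qed

text \<open>Moving a point of the epigraph slightly upwards, in the coordinates given by
  \<open>Q\<close>, leads to the strict epigraph. This is the source of the positivity of the total
  area.\<close>

lemma lipschitz_patch_interior_nonempty:
  assumes "lipschitz_patch S" "x \<in> S"
  shows "interior S \<noteq> {}"
  using assms
proof (cases rule: lipschitz_patchE)
  case (1 W)
  then show ?thesis using interiorI by blast
next
  case (2 W Q L \<gamma>)
  have lin: "linear Q" by (rule orthogonal_transformation_linear[OF 2(3)])
  have surj: "Q (inv Q y) = y" for y
    using orthogonal_transformation_bij[OF 2(3)] by (simp add: bij_is_surj surj_f_inv_f)
  obtain r where r: "r > 0" "ball x r \<subseteq> W" using 2 by (auto simp: open_contains_ball)
  define y where "y = x + (r/2) *\<^sub>R inv Q (axis 2 1)"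
  have "norm (inv Q (axis 2 1 :: real^2)) = 1"
    using orthogonal_transformation_norm[OF orthogonal_transformation_inv[OF 2(3)]] by simp
  then have y: "y \<in> W" using r by (auto simp: y_def dist_norm)
  have "Q y = Q x + (r/2) *\<^sub>R axis 2 1" by (simp add: y_def linear_add[OF lin] linear_cmul[OF lin] surj)
  then have Qy: "Q y $ 1 = Q x $ 1" "Q y $ 2 = Q x $ 2 + r/2" by (simp_all add: axis_def)
  have "x \<in> S \<inter> W" using assms 2 by auto
  then have "\<gamma> (Q x $ 1) \<le> Q x $ 2" unfolding 2(5) by auto
  then have "\<gamma> (Q y $ 1) < Q y $ 2" using Qy r by simp
  moreover have "W \<inter> {y. \<gamma> (Q y $ 1) < Q y $ 2} \<subseteq> interior S"
    by (rule strict_epigraph_subset_interior[OF 2(1,3,4,5)])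
  ultimately show ?thesis using y by auto
qed

text \<open>Near a boundary point, the broken line runs up to a height from which the whole horizontal
  segment lies above the Lipschitz graph.\<close>

lemma lipschitz_patch_quasiconvex:
  assumes "lipschitz_patch S" "x0 \<in> S" and R: "R > 0"
  obtains r C where "r > 0" "C \<ge> 0" "\<And>x y. x \<in> S \<inter> ball x0 r \<Longrightarrow> y \<in> S \<inter> ball x0 r \<Longrightarrow>
     \<exists>a b. closed_segment x a \<union> closed_segment a b \<union> closed_segment b y \<subseteq> S \<inter> ball x0 R \<and>
       dist x a + dist a b + dist b y \<le> C * dist x y"
  using assms(1,2)
proof (cases rule: lipschitz_patchE)
  case (1 W)
  then obtain r where r: "r > 0" "ball x0 r \<subseteq> W" by (auto simp: open_contains_ball)
  show ?thesis
  proof (rule that[of "min r R" 1])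
    show "min r R > 0" using r R by simp
    fix x y assume "x \<in> S \<inter> ball x0 (min r R)" "y \<in> S \<inter> ball x0 (min r R)"
    then have "x \<in> ball x0 (min r R)" "y \<in> ball x0 (min r R)" by auto
    then have seg: "closed_segment x y \<subseteq> ball x0 (min r R)" "closed_segment x x \<subseteq> ball x0 (min r R)"
      by (simp_all add: closed_segment_subset convex_ball)
    have sub: "ball x0 (min r R) \<subseteq> S \<inter> ball x0 R" using r 1 by auto
    have "closed_segment x y \<subseteq> S \<inter> ball x0 R" "closed_segment x x \<subseteq> S \<inter> ball x0 R"
      by (rule order_trans[OF seg(1) sub], rule order_trans[OF seg(2) sub])
    then have "closed_segment x x \<union> closed_segment x x \<union> closed_segment x y \<subseteq> S \<inter> ball x0 R"
      by (intro Un_least)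
    then show "\<exists>a b. closed_segment x a \<union> closed_segment a b \<union> closed_segment b y \<subseteq> S \<inter> ball x0 R \<and>
       dist x a + dist a b + dist b y \<le> 1 * dist x y" by (intro exI[of _ x]) simp
  qed simp
next
  case (2 W Q L \<gamma>)
  have lin: "linear Q" by (rule orthogonal_transformation_linear[OF 2(3)])
  have surj: "Q (inv Q y) = y" for y
    using orthogonal_transformation_bij[OF 2(3)] by (simp add: bij_is_surj surj_f_inv_f)
  have Qn: "dist x y = dist (Q x) (Q y)" for x y
    using orthogonal_transformation_norm[OF 2(3)] by (simp add: dist_norm linear_diff[OF lin, symmetric])
  have L0: "L \<ge> 0" using 2(4) by (rule lipschitz_on_nonneg)
  obtain \<rho> where \<rho>: "\<rho> > 0" "ball x0 \<rho> \<subseteq> W" using 2 by (auto simp: open_contains_ball)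
  \<comment> \<open>Each vertical leg costs at most 1 + L times the distance of the endpoints, the
    horizontal leg at most the distance itself.\<close>
  define C where "C = 3 + 2 * L"
  \<comment> \<open>Points of the broken line are at distance less than r + 2 r C from
    \<open>x0\<close>; this has to stay within both radii.\<close>
  define r where "r = min \<rho> R / (1 + 2 * C)"
  have C: "C \<ge> 0" using L0 by (simp add: C_def)
  have r: "r > 0" "r * (1 + 2 * C) = min \<rho> R" using C \<rho> R by (simp_all add: r_def)
  show ?thesis
  proof (rule that[OF r(1) C])
    fix x y assume x: "x \<in> S \<inter> ball x0 r" and y: "y \<in> S \<inter> ball x0 r"
    have rle: "r \<le> min \<rho> R" using r C by (metis add_increasing2 mult_left_mono mult.right_neutral less_imp_le zero_le_mult_iff zero_le_numeral le_add_same_cancel1)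
    have xW: "x \<in> S \<inter> W" "y \<in> S \<inter> W" using x y \<rho> rle by auto
    then have ep: "\<gamma> (Q x $ 1) \<le> Q x $ 2" "\<gamma> (Q y $ 1) \<le> Q y $ 2" unfolding 2(5) by auto
    \<comment> \<open>Between the two feet the graph rises by at most \<open>L\<close> times their
      horizontal distance, so at height \<open>h\<close> the whole segment stays above it.\<close>
    define h where "h = max (Q x $ 2) (Q y $ 2) + L * \<bar>Q x $ 1 - Q y $ 1\<bar>"
    define a where "a = inv Q (vector [Q x $ 1, h])"
    define b where "b = inv Q (vector [Q y $ 1, h])"
    have Qa: "Q a $ 1 = Q x $ 1" "Q a $ 2 = h" and Qb: "Q b $ 1 = Q y $ 1" "Q b $ 2 = h"
      by (simp_all add: a_def b_def surj)
    have hx: "Q x $ 2 \<le> h" "Q y $ 2 \<le> h" using L0 by (auto simp: h_def add_increasing2)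
    have d: "dist u v = sqrt ((Q u $ 1 - Q v $ 1)\<^sup>2 + (Q u $ 2 - Q v $ 2)\<^sup>2)" for u v
      unfolding Qn[of u v] by (simp add: dist_vec_def L2_set_def sum_2 dist_real_def)
    have d1: "\<bar>Q x $ 1 - Q y $ 1\<bar> \<le> dist x y" "\<bar>Q x $ 2 - Q y $ 2\<bar> \<le> dist x y"
      unfolding d by (auto intro: real_le_rsqrt)
    have "L * \<bar>Q x $ 1 - Q y $ 1\<bar> \<le> L * dist x y" using d1 L0 by (intro mult_left_mono)
    then have len: "dist x a \<le> (1 + L) * dist x y" "dist b y \<le> (1 + L) * dist x y" "dist a b \<le> dist x y"
      using d1 hx unfolding d[of x a] d[of b y] d[of a b] Qa Qb by (auto simp: h_def algebra_simps)
    then have tot: "dist x a + dist a b + dist b y \<le> C * dist x y" by (simp add: C_def algebra_simps)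
    have seg: "Q ((1 - u) *\<^sub>R p + u *\<^sub>R q) $ i = (1 - u) * Q p $ i + u * Q q $ i" for u p q i
      by (simp add: linear_add[OF lin] linear_cmul[OF lin])
    have "p \<in> S \<inter> ball x0 R" if p: "p \<in> closed_segment x a \<union> closed_segment a b \<union> closed_segment b y" for p
    proof -
      have "dist x p \<le> dist x a + dist a b + dist b y"
      proof -
        consider "p \<in> closed_segment x a" | "p \<in> closed_segment a b" | "p \<in> closed_segment b y" using p by blast
        then show ?thesis
        proof cases
          case 1
          then have "dist x p \<le> dist x a" by (metis dist_commute dist_in_closed_segment(1))
          then show ?thesis using zero_le_dist[of a b] zero_le_dist[of b y] by linarith
        next
          case 2
          then have "dist a p \<le> dist a b" by (metis dist_commute dist_in_closed_segment(1))
          then show ?thesis using dist_triangle[of x p a] zero_le_dist[of b y] by linarith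
        next
          case 3
          then have "dist b p \<le> dist b y" by (metis dist_commute dist_in_closed_segment(1))
          then show ?thesis using dist_triangle[of x p b] dist_triangle[of x b a] by linarith
        qed
      qed
      also have "\<dots> \<le> C * dist x y" by (rule tot)
      also have "\<dots> \<le> C * (2 * r)"
        using x y C dist_triangle[of x y x0] by (intro mult_left_mono) (auto simp: dist_commute)
      finally have "dist x0 p < r * (1 + 2 * C)"
        using x dist_triangle[of x0 p x] by (auto simp: algebra_simps)
      then have p1: "dist x0 p < \<rho>" "dist x0 p < R" unfolding r(2) by auto
      have "\<gamma> (Q p $ 1) \<le> Q p $ 2"
        using p
      proof safe
        assume "p \<in> closed_segment x a"
        then obtain u where u: "p = (1 - u) *\<^sub>R x + u *\<^sub>R a" "0 \<le> u" "u \<le> 1" by (auto simp: in_segment)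
        have "Q p $ 1 = Q x $ 1" unfolding u(1) seg Qa by (simp add: algebra_simps)
        moreover have "Q p $ 2 = Q x $ 2 + u * (h - Q x $ 2)" unfolding u(1) seg Qa by (simp add: algebra_simps)
        moreover have "u * (h - Q x $ 2) \<ge> 0" using u hx by simp
        ultimately show ?thesis using ep by simp
      next
        assume "p \<in> closed_segment b y"
        then obtain u where u: "p = (1 - u) *\<^sub>R b + u *\<^sub>R y" "0 \<le> u" "u \<le> 1" by (auto simp: in_segment)
        have "Q p $ 1 = Q y $ 1" unfolding u(1) seg Qb by (simp add: algebra_simps)
        moreover have "Q p $ 2 = Q y $ 2 + (1 - u) * (h - Q y $ 2)" unfolding u(1) seg Qb by (simp add: algebra_simps)
        moreover have "(1 - u) * (h - Q y $ 2) \<ge> 0" using u hx by simp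
        ultimately show ?thesis using ep by simp
      next
        assume "p \<in> closed_segment a b"
        then obtain u where u: "p = (1 - u) *\<^sub>R a + u *\<^sub>R b" "0 \<le> u" "u \<le> 1" by (auto simp: in_segment)
        have p1: "Q p $ 1 = Q x $ 1 + u * (Q y $ 1 - Q x $ 1)" unfolding u(1) seg Qa Qb by (simp add: algebra_simps)
        have p2: "Q p $ 2 = h" unfolding u(1) seg Qa Qb by (simp add: algebra_simps)
        have "\<gamma> (Q p $ 1) - \<gamma> (Q x $ 1) \<le> L * \<bar>Q p $ 1 - Q x $ 1\<bar>"
          using lipschitz_onD[OF 2(4), of "Q p $ 1" "Q x $ 1"] by (simp add: dist_real_def)
        also have "\<dots> = L * (u * \<bar>Q x $ 1 - Q y $ 1\<bar>)" using u p1 by (simp add: abs_mult abs_minus_commute)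
        also have "\<dots> \<le> L * \<bar>Q x $ 1 - Q y $ 1\<bar>" using u L0 by (intro mult_left_mono) (auto simp: mult_left_le_one_le)
        finally show ?thesis using ep p2 by (auto simp: h_def)
      qed
      then have "p \<in> S \<inter> W" unfolding 2(5) using p1 \<rho> by auto
      then show ?thesis using p1 by simp
    qed
    then show "\<exists>a b. closed_segment x a \<union> closed_segment a b \<union> closed_segment b y \<subseteq> S \<inter> ball x0 R \<and>
       dist x a + dist a b + dist b y \<le> C * dist x y" using tot by blast
  qed
qed

section \<open>Charts\<close>

lemma smooth_on_imp_continuous_on:
  assumes "smooth_on S f"
  shows "continuous_on S f"
proof (rule continuous_on_eq_continuous_within[THEN iffD2], rule ballI)
  fix x assume x: "x \<in> S"
  then obtain W F where W: "open W" "x \<in> W" "\<And>k. Ck_on k W F" "\<forall>y\<in>S \<inter> W. F y = f y"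
    using assms unfolding smooth_on_def by blast
  have "continuous_on W F" using W(3)[of 0] by simp
  then have "continuous (at x within (S \<inter> W)) F"
    using x W(2) by (meson IntI continuous_on_eq_continuous_within continuous_on_subset inf_le2)
  then have "continuous (at x within (S \<inter> W)) f"
    by (rule continuous_transform_within[OF _ zero_less_one]) (use x W in auto)
  then show "continuous (at x within S) f"
    using at_within_nhd[of x W "S \<inter> W" S] W(1,2) by (simp add: continuous_within Int_assoc)
qed

locale riemannian_surface =
  fixes M :: "'a surface"
  assumes surface: "oriented_riemannian_surface M"
begin

abbreviation X :: "'a topology" where "X \<equiv> surface_top M"

abbreviation patch :: "'a chart \<Rightarrow> (real^2) set" where "patch c \<equiv> coord c ` dom_of c"

definition borel_sets :: "'a measure" where "borel_sets = sigma (points M) {U. openin X U}"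

text \<open>Extension by zero off the patch gives a Borel function on the whole plane, the form that
  \<open>nn_integral_change_of_variables\<close> asks for.\<close>

definition density_in :: "'a chart \<Rightarrow> real^2 \<Rightarrow> real" where
  "density_in c x = indicator (patch c) x * area_density M c (chart_inv c x)"

lemma chart:
  assumes "c \<in> atlas M"
  shows "openin X (dom_of c)" "lipschitz_patch (patch c)"
    "homeomorphic_map (subtopology X (dom_of c)) (top_of_set (patch c)) (coord c)"
  using surface assms unfolding oriented_riemannian_surface_def chart_on_def by blast+

lemma dom_subset: "c \<in> atlas M \<Longrightarrow> dom_of c \<subseteq> points M"
  using chart(1) openin_subset by blast

lemma topspace_dom: "c \<in> atlas M \<Longrightarrow> topspace (subtopology X (dom_of c)) = dom_of c"
  using dom_subset[of c] by (auto simp: topspace_subtopology)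

lemma inj_coord: "c \<in> atlas M \<Longrightarrow> inj_on (coord c) (dom_of c)"
  using homeomorphic_imp_injective_map[OF chart(3)] topspace_dom by metis

lemma chart_inv_coord [simp]: "c \<in> atlas M \<Longrightarrow> p \<in> dom_of c \<Longrightarrow> chart_inv c (coord c p) = p"
  unfolding chart_inv_def by (rule inv_into_f_f[OF inj_coord])

lemma coord_chart_inv [simp]: "x \<in> patch c \<Longrightarrow> coord c (chart_inv c x) = x"
  unfolding chart_inv_def by (rule f_inv_into_f)

lemma chart_inv_in_dom: "x \<in> patch c \<Longrightarrow> chart_inv c x \<in> dom_of c"
  unfolding chart_inv_def by (rule inv_into_into)

lemma coord_image_eq:
  assumes "c \<in> atlas M" "E \<subseteq> dom_of c"
  shows "coord c ` E = {x\<in>patch c. chart_inv c x \<in> E}"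
  using assms by (force intro: image_eqI[where x="chart_inv c _"])

lemma chart_inv_image: "c \<in> atlas M \<Longrightarrow> E \<subseteq> dom_of c \<Longrightarrow> chart_inv c ` coord c ` E = E"
  by (force simp: image_image)

lemma continuous_coord: "c \<in> atlas M \<Longrightarrow> continuous_map (subtopology X (dom_of c)) euclidean (coord c)"
  using homeomorphic_imp_continuous_map[OF chart(3)] continuous_map_in_subtopology by metis

lemma continuous_chart_inv:
  assumes c: "c \<in> atlas M"
  shows "continuous_map (top_of_set (patch c)) X (chart_inv c)"
proof -
  obtain g where g: "homeomorphic_maps (subtopology X (dom_of c)) (top_of_set (patch c)) (coord c) g"
    using chart(3)[OF c] homeomorphic_map_maps by blast
  then have "continuous_map (top_of_set (patch c)) (subtopology X (dom_of c)) g"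
    and eq: "\<And>p. p \<in> dom_of c \<Longrightarrow> g (coord c p) = p"
    using topspace_dom[OF c] by (auto simp: homeomorphic_maps_def)
  then have "continuous_map (top_of_set (patch c)) X g" by (simp add: continuous_map_in_subtopology)
  then show ?thesis by (rule continuous_map_eq) (use eq c in auto)
qed

lemma openin_coord_preimage:
  assumes c: "c \<in> atlas M" and U: "open U"
  shows "openin X {p\<in>dom_of c. coord c p \<in> U}"
proof -
  have "openin (subtopology X (dom_of c)) {p\<in>topspace (subtopology X (dom_of c)). coord c p \<in> U}"
    by (rule openin_continuous_map_preimage[OF continuous_coord[OF c]]) (use U in simp)
  then show ?thesis
    unfolding topspace_dom[OF c] using chart(1)[OF c] by (rule openin_trans_full)
qed

lemma openin_coord_image:
  assumes c: "c \<in> atlas M" and V: "openin X V"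
  obtains W where "open W" "\<And>p. p \<in> dom_of c \<Longrightarrow> coord c p \<in> W \<longleftrightarrow> p \<in> V"
proof -
  have "openin (top_of_set (patch c)) {x\<in>topspace (top_of_set (patch c)). chart_inv c x \<in> V}"
    by (rule openin_continuous_map_preimage[OF continuous_chart_inv[OF c] V])
  then obtain W where W: "open W" "{x\<in>patch c. chart_inv c x \<in> V} = patch c \<inter> W"
    by (auto simp: openin_open)
  have "coord c p \<in> W \<longleftrightarrow> p \<in> V" if "p \<in> dom_of c" for p
  proof -
    have "coord c p \<in> {x\<in>patch c. chart_inv c x \<in> V} \<longleftrightarrow> p \<in> V" using that c by simp
    then show ?thesis unfolding W(2) using that by simp
  qed
  then show thesis using W(1) that by blast
qed

lemma chart_at:
  assumes "p \<in> points M"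
  shows "chart_at M p \<in> atlas M" "p \<in> dom_of (chart_at M p)"
proof -
  have "(\<Union>c\<in>atlas M. dom_of c) = points M" using surface unfolding oriented_riemannian_surface_def by blast
  then have "\<exists>c. c \<in> atlas M \<and> p \<in> dom_of c" using assms by blast
  from someI_ex[OF this] show "chart_at M p \<in> atlas M" "p \<in> dom_of (chart_at M p)"
    by (simp_all add: chart_at_def)
qed

lemma inner_riem: "c \<in> atlas M \<Longrightarrow> p \<in> dom_of c \<Longrightarrow> inner_product (riem M c p)"
  using surface unfolding oriented_riemannian_surface_def by blast

lemma continuous_riem: "c \<in> atlas M \<Longrightarrow> continuous_on (patch c) (\<lambda>x. riem M c (chart_inv c x) u v)"
  using surface smooth_on_imp_continuous_on unfolding oriented_riemannian_surface_def by blast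

lemma transition_smooth:
  "c \<in> atlas M \<Longrightarrow> d \<in> atlas M \<Longrightarrow> smooth_on (coord c ` (dom_of c \<inter> dom_of d)) (coord d \<circ> chart_inv c)"
  using surface unfolding oriented_riemannian_surface_def charts_compatible_def Let_def by blast

lemma transition:
  assumes "c \<in> atlas M" "d \<in> atlas M" "p \<in> dom_of c" "p \<in> dom_of d"
  obtains D where "(coord d \<circ> chart_inv c has_derivative D) (at (coord c p) within coord c ` (dom_of c \<inter> dom_of d))"
    "det (matrix D) > 0" "\<And>u v. riem M d p (D u) (D v) = riem M c p u v"
proof -
  have "charts_compatible M c d" using surface assms unfolding oriented_riemannian_surface_def by blast
  then have "\<exists>D. (coord d \<circ> chart_inv c has_derivative D) (at (coord c p) within coord c ` (dom_of c \<inter> dom_of d)) \<and>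
     det (matrix D) > 0 \<and> (\<forall>u v. riem M c p u v = riem M d p (D u) (D v))"
    using assms unfolding charts_compatible_def Let_def by blast
  then show thesis using that by (elim exE conjE) simp
qed

lemma area_density_eq:
  assumes "c \<in> atlas M" "p \<in> dom_of c"
  shows "area_density M c p = sqrt (gram_det (riem M c p))"
  using inner_productD(2)[OF inner_riem[OF assms], of "axis 2 1" "axis 1 1"]
  by (simp add: area_density_def gram_det_def det_2 power2_eq_square)

lemma area_density_pos: "c \<in> atlas M \<Longrightarrow> p \<in> dom_of c \<Longrightarrow> 0 < area_density M c p"
  using gram_det_pos(3)[OF inner_riem] by (simp add: area_density_eq)

lemma density_in_nonneg: "c \<in> atlas M \<Longrightarrow> 0 \<le> density_in c x"
  using area_density_pos[of c "chart_inv c x"] chart_inv_in_dom[of x c]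
  by (cases "x \<in> patch c") (simp_all add: density_in_def less_imp_le)

lemma density_in_pos: "c \<in> atlas M \<Longrightarrow> x \<in> patch c \<Longrightarrow> 0 < density_in c x"
  using area_density_pos[of c "chart_inv c x"] chart_inv_in_dom[of x c] by (simp add: density_in_def)

lemma density_in_coord: "c \<in> atlas M \<Longrightarrow> p \<in> dom_of c \<Longrightarrow> density_in c (coord c p) = area_density M c p"
  by (simp add: density_in_def)

lemma continuous_gram_det: "c \<in> atlas M \<Longrightarrow> continuous_on (patch c) (\<lambda>x. gram_det (riem M c (chart_inv c x)))"
  unfolding gram_det_def by (intro continuous_intros continuous_riem)

lemma continuous_area_density:
  assumes "c \<in> atlas M"
  shows "continuous_on (patch c) (\<lambda>x. area_density M c (chart_inv c x))"
proof (rule continuous_on_eq)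
  show "continuous_on (patch c) (\<lambda>x. sqrt (gram_det (riem M c (chart_inv c x))))"
    by (intro continuous_intros continuous_gram_det assms)
qed (simp add: area_density_eq[OF assms] chart_inv_in_dom)

lemma patch_borel [measurable]: "c \<in> atlas M \<Longrightarrow> patch c \<in> sets borel"
  by (rule lipschitz_patch_borel[OF chart(2)])

lemma density_in_measurable:
  assumes c: "c \<in> atlas M"
  shows "density_in c \<in> borel_measurable borel"
  using borel_measurable_continuous_on_indicator[OF patch_borel[OF c] continuous_area_density[OF c]]
  by (simp add: density_in_def[abs_def])

subsection \<open>Borel sets\<close>

lemma space_borel_sets [simp]: "space borel_sets = points M"
  by (simp add: borel_sets_def space_measure_of_conv)

lemma openin_borel: "openin X U \<Longrightarrow> U \<in> sets borel_sets"
  unfolding borel_sets_def using openin_subset by (subst sets_measure_of) (auto intro: sigma_sets.Basic)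

lemma dom_borel: "c \<in> atlas M \<Longrightarrow> dom_of c \<in> sets borel_sets"
  by (rule openin_borel[OF chart(1)])

lemma coord_measurable:
  assumes c: "c \<in> atlas M"
  shows "coord c \<in> borel_measurable (restrict_space borel_sets (dom_of c))"
proof (rule borel_measurableI)
  fix U :: "(real^2) set" assume U: "open U"
  have "coord c -` U \<inter> space (restrict_space borel_sets (dom_of c)) = {p\<in>dom_of c. coord c p \<in> U}"
    using dom_subset[OF c] by (auto simp: space_restrict_space)
  then show "coord c -` U \<inter> space (restrict_space borel_sets (dom_of c)) \<in> sets (restrict_space borel_sets (dom_of c))"
    using openin_borel[OF openin_coord_preimage[OF c U]] by (subst sets_restrict_space_iff) (auto simp: dom_borel c dom_subset Int_absorb2)
qed

lemma coord_preimage_borel: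
  assumes c: "c \<in> atlas M" and U: "U \<in> sets borel"
  shows "{p\<in>dom_of c. coord c p \<in> U} \<in> sets borel_sets"
proof -
  have "coord c -` U \<inter> space (restrict_space borel_sets (dom_of c)) \<in> sets (restrict_space borel_sets (dom_of c))"
    by (rule measurable_sets[OF coord_measurable[OF c] U])
  moreover have "coord c -` U \<inter> space (restrict_space borel_sets (dom_of c)) = {p\<in>dom_of c. coord c p \<in> U}"
    using dom_subset[OF c] by (auto simp: space_restrict_space)
  ultimately show ?thesis by (auto simp: sets_restrict_space_iff dom_borel c dom_subset Int_absorb2)
qed

lemma chart_inv_measurable:
  assumes c: "c \<in> atlas M"
  shows "chart_inv c \<in> measurable (restrict_space lborel (patch c)) borel_sets"
  unfolding borel_sets_def
proof (rule measurable_measure_of)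
  show "{U. openin X U} \<subseteq> Pow (points M)" using openin_subset by auto
  show "chart_inv c \<in> space (restrict_space lborel (patch c)) \<rightarrow> points M"
  proof
    fix x assume "x \<in> space (restrict_space lborel (patch c))"
    then have "x \<in> patch c" by (simp add: space_restrict_space)
    then show "chart_inv c x \<in> points M" using chart_inv_in_dom[of x c] dom_subset[OF c] by blast
  qed
  fix V assume "V \<in> {U. openin X U}"
  then obtain W where W: "open W" "\<And>p. p \<in> dom_of c \<Longrightarrow> coord c p \<in> W \<longleftrightarrow> p \<in> V"
    using openin_coord_image[OF c] by blast
  have "chart_inv c -` V \<inter> space (restrict_space lborel (patch c)) = patch c \<inter> W"
  proof (rule set_eqI)
    fix x
    show "x \<in> chart_inv c -` V \<inter> space (restrict_space lborel (patch c)) \<longleftrightarrow> x \<in> patch c \<inter> W"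
      using W(2)[OF chart_inv_in_dom[of x]] by (cases "x \<in> patch c") (simp_all add: space_restrict_space)
  qed
  then show "chart_inv c -` V \<inter> space (restrict_space lborel (patch c)) \<in> sets (restrict_space lborel (patch c))"
    using W(1) unfolding sets_restrict_space by (intro image_eqI[of _ _ W]) simp_all
qed

lemma coord_image_borel:
  assumes c: "c \<in> atlas M" and E: "E \<in> sets borel_sets" "E \<subseteq> dom_of c"
  shows "coord c ` E \<in> sets borel"
proof -
  have "chart_inv c -` E \<inter> space (restrict_space lborel (patch c)) \<in> sets (restrict_space lborel (patch c))"
    by (rule measurable_sets[OF chart_inv_measurable[OF c] E(1)])
  moreover have "chart_inv c -` E \<inter> space (restrict_space lborel (patch c)) = coord c ` E"
    unfolding coord_image_eq[OF c E(2)] by (auto simp: space_restrict_space)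
  ultimately show ?thesis using patch_borel[OF c] by (auto simp: sets_restrict_space_iff)
qed

subsection \<open>The area measure in a chart\<close>

text \<open>A measure on all Borel sets of the surface, carried by the domain of the chart, so that
  the measures of several charts can be compared and added.\<close>

definition chart_area :: "'a chart \<Rightarrow> 'a measure" where
  "chart_area c = distr (density (restrict_space lborel (patch c)) (\<lambda>x. ennreal (density_in c x))) borel_sets (chart_inv c)"

lemma sets_chart_area [simp]: "sets (chart_area c) = sets borel_sets"
  by (simp add: chart_area_def)

lemma density_in_measurable_restrict:
  "c \<in> atlas M \<Longrightarrow> (\<lambda>x. ennreal (density_in c x)) \<in> borel_measurable (restrict_space lborel (patch c))"
  using density_in_measurable by (intro measurable_restrict_space1) measurable

lemma nn_integral_chart_area:
  assumes c: "c \<in> atlas M" and f: "f \<in> borel_measurable borel_sets"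
  shows "(\<integral>\<^sup>+p. f p \<partial>chart_area c) =
    (\<integral>\<^sup>+x. ennreal (density_in c x) * f (chart_inv c x) * indicator (patch c) x \<partial>lborel)"
proof -
  have m: "chart_inv c \<in> measurable (density (restrict_space lborel (patch c)) (\<lambda>x. ennreal (density_in c x))) borel_sets"
    using chart_inv_measurable[OF c] by simp
  have m2: "(\<lambda>x. f (chart_inv c x)) \<in> borel_measurable (restrict_space lborel (patch c))"
    by (rule measurable_compose[OF chart_inv_measurable[OF c] f])
  have f': "f \<in> borel_measurable (distr (density (restrict_space lborel (patch c)) (\<lambda>x. ennreal (density_in c x))) borel_sets (chart_inv c))"
    using f by simp
  show ?thesis
    unfolding chart_area_def nn_integral_distr[OF m f'] nn_integral_density[OF density_in_measurable_restrict[OF c] m2]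
    using patch_borel[OF c] by (subst nn_integral_restrict_space) auto
qed

lemma emeasure_chart_area:
  assumes c: "c \<in> atlas M" and E: "E \<in> sets borel_sets"
  shows "emeasure (chart_area c) E =
    (\<integral>\<^sup>+x. ennreal (area_density M c (chart_inv c x)) * indicator (coord c ` (E \<inter> dom_of c)) x \<partial>lborel)"
proof -
  have "emeasure (chart_area c) E = (\<integral>\<^sup>+p. indicator E p \<partial>chart_area c)" using E by simp
  also have "\<dots> = (\<integral>\<^sup>+x. ennreal (density_in c x) * indicator E (chart_inv c x) * indicator (patch c) x \<partial>lborel)"
    using E by (intro nn_integral_chart_area[OF c]) simp
  also have "\<dots> = (\<integral>\<^sup>+x. ennreal (area_density M c (chart_inv c x)) * indicator (coord c ` (E \<inter> dom_of c)) x \<partial>lborel)"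
    unfolding coord_image_eq[OF c Int_lower2]
    by (intro nn_integral_cong) (auto simp: density_in_def indicator_def chart_inv_in_dom)
  finally show ?thesis .
qed

end

section \<open>The area measure\<close>

lemma finite_sum_measure_exists:
  fixes P :: "'i \<Rightarrow> 'a measure" and B :: "'a measure"
  assumes I: "finite I" and sets: "\<And>i. i \<in> I \<Longrightarrow> sets (P i) = sets B"
  obtains Q where "sets Q = sets B" "\<And>E. E \<in> sets B \<Longrightarrow> emeasure Q E = (\<Sum>i\<in>I. emeasure (P i) E)"
proof -
  define f where "f E = (\<Sum>i\<in>I. emeasure (P i) E)" for E
  define Q where "Q = measure_of (space B) (sets B) f"
  have "sigma_algebra (space B) (sets B)" by (rule sets.sigma_algebra_axioms)
  moreover have "positive (sets B) f" by (simp add: positive_def f_def)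
  moreover have "countably_additive (sets B) f"
  proof (rule countably_additiveI)
    fix A :: "nat \<Rightarrow> 'a set" assume A: "range A \<subseteq> sets B" "disjoint_family A"
    have "(\<lambda>n. f (A n)) sums f (\<Union>n. A n)"
      unfolding f_def
    proof (rule sums_sum)
      fix i assume "i \<in> I"
      then have "range A \<subseteq> sets (P i)" using A(1) sets by simp
      then show "(\<lambda>n. emeasure (P i) (A n)) sums emeasure (P i) (\<Union>n. A n)"
        using suminf_emeasure[of A "P i"] A(2) summable_sums[of "\<lambda>n. emeasure (P i) (A n)"] by simp
    qed
    then show "(\<Sum>n. f (A n)) = f (\<Union>n. A n)" by (rule sums_unique[symmetric])
  qed
  ultimately have "E \<in> sets B \<Longrightarrow> emeasure Q E = f E" for E
    unfolding Q_def by (rule emeasure_measure_of_sigma)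
  moreover have "sets Q = sets B" unfolding Q_def by simp
  ultimately show thesis using that by (simp add: f_def)
qed

context riemannian_surface
begin

lemma area_density_transition:
  assumes c: "c \<in> atlas M" "p \<in> dom_of c" and d: "d \<in> atlas M" "p \<in> dom_of d"
    and D: "linear D" "det (matrix D) > 0" "\<And>u v. riem M d p (D u) (D v) = riem M c p u v"
  shows "area_density M c p = det (matrix D) * area_density M d p"
  using gram_det_pullback[OF D(1) inner_riem[OF d] D(3)] D(2)
  by (simp add: area_density_eq[OF c] area_density_eq[OF d] real_sqrt_mult)

text \<open>Change of variables along the coordinate change: its determinant is positive and equals
  the quotient of the two area densities, since it pulls one metric back to the other.\<close>

lemma chart_area_agree:
  assumes c: "c \<in> atlas M" and d: "d \<in> atlas M" and E: "E \<in> sets borel_sets" "E \<subseteq> dom_of c" "E \<subseteq> dom_of d"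
  shows "emeasure (chart_area c) E = emeasure (chart_area d) E"
proof -
  let ?g = "coord d \<circ> chart_inv c"
  have "\<exists>D. (?g has_derivative D) (at x within coord c ` E) \<and> det (matrix D) > 0 \<and>
      area_density M c (chart_inv c x) = det (matrix D) * density_in d (?g x)" if x: "x \<in> coord c ` E" for x
  proof -
    define p where "p = chart_inv c x"
    have p: "p \<in> E" "x = coord c p" using x E c by (auto simp: p_def)
    then obtain D where D: "(?g has_derivative D) (at x within coord c ` (dom_of c \<inter> dom_of d))"
      "det (matrix D) > 0" "\<And>u v. riem M d p (D u) (D v) = riem M c p u v"
      using transition[OF c d, of p] E by blast
    have "(?g has_derivative D) (at x within coord c ` E)"
      by (rule has_derivative_subset[OF D(1)]) (use E in auto)
    moreover have "area_density M c p = det (matrix D) * area_density M d p"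
      using D p E c d has_derivative_linear[OF D(1)] by (intro area_density_transition) auto
    moreover have "density_in d (?g x) = area_density M d p"   proof -
      have "p \<in> dom_of c" "p \<in> dom_of d" using p E by auto
      then show ?thesis using c d p(2) by (simp add: density_in_coord)
    qed
    ultimately show ?thesis using D(2) by (auto simp: p_def)
  qed
  then have "\<forall>x\<in>coord c ` E. \<exists>D. (?g has_derivative D) (at x within coord c ` E) \<and> det (matrix D) > 0 \<and>
      area_density M c (chart_inv c x) = det (matrix D) * density_in d (?g x)" by blast
  then obtain D where D: "\<And>x. x \<in> coord c ` E \<Longrightarrow> (?g has_derivative D x) (at x within coord c ` E)"
    "\<And>x. x \<in> coord c ` E \<Longrightarrow> area_density M c (chart_inv c x) = \<bar>det (matrix (D x))\<bar> * density_in d (?g x)"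
    by (metis abs_of_pos)
  have gE: "?g ` coord c ` E = coord d ` E"
    using chart_inv_image[OF c E(2)] by (metis image_comp)
  have inj: "inj_on ?g (coord c ` E)"
  proof (rule comp_inj_on)
    show "inj_on (chart_inv c) (coord c ` E)"
      unfolding chart_inv_def by (rule inj_on_inv_into) (use E in auto)
    show "inj_on (coord d) (chart_inv c ` coord c ` E)"
      using inj_on_subset[OF inj_coord[OF d] E(3)] by (simp add: chart_inv_image[OF c E(2)])
  qed
  have "emeasure (chart_area c) E = (\<integral>\<^sup>+x. ennreal (area_density M c (chart_inv c x)) * indicator (coord c ` E) x \<partial>lborel)"
    using emeasure_chart_area[OF c E(1)] E(2) by (simp add: Int_absorb2)
  also have "\<dots> = (\<integral>\<^sup>+x. ennreal (\<bar>det (matrix (D x))\<bar> * density_in d (?g x)) * indicator (coord c ` E) x \<partial>lborel)"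
    by (intro nn_integral_cong) (auto simp: indicator_def D(2))
  also have "\<dots> = (\<integral>\<^sup>+y. ennreal (density_in d y) * indicator (?g ` coord c ` E) y \<partial>lborel)"
    by (rule nn_integral_change_of_variables[OF _ D(1) inj density_in_measurable[OF d] density_in_nonneg[OF d]])
       (use coord_image_borel[OF c E(1,2)] in simp)
  also have "\<dots> = (\<integral>\<^sup>+y. ennreal (area_density M d (chart_inv d y)) * indicator (coord d ` E) y \<partial>lborel)"
    unfolding gE using E(3) by (intro nn_integral_cong) (auto simp: indicator_def density_in_def)
  also have "\<dots> = emeasure (chart_area d) E"
    using emeasure_chart_area[OF d E(1)] E(3) by (simp add: Int_absorb2)
  finally show ?thesis .
qed

end

locale compact_surface = riemannian_surface +
  assumes compact: "compact_space X"
begin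

text \<open>A finite subcover, made disjoint by removing from each set the earlier ones. The
  property \<open>Q\<close> is kept abstract because it will stand for chart domains, for sets of
  finite area and for the pieces of a map.\<close>

lemma compact_borel_partition:
  assumes Q: "\<And>p. p \<in> points M \<Longrightarrow> \<exists>U. openin X U \<and> p \<in> U \<and> Q U"
  obtains n :: nat and U D where "\<And>i. i < n \<Longrightarrow> openin X (U i)" "\<And>i. i < n \<Longrightarrow> Q (U i)"
    "\<And>i. i < n \<Longrightarrow> D i \<in> sets borel_sets" "\<And>i. i < n \<Longrightarrow> D i \<subseteq> U i"
    "disjoint_family_on D {..<n}" "(\<Union>i<n. D i) = points M"
proof -
  let ?\<U> = "{U. openin X U \<and> Q U}"
  have "Ball ?\<U> (openin X)" "points M \<subseteq> \<Union>?\<U>" using Q by auto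
  then obtain \<F> where F: "finite \<F>" "\<F> \<subseteq> ?\<U>" "points M \<subseteq> \<Union>\<F>"
    using compact unfolding compact_space_alt by meson
  obtain n :: nat and U where U: "\<F> = U ` {i. i < n}" using finite_imp_nat_seg_image_inj_on[OF F(1)] by metis
  have op: "openin X (U i)" "Q (U i)" if "i < n" for i using F(2) U that by auto
  define D where "D i = U i - (\<Union>j<i. U j)" for i
  show thesis
  proof (rule that[of n U D])
    show "D i \<in> sets borel_sets" if "i < n" for i
      unfolding D_def using op that by (intro sets.Diff sets.finite_UN) (auto intro: openin_borel)
    show "D i \<subseteq> U i" for i by (auto simp: D_def)
    show "disjoint_family_on D {..<n}"
      unfolding disjoint_family_on_def
    proof (intro ballI impI)
      fix i j :: nat assume "i \<noteq> j"
      then consider "i < j" | "j < i" by linarith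
      then show "D i \<inter> D j = {}" by cases (auto simp: D_def)
    qed
    show "(\<Union>i<n. D i) = points M"
    proof
      show "(\<Union>i<n. D i) \<subseteq> points M" using op(1) openin_subset by (fastforce simp: D_def)
      show "points M \<subseteq> (\<Union>i<n. D i)"
      proof
        fix p assume "p \<in> points M"
        then have ex: "\<exists>i. i < n \<and> p \<in> U i" using F(3) U by auto
        define i where "i = (LEAST i. i < n \<and> p \<in> U i)"
        have i: "i < n" "p \<in> U i" using LeastI_ex[OF ex] by (auto simp: i_def)
        have "p \<notin> U j" if "j < i" for j using not_less_Least[of j "\<lambda>i. i < n \<and> p \<in> U i"] that i by (auto simp: i_def)
        then show "p \<in> (\<Union>i<n. D i)" using i by (auto simp: D_def)
      qed
    qed
  qed (use op in auto)
qed

lemma chart_partition: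
  obtains n :: nat and F D where "\<And>i. i < n \<Longrightarrow> F i \<in> atlas M" "\<And>i. i < n \<Longrightarrow> D i \<in> sets borel_sets"
    "\<And>i. i < n \<Longrightarrow> D i \<subseteq> dom_of (F i)" "disjoint_family_on D {..<n}" "(\<Union>i<n. D i) = points M"
proof -
  have "\<exists>U. openin X U \<and> p \<in> U \<and> (\<exists>c\<in>atlas M. U = dom_of c)" if "p \<in> points M" for p
    using chart_at[OF that] chart(1) by blast
  then obtain n :: nat and U D where *: "\<And>i. i < n \<Longrightarrow> \<exists>c\<in>atlas M. U i = dom_of c"
    "\<And>i. i < n \<Longrightarrow> D i \<in> sets borel_sets" "\<And>i. i < n \<Longrightarrow> D i \<subseteq> U i"
    "disjoint_family_on D {..<n}" "(\<Union>i<n. D i) = points M"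
    using compact_borel_partition[where Q="\<lambda>U. \<exists>c\<in>atlas M. U = dom_of c"] by metis
  from *(1) have "\<forall>i. \<exists>c. i < n \<longrightarrow> c \<in> atlas M \<and> U i = dom_of c" by blast
  then obtain F where F: "\<And>i. i < n \<Longrightarrow> F i \<in> atlas M \<and> U i = dom_of (F i)" by metis
  show thesis by (rule that[of n F D]) (use F * in auto)
qed

lemma emeasure_partition:
  assumes \<mu>: "sets \<mu> = sets borel_sets" and D: "\<And>i. i < (n::nat) \<Longrightarrow> D i \<in> sets borel_sets" "disjoint_family_on D {..<n}"
    and E: "E \<in> sets borel_sets" "E \<subseteq> (\<Union>i<n. D i)"
  shows "emeasure \<mu> E = (\<Sum>i<n. emeasure \<mu> (E \<inter> D i))"
proof -
  have "(\<Sum>i<n. emeasure \<mu> (E \<inter> D i)) = emeasure \<mu> (\<Union>i<n. E \<inter> D i)"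
    using D E(1) by (intro sum_emeasure) (auto simp: \<mu> disjoint_family_on_def)
  also have "(\<Union>i<n. E \<inter> D i) = E" using E(2) by auto
  finally show ?thesis by simp
qed

text \<open>This justifies the THE in \<open>borel_area_measure\<close>. The chart measures
  restricted to a finite partition are added up; by \<open>chart_area_agree\<close> the sum has the
  prescribed values in every chart, and these values determine it since every Borel set splits into
  parts lying in charts.\<close>

lemma borel_area_measure_ex1:
  "\<exists>!\<mu>. sets \<mu> = sets borel_sets \<and> (\<forall>c\<in>atlas M. \<forall>E\<in>sets \<mu>. E \<subseteq> dom_of c \<longrightarrow> emeasure \<mu> E = emeasure (chart_area c) E)"
proof -
  obtain n :: nat and F D where F: "\<And>i. i < n \<Longrightarrow> F i \<in> atlas M" and D: "\<And>i. i < n \<Longrightarrow> D i \<in> sets borel_sets"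
    "\<And>i. i < n \<Longrightarrow> D i \<subseteq> dom_of (F i)" "disjoint_family_on D {..<n}" "(\<Union>i<n. D i) = points M"
    using chart_partition by blast
  have sub: "E \<subseteq> (\<Union>i<n. D i)" if "E \<in> sets borel_sets" for E
    using sets.sets_into_space[OF that] D(4) by simp
  show ?thesis
  proof (rule ex_ex1I)
    obtain Q where Q: "sets Q = sets borel_sets"
      "\<And>E. E \<in> sets borel_sets \<Longrightarrow> emeasure Q E = (\<Sum>i<n. emeasure (density (chart_area (F i)) (indicator (D i))) E)"
      by (rule finite_sum_measure_exists[of "{..<n}" "\<lambda>i. density (chart_area (F i)) (indicator (D i))" borel_sets]) auto
    have "emeasure Q E = emeasure (chart_area c) E" if c: "c \<in> atlas M" and E: "E \<in> sets borel_sets" "E \<subseteq> dom_of c" for c E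
    proof -
      have "emeasure (density (chart_area (F i)) (indicator (D i))) E = emeasure (chart_area c) (E \<inter> D i)" if i: "i < n" for i
      proof -
        have "emeasure (density (chart_area (F i)) (indicator (D i))) E = (\<integral>\<^sup>+p. indicator (D i) p * indicator E p \<partial>chart_area (F i))"
          using D(1)[OF i] E(1) by (intro emeasure_density borel_measurable_indicator) simp_all
        also have "\<dots> = (\<integral>\<^sup>+p. indicator (E \<inter> D i) p \<partial>chart_area (F i))"
          by (intro nn_integral_cong) (auto simp: indicator_def)
        also have "\<dots> = emeasure (chart_area (F i)) (E \<inter> D i)" using D(1)[OF i] E(1) by (intro nn_integral_indicator) auto
        also have "\<dots> = emeasure (chart_area c) (E \<inter> D i)"
          by (rule chart_area_agree[OF F[OF i] c]) (use D(1,2)[OF i] E in auto)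
        finally show ?thesis .
      qed
      then have "emeasure Q E = (\<Sum>i<n. emeasure (chart_area c) (E \<inter> D i))" using Q(2)[OF E(1)] by simp
      also have "\<dots> = emeasure (chart_area c) E"
        by (rule emeasure_partition[symmetric]) (use D E sub in auto)
      finally show ?thesis .
    qed
    then show "\<exists>\<mu>. sets \<mu> = sets borel_sets \<and> (\<forall>c\<in>atlas M. \<forall>E\<in>sets \<mu>. E \<subseteq> dom_of c \<longrightarrow> emeasure \<mu> E = emeasure (chart_area c) E)"
      using Q(1) by (intro exI[of _ Q]) auto
  next
    fix \<mu> \<nu>
    assume \<mu>: "sets \<mu> = sets borel_sets \<and> (\<forall>c\<in>atlas M. \<forall>E\<in>sets \<mu>. E \<subseteq> dom_of c \<longrightarrow> emeasure \<mu> E = emeasure (chart_area c) E)"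
      and \<nu>: "sets \<nu> = sets borel_sets \<and> (\<forall>c\<in>atlas M. \<forall>E\<in>sets \<nu>. E \<subseteq> dom_of c \<longrightarrow> emeasure \<nu> E = emeasure (chart_area c) E)"
    show "\<mu> = \<nu>"
    proof (rule measure_eqI)
      show "sets \<mu> = sets \<nu>" using \<mu> \<nu> by simp
      fix E assume "E \<in> sets \<mu>"
      then have E: "E \<in> sets borel_sets" using \<mu> by simp
      have "emeasure \<mu> (E \<inter> D i) = emeasure \<nu> (E \<inter> D i)" if "i < n" for i
      proof -
        have *: "E \<inter> D i \<in> sets borel_sets" "E \<inter> D i \<subseteq> dom_of (F i)" using D(1,2)[OF that] E by auto
        then have "emeasure \<mu> (E \<inter> D i) = emeasure (chart_area (F i)) (E \<inter> D i)"
          using \<mu> F[OF that] by simp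
        also have "\<dots> = emeasure \<nu> (E \<inter> D i)" using \<nu> F[OF that] * by simp
        finally show ?thesis .
      qed
      then show "emeasure \<mu> E = emeasure \<nu> E"
        using emeasure_partition[of \<mu> n D E] emeasure_partition[of \<nu> n D E] \<mu> \<nu> D E sub[OF E] by simp
    qed
  qed
qed

lemma borel_area_measure:
  shows sets_borel_area_measure: "sets (borel_area_measure M) = sets borel_sets"
    and emeasure_borel_area_measure: "\<And>c E. c \<in> atlas M \<Longrightarrow> E \<in> sets borel_sets \<Longrightarrow> E \<subseteq> dom_of c \<Longrightarrow>
      emeasure (borel_area_measure M) E = emeasure (chart_area c) E"
proof -
  let ?P = "\<lambda>\<mu>. sets \<mu> = sets borel_sets \<and> (\<forall>c\<in>atlas M. \<forall>E\<in>sets \<mu>. E \<subseteq> dom_of c \<longrightarrow> emeasure \<mu> E = emeasure (chart_area c) E)"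
  have "(\<forall>c\<in>atlas M. \<forall>E\<in>sets \<mu>. E \<subseteq> dom_of c \<longrightarrow> emeasure \<mu> E =
       (\<integral>\<^sup>+ x. ennreal (area_density M c (chart_inv c x)) * indicator (coord c ` E) x \<partial>lborel))
      \<longleftrightarrow> (\<forall>c\<in>atlas M. \<forall>E\<in>sets \<mu>. E \<subseteq> dom_of c \<longrightarrow> emeasure \<mu> E = emeasure (chart_area c) E)"
    if "sets \<mu> = sets borel_sets" for \<mu>
  proof (intro ball_cong imp_cong refl)
    fix c E assume "c \<in> atlas M" "E \<in> sets \<mu>" "E \<subseteq> dom_of c"
    then show "(emeasure \<mu> E = (\<integral>\<^sup>+ x. ennreal (area_density M c (chart_inv c x)) * indicator (coord c ` E) x \<partial>lborel))
      \<longleftrightarrow> (emeasure \<mu> E = emeasure (chart_area c) E)"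
      using emeasure_chart_area[of c E] that by (simp add: Int_absorb2)
  qed
  then have "borel_area_measure M = (THE \<mu>. ?P \<mu>)"
    unfolding borel_area_measure_def borel_sets_def[symmetric] by (intro arg_cong[where f=The] ext conj_cong refl) 
  with theI'[OF borel_area_measure_ex1] have P: "?P (borel_area_measure M)" by simp
  then show "sets (borel_area_measure M) = sets borel_sets" by blast
  show "\<And>c E. c \<in> atlas M \<Longrightarrow> E \<in> sets borel_sets \<Longrightarrow> E \<subseteq> dom_of c \<Longrightarrow>
      emeasure (borel_area_measure M) E = emeasure (chart_area c) E"
    using P by simp
qed

section \<open>Integrals, null sets and the total area\<close>

abbreviation \<mu> :: "'a measure" where "\<mu> \<equiv> borel_area_measure M"

lemma space_area [simp]: "space \<mu> = points M"
  using sets_eq_imp_space_eq[OF sets_borel_area_measure] by simp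

lemma nn_integral_area_chart:
  assumes c: "c \<in> atlas M" and E: "E \<in> sets borel_sets" "E \<subseteq> dom_of c" and f: "f \<in> borel_measurable borel_sets"
  shows "(\<integral>\<^sup>+p. f p * indicator E p \<partial>\<mu>) =
    (\<integral>\<^sup>+x. ennreal (density_in c x) * f (chart_inv c x) * indicator (coord c ` E) x \<partial>lborel)"
proof -
  note E(1)[measurable] f[measurable]
  have "density \<mu> (indicator E) = density (chart_area c) (indicator E)"
  proof (rule measure_eqI)
    fix A assume "A \<in> sets (density \<mu> (indicator E))"
    then have A: "A \<in> sets borel_sets" by (simp add: sets_borel_area_measure)
    have *: "emeasure (density \<nu> (indicator E)) A = emeasure \<nu> (A \<inter> E)" if "sets \<nu> = sets borel_sets" for \<nu>
    proof -
      have "emeasure (density \<nu> (indicator E)) A = (\<integral>\<^sup>+p. indicator E p * indicator A p \<partial>\<nu>)"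
        using A E that by (intro emeasure_density borel_measurable_indicator) simp_all
      also have "\<dots> = (\<integral>\<^sup>+p. indicator (A \<inter> E) p \<partial>\<nu>)" by (intro nn_integral_cong) (auto simp: indicator_def)
      finally show ?thesis using A E that by simp
    qed
    show "emeasure (density \<mu> (indicator E)) A = emeasure (density (chart_area c) (indicator E)) A"
      using A E by (subst (1 2) *) (auto simp: sets_borel_area_measure intro!: emeasure_borel_area_measure c)
  qed (simp add: sets_borel_area_measure)
  moreover have "(\<integral>\<^sup>+p. f p * indicator E p \<partial>\<nu>) = (\<integral>\<^sup>+p. f p \<partial>density \<nu> (indicator E))" if "sets \<nu> = sets borel_sets" for \<nu>
  proof -
    have "f \<in> borel_measurable \<nu>" "(indicator E :: 'a \<Rightarrow> ennreal) \<in> borel_measurable \<nu>"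
      unfolding measurable_cong_sets[OF that refl] by measurable
    then show ?thesis by (subst nn_integral_density) (auto simp: mult.commute)
  qed
  ultimately have "(\<integral>\<^sup>+p. f p * indicator E p \<partial>\<mu>) = (\<integral>\<^sup>+p. f p * indicator E p \<partial>chart_area c)"
    by (simp add: sets_borel_area_measure)
  also have "\<dots> = (\<integral>\<^sup>+x. ennreal (density_in c x) * (f (chart_inv c x) * indicator E (chart_inv c x)) * indicator (patch c) x \<partial>lborel)"
    using f E by (intro nn_integral_chart_area[OF c]) measurable
  also have "\<dots> = (\<integral>\<^sup>+x. ennreal (density_in c x) * f (chart_inv c x) * indicator (coord c ` E) x \<partial>lborel)"
    unfolding coord_image_eq[OF c E(2)] by (intro nn_integral_cong) (auto simp: indicator_def)
  finally show ?thesis .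
qed

lemma emeasure_area_chart:
  assumes c: "c \<in> atlas M" and E: "E \<in> sets borel_sets" "E \<subseteq> dom_of c"
  shows "emeasure \<mu> E = (\<integral>\<^sup>+x. ennreal (density_in c x) * indicator (coord c ` E) x \<partial>lborel)"
  using nn_integral_area_chart[OF c E, of "\<lambda>_. 1"] E by (simp add: sets_borel_area_measure)

text \<open>The density is positive on the patch, so null sets correspond for Borel sets. An
  arbitrary \<open>T\<close> is enclosed in a Borel null set on either side, which is possible
  because both measures are completed.\<close>

lemma null_area_iff_negligible:
  assumes c: "c \<in> atlas M" and T: "T \<subseteq> dom_of c"
  shows "T \<in> null_sets (area_measure M) \<longleftrightarrow> negligible (coord c ` T)"
proof
  assume "T \<in> null_sets (area_measure M)"
  then obtain Z where Z: "T \<subseteq> Z" "Z \<in> null_sets \<mu>"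
    unfolding area_measure_def null_sets_completion_iff2 by blast
  define E where "E = Z \<inter> dom_of c"
  have E: "E \<in> sets borel_sets" "E \<subseteq> dom_of c" "T \<subseteq> E"
    using Z T dom_borel[OF c] by (auto simp: E_def null_sets_def sets_borel_area_measure)
  have "emeasure \<mu> E \<le> emeasure \<mu> Z" using Z by (intro emeasure_mono) (auto simp: E_def)
  then have "emeasure \<mu> E = 0" using Z(2) by auto
  then have "(\<integral>\<^sup>+x. ennreal (density_in c x) * indicator (coord c ` E) x \<partial>lborel) = 0"
    using emeasure_area_chart[OF c E(1,2)] by simp
  moreover have m: "(\<lambda>x. ennreal (density_in c x) * indicator (coord c ` E) x) \<in> borel_measurable lborel"
    using density_in_measurable[OF c] coord_image_borel[OF c E(1,2)] by measurable
  ultimately have "AE x in lborel. ennreal (density_in c x) * indicator (coord c ` E) x = 0"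
    by (simp add: nn_integral_0_iff_AE)
  then have "AE x in lborel. x \<notin> coord c ` E"
  proof eventually_elim
    case (elim x)
    show ?case
    proof
      assume x: "x \<in> coord c ` E"
      then have "0 < density_in c x" using density_in_pos[OF c, of x] E(2) by auto
      then show False using elim x by simp
    qed
  qed
  then have "coord c ` E \<in> null_sets lborel" using AE_iff_null_sets[of "coord c ` E" lborel] coord_image_borel[OF c E(1,2)] by simp
  then have "negligible (coord c ` E)" by (simp add: negligible_iff_null_sets null_sets_completionI)
  then show "negligible (coord c ` T)" by (rule negligible_subset) (use E in auto)
next
  assume "negligible (coord c ` T)"
  then obtain Z where Z: "Z \<in> null_sets lborel" "coord c ` T \<subseteq> Z"
    unfolding negligible_iff_null_sets null_sets_completion_iff2 by blast
  define E where "E = {p\<in>dom_of c. coord c p \<in> Z}"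
  have Zb: "Z \<in> sets borel" using Z(1) by auto
  have E: "E \<in> sets borel_sets" "E \<subseteq> dom_of c" "T \<subseteq> E"
    using coord_preimage_borel[OF c Zb] Z(2) T by (auto simp: E_def)
  have "AE x in lborel. x \<notin> Z" using Z(1) by (rule AE_not_in)
  then have "(\<integral>\<^sup>+x. ennreal (density_in c x) * indicator (coord c ` E) x \<partial>lborel) = (\<integral>\<^sup>+x. 0 \<partial>(lborel :: (real^2) measure))"
  proof (intro nn_integral_cong_AE, eventually_elim)
    fix x assume "x \<notin> Z"
    then have "x \<notin> coord c ` E" by (auto simp: E_def)
    then show "ennreal (density_in c x) * indicator (coord c ` E) x = 0" by simp
  qed
  then have "emeasure \<mu> E = 0" using emeasure_area_chart[OF c E(1,2)] by simp
  then have "E \<in> null_sets \<mu>" using E(1) by (simp add: null_sets_def sets_borel_area_measure)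
  then show "T \<in> null_sets (area_measure M)"
    unfolding area_measure_def null_sets_completion_iff2 using E(3) by blast
qed

text \<open>The density is continuous up to the boundary of a patch, hence bounded near each point,
  and compactness leaves finitely many such neighbourhoods.\<close>

lemma emeasure_points_finite: "emeasure \<mu> (points M) < \<infinity>"
proof -
  have "\<exists>U. openin X U \<and> p \<in> U \<and> emeasure \<mu> U < \<infinity>" if p: "p \<in> points M" for p
  proof -
    define c where "c = chart_at M p"
    have c: "c \<in> atlas M" "p \<in> dom_of c" using chart_at[OF p] by (simp_all add: c_def)
    have "continuous (at (coord c p) within patch c) (\<lambda>x. area_density M c (chart_inv c x))"
      using continuous_area_density[OF c(1)] c(2) by (simp add: continuous_on_eq_continuous_within)
    then obtain r where r: "r > 0" "\<And>x. x \<in> patch c \<Longrightarrow> dist x (coord c p) < r \<Longrightarrow>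
        dist (area_density M c (chart_inv c x)) (area_density M c (chart_inv c (coord c p))) < 1"
      unfolding continuous_within_eps_delta by (meson zero_less_one)
    define K where "K = area_density M c p + 1"
    define U where "U = {q\<in>dom_of c. coord c q \<in> ball (coord c p) r}"
    have U: "openin X U" "p \<in> U" "U \<subseteq> dom_of c"
      using openin_coord_preimage[OF c(1), of "ball (coord c p) r"] c(2) r(1) by (auto simp: U_def)
    have le: "density_in c x \<le> K" if "x \<in> coord c ` U" for x
    proof -
      have x: "x \<in> patch c" "dist x (coord c p) < r" using that by (auto simp: U_def dist_commute)
      then show ?thesis using r(2)[OF x] c by (simp add: density_in_def K_def dist_real_def)
    qed
    have "emeasure \<mu> U = (\<integral>\<^sup>+x. ennreal (density_in c x) * indicator (coord c ` U) x \<partial>lborel)"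
      by (rule emeasure_area_chart[OF c(1) openin_borel[OF U(1)] U(3)])
    also have "\<dots> \<le> (\<integral>\<^sup>+x. ennreal K * indicator (ball (coord c p) r) x \<partial>lborel)"
    proof (rule nn_integral_mono)
      fix x
      show "ennreal (density_in c x) * indicator (coord c ` U) x \<le> ennreal K * indicator (ball (coord c p) r) x"
      proof (cases "x \<in> coord c ` U")
        case True
        then have "x \<in> ball (coord c p) r" by (auto simp: U_def)
        then show ?thesis using le[OF True] True by (simp add: ennreal_leI)
      qed simp
    qed
    also have "\<dots> < \<infinity>" using emeasure_bounded_finite[OF bounded_ball, of "coord c p" r]
      by (simp add: nn_integral_cmult_indicator ennreal_mult_less_top)
    finally show ?thesis using U by blast
  qed
  then obtain n :: nat and U D where *: "\<And>i. i < n \<Longrightarrow> openin X (U i)" "\<And>i. i < n \<Longrightarrow> emeasure \<mu> (U i) < \<infinity>"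
    "\<And>i. i < n \<Longrightarrow> D i \<in> sets borel_sets" "\<And>i. i < n \<Longrightarrow> D i \<subseteq> U i" "disjoint_family_on D {..<n}" "(\<Union>i<n. D i) = points M"
    using compact_borel_partition[where Q="\<lambda>U. emeasure \<mu> U < \<infinity>"] by blast
  have "emeasure \<mu> (points M) = (\<Sum>i<n. emeasure \<mu> (points M \<inter> D i))"
    by (rule emeasure_partition) (use * sets.top[of borel_sets] in \<open>auto simp: sets_borel_area_measure\<close>)
  also have "\<dots> < \<infinity>"
  proof -
    have "emeasure \<mu> (points M \<inter> D i) < \<infinity>" if "i < n" for i
      using *(1-4)[OF that] openin_borel
      by (intro order.strict_trans1[OF emeasure_mono *(2)[OF that]]) (auto simp: sets_borel_area_measure)
    then show ?thesis by simp
  qed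
  finally show ?thesis .
qed

lemma emeasure_points_pos: "emeasure \<mu> (points M) > 0"
proof (rule ccontr)
  assume "\<not> emeasure \<mu> (points M) > 0"
  then have 0: "emeasure \<mu> (points M) = 0" by simp
  have "points M \<noteq> {}" using surface unfolding oriented_riemannian_surface_def by blast
  then obtain p where p: "p \<in> points M" by blast
  define c where "c = chart_at M p"
  have c: "c \<in> atlas M" "p \<in> dom_of c" using chart_at[OF p] by (simp_all add: c_def)
  have "emeasure \<mu> (dom_of c) \<le> emeasure \<mu> (points M)"
    using dom_subset[OF c(1)] sets.top[of \<mu>] by (intro emeasure_mono) simp_all
  then have "dom_of c \<in> null_sets \<mu>" using 0 dom_borel[OF c(1)] by (auto simp: null_sets_def sets_borel_area_measure)
  then have "dom_of c \<in> null_sets (area_measure M)" by (simp add: area_measure_def null_sets_completionI)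
  then have "negligible (patch c)" using null_area_iff_negligible[OF c(1)] by blast
  then have "negligible (interior (patch c))" using negligible_subset interior_subset by blast
  then have "interior (patch c) = {}" using open_not_negligible[OF open_interior] by blast
  then show False using lipschitz_patch_interior_nonempty[OF chart(2)[OF c(1)]] c(2) by blast
qed

lemma total_area_pos: "0 < total_area M"
  unfolding area_def area_measure_def measure_def
  using emeasure_points_pos emeasure_points_finite sets.top[of \<mu>]
  by (simp add: enn2real_positive_iff)

end

section \<open>Geodesic distance in charts\<close>

text \<open>Eigenvalue bounds that are visibly continuous in the coefficients. The lower one is
  Cayley-Hamilton: with \<open>B\<close> the Gram matrix, T B - det B is the square of
  \<open>B\<close>, a nonnegative form. For the upper one, the trace form minus the form itself is
  the form evaluated at the vector turned by a right angle.\<close>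

lemma inner_product_trace_bounds:
  fixes b :: "real^2 \<Rightarrow> real^2 \<Rightarrow> real"
  assumes b: "inner_product b"
  defines "T \<equiv> b (axis 1 1) (axis 1 1) + b (axis 2 1) (axis 2 1)"
  shows "gram_det b / T * (norm v)\<^sup>2 \<le> b v v" "b v v \<le> T * (norm v)\<^sup>2"
proof -
  let ?G = "b (axis 1 1) (axis 1 1)" and ?H = "b (axis 1 1) (axis 2 1)" and ?K = "b (axis 2 1) (axis 2 1)"
  have T: "T > 0" using gram_det_pos[OF b] by (simp add: T_def)
  have n: "(norm v)\<^sup>2 = v$1 * v$1 + v$2 * v$2"
    by (simp add: power2_norm_eq_inner inner_vec_def sum_2)
  have "T * b v v - gram_det b * (norm v)\<^sup>2 = (?G * v$1 + ?H * v$2)\<^sup>2 + (?H * v$1 + ?K * v$2)\<^sup>2"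
    unfolding n T_def gram_det_def inner_product_real2[OF b, of v v] by (simp add: algebra_simps power2_eq_square)
  then have "gram_det b * (norm v)\<^sup>2 \<le> T * b v v" using sum_power2_ge_zero[of "?G * v$1 + ?H * v$2" "?H * v$1 + ?K * v$2"] by linarith
  then show "gram_det b / T * (norm v)\<^sup>2 \<le> b v v" using T by (simp add: field_simps)
  define w :: "real^2" where "w = vector [v$2, - (v$1)]"
  have "T * (norm v)\<^sup>2 - b v v = b w w"
    unfolding n T_def inner_product_real2[OF b, of v v] inner_product_real2[OF b, of w w] by (simp add: w_def algebra_simps)
  moreover have "0 \<le> b w w" using inner_product_coord_norm[OF b] by simp
  ultimately show "b v v \<le> T * (norm v)\<^sup>2" by linarith
qed

context riemannian_surface
begin

lemma metric_bounds:
  assumes c: "c \<in> atlas M" and p: "p \<in> dom_of c"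
  obtains R m K where "R > 0" "m > 0" "K > 0"
    "\<And>x v. x \<in> patch c \<Longrightarrow> dist (coord c p) x < R \<Longrightarrow> m * (norm v)\<^sup>2 \<le> riem M c (chart_inv c x) v v"
    "\<And>x v. x \<in> patch c \<Longrightarrow> dist (coord c p) x < R \<Longrightarrow> riem M c (chart_inv c x) v v \<le> K * (norm v)\<^sup>2"
proof -
  define T where "T x = riem M c (chart_inv c x) (axis 1 1) (axis 1 1) + riem M c (chart_inv c x) (axis 2 1) (axis 2 1)" for x
  define d where "d x = gram_det (riem M c (chart_inv c x)) / T x" for x
  have inn: "inner_product (riem M c (chart_inv c x))" if "x \<in> patch c" for x
    using inner_riem[OF c chart_inv_in_dom[OF that]] .
  have Tp: "T x > 0" and dp: "d x > 0" if "x \<in> patch c" for x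
    using gram_det_pos[OF inn[OF that]] by (simp_all add: T_def d_def)
  have cT: "continuous_on (patch c) T" unfolding T_def by (intro continuous_intros continuous_riem c)
  have cd: "continuous_on (patch c) d"
    unfolding d_def using Tp by (intro continuous_on_divide continuous_gram_det c cT) force
  let ?x = "coord c p"
  have x: "?x \<in> patch c" using p by simp
  obtain r1 where r1: "r1 > 0" "\<And>x. x \<in> patch c \<Longrightarrow> dist x ?x < r1 \<Longrightarrow> dist (T x) (T ?x) < 1"
    using cT x unfolding continuous_on_iff by (meson zero_less_one)
  obtain r2 where r2: "r2 > 0" "\<And>x. x \<in> patch c \<Longrightarrow> dist x ?x < r2 \<Longrightarrow> dist (d x) (d ?x) < d ?x / 2"
    using cd x dp[OF x] unfolding continuous_on_iff by (meson half_gt_zero)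
  show thesis
  proof (rule that[of "min r1 r2" "d ?x / 2" "T ?x + 1"])
    show "min r1 r2 > 0" "d ?x / 2 > 0" "T ?x + 1 > 0" using r1 r2 dp[OF x] Tp[OF x] by auto
    fix y and v :: "real^2" assume y: "y \<in> patch c" "dist ?x y < min r1 r2"
    have "\<bar>T y - T ?x\<bar> < 1" "\<bar>d y - d ?x\<bar> < d ?x / 2"
      using r1(2)[OF y(1)] r2(2)[OF y(1)] y(2) by (simp_all add: dist_commute dist_real_def)
    then have "T y \<le> T ?x + 1" "d ?x / 2 \<le> d y" by linarith+
    then have "d ?x / 2 * (norm v)\<^sup>2 \<le> d y * (norm v)\<^sup>2" "T y * (norm v)\<^sup>2 \<le> (T ?x + 1) * (norm v)\<^sup>2"
      by (simp_all only: mult_right_mono[OF _ zero_le_power2])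
    with inner_product_trace_bounds[OF inn[OF y(1)], of v]
    show "d ?x / 2 * (norm v)\<^sup>2 \<le> riem M c (chart_inv c y) v v" "riem M c (chart_inv c y) v v \<le> (T ?x + 1) * (norm v)\<^sup>2"
      by (auto simp: d_def T_def)
  qed
qed

lemma curve_neighbourhood:
  assumes \<gamma>: "continuous_map (top_of_set {0..1}) X \<gamma>" and t: "t \<in> {0<..<1::real}" and V: "openin X V" "\<gamma> t \<in> V"
  obtains T where "open T" "t \<in> T" "T \<subseteq> {0<..<1}" "\<gamma> ` T \<subseteq> V"
proof -
  have "openin (top_of_set {0..1}) {s\<in>topspace (top_of_set {0..1}). \<gamma> s \<in> V}"
    by (rule openin_continuous_map_preimage[OF \<gamma> V(1)])
  then obtain W where W: "open W" "{s\<in>{0..1}. \<gamma> s \<in> V} = {0..1} \<inter> W"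
    by (auto simp: openin_open)
  have "t \<in> {s\<in>{0..1}. \<gamma> s \<in> V}" using t V by auto
  then have "t \<in> W" unfolding W(2) by simp
  have "\<gamma> s \<in> V" if "s \<in> W \<inter> {0<..<1}" for s
  proof -
    have "s \<in> {0..1} \<inter> W" using that by auto
    then show ?thesis unfolding W(2)[symmetric] by simp
  qed
  note \<gamma>V = this
  show thesis
  proof (rule that[of "W \<inter> {0<..<1}"])
    show "open (W \<inter> {0<..<1})" using W(1) by auto
    show "t \<in> W \<inter> {0<..<1}" using \<open>t \<in> W\<close> t by simp
    show "\<gamma> ` (W \<inter> {0<..<1}) \<subseteq> V" using \<gamma>V by blast
  qed simp
qed

text \<open>\<open>speed\<close> uses a chart that is selected anew at every time. Coordinate
  changes are isometric, so any chart around the point gives the same value; at interior times the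
  curve stays in both domains on an open interval, and two-sided derivatives may be
  compared.\<close>

lemma speed_eq:
  assumes \<gamma>: "continuous_map (top_of_set {0..1}) X \<gamma>" and t: "t \<in> {0<..<1}"
    and c: "c \<in> atlas M" "\<gamma> t \<in> dom_of c" and w: "((coord c \<circ> \<gamma>) has_vector_derivative w) (at t)"
  shows "speed M \<gamma> t = sqrt (riem M c (\<gamma> t) w w)"
proof -
  have p: "\<gamma> t \<in> points M" using c dom_subset by blast
  define e where "e = chart_at M (\<gamma> t)"
  have e: "e \<in> atlas M" "\<gamma> t \<in> dom_of e" using chart_at[OF p] by (simp_all add: e_def)
  obtain D where D: "(coord e \<circ> chart_inv c has_derivative D) (at (coord c (\<gamma> t)) within coord c ` (dom_of c \<inter> dom_of e))"
    "det (matrix D) > 0" "\<And>u v. riem M e (\<gamma> t) (D u) (D v) = riem M c (\<gamma> t) u v"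
    by (rule transition[OF c(1) e(1) c(2) e(2)]) (rule that)
  obtain T where T: "open T" "t \<in> T" "T \<subseteq> {0<..<1}" "\<gamma> ` T \<subseteq> dom_of c \<inter> dom_of e"
    by (rule curve_neighbourhood[OF \<gamma> t openin_Int[OF chart(1)[OF c(1)] chart(1)[OF e(1)]] IntI[OF c(2) e(2)]])
  have 1: "((coord c \<circ> \<gamma>) has_derivative (\<lambda>h. h *\<^sub>R w)) (at t within T)"
    using w by (simp add: has_vector_derivative_def has_derivative_at_withinI)
  have sub: "(coord c \<circ> \<gamma>) ` T \<subseteq> coord c ` (dom_of c \<inter> dom_of e)" using T(4) by auto
  have "(coord e \<circ> chart_inv c has_derivative D) (at ((coord c \<circ> \<gamma>) t) within (coord c \<circ> \<gamma>) ` T)"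
    using has_derivative_subset[OF D(1) sub] by simp
  from diff_chain_within[OF 1 this]
  have "((coord e \<circ> chart_inv c) \<circ> (coord c \<circ> \<gamma>) has_derivative (\<lambda>h. D (h *\<^sub>R w))) (at t)"
    using T(1,2) by (simp add: at_within_open[of t T] comp_def)
  then have "(coord e \<circ> \<gamma> has_derivative (\<lambda>h. D (h *\<^sub>R w))) (at t)"
    by (rule has_derivative_transform_within_open[OF _ T(1,2)]) (use T(4) c(1) in auto)
  moreover have "D (h *\<^sub>R w) = h *\<^sub>R D w" for h using linear_cmul[OF has_derivative_linear[OF D(1)]] .
  ultimately have "(coord e \<circ> \<gamma> has_vector_derivative D w) (at t)" by (simp add: has_vector_derivative_def)
  then have "vector_derivative (coord e \<circ> \<gamma>) (at t) = D w" by (rule vector_derivative_at)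
  then show ?thesis by (simp add: speed_def metric_at_def e_def[symmetric] D(3))
qed

subsection \<open>Coordinate segments\<close>

text \<open>The definition tests a curve in every chart of the atlas. In another chart the segment
  is composed with a coordinate change, which is smooth as well.\<close>

lemma coordinate_segment_C1:
  assumes c: "c \<in> atlas M" and seg: "closed_segment a b \<subseteq> patch c"
  defines "\<gamma> \<equiv> \<lambda>t. chart_inv c (a + t *\<^sub>R (b - a))"
  shows "piecewise_C1_curve M \<gamma>"
proof -
  define l where "l = (\<lambda>t. a + t *\<^sub>R (b - a))"
  have \<gamma>: "\<gamma> = (\<lambda>t. chart_inv c (l t))" by (simp add: \<gamma>_def l_def)
  have l: "l t \<in> patch c" if "t \<in> {0..1}" for t
  proof -
    have "l t \<in> closed_segment a b" using that by (auto simp: l_def in_segment algebra_simps intro!: exI[of _ t])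
    then show ?thesis using seg by blast
  qed
  have lc: "continuous_on S l" for S unfolding l_def by (intro continuous_intros)
  have ld: "(l has_vector_derivative (b - a)) (at t)" for t
    unfolding l_def by (auto intro!: derivative_eq_intros)
  have cont: "continuous_map (top_of_set {0..1}) X \<gamma>"
  proof -
    have "continuous_map (top_of_set {0..1}) (top_of_set (patch c)) l"
      using lc l by (auto simp: continuous_map_in_subtopology)
    from continuous_map_compose[OF this continuous_chart_inv[OF c]] show ?thesis by (simp add: \<gamma> comp_def)
  qed
  show ?thesis
    unfolding piecewise_C1_curve_def
  proof (intro conjI cont ballI allI impI)
    fix d \<alpha> \<beta> assume d: "d \<in> atlas M" and ab: "0 \<le> \<alpha> \<and> \<alpha> \<le> \<beta> \<and> \<beta> \<le> 1 \<and> \<gamma> ` {\<alpha>..\<beta>} \<subseteq> dom_of d"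
    let ?h = "coord d \<circ> \<gamma>"
    have "continuous_map (top_of_set {\<alpha>..\<beta>}) (subtopology X (dom_of d)) \<gamma>"
      using continuous_map_from_subtopology_mono[OF cont, of "{\<alpha>..\<beta>}"] ab by (auto simp: continuous_map_in_subtopology)
    from continuous_map_compose[OF this continuous_coord[OF d]] have hc: "continuous_on {\<alpha>..\<beta>} ?h" by simp
    have local_C1: "\<exists>T k. open T \<and> t \<in> T \<and> continuous_on T k \<and> (\<forall>s\<in>T. (?h has_vector_derivative k s) (at s))"
      if t: "t \<in> {\<alpha><..<\<beta>}" for t
    proof -
      have lt: "l s \<in> coord c ` (dom_of c \<inter> dom_of d)" if "s \<in> {\<alpha>..\<beta>}" for s
      proof (rule image_eqI[of _ _ "\<gamma> s"])
        show "l s = coord c (\<gamma> s)" using l[of s] ab that by (simp add: \<gamma>)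
        show "\<gamma> s \<in> dom_of c \<inter> dom_of d" proof
          show "\<gamma> s \<in> dom_of c" using l[of s] ab that chart_inv_in_dom[of "l s" c] by (simp add: \<gamma>)
          have "\<gamma> s \<in> \<gamma> ` {\<alpha>..\<beta>}" using that by (rule imageI)
          then show "\<gamma> s \<in> dom_of d" using ab by blast
        qed
      qed
      \<comment> \<open>The segment may touch the boundary of the patch, so the coordinate change is
        replaced by a smooth extension to an open set around the point.\<close>
      obtain W F where W: "open W" "l t \<in> W" "\<And>k. Ck_on k W F"
        "\<forall>y\<in>coord c ` (dom_of c \<inter> dom_of d) \<inter> W. F y = (coord d \<circ> chart_inv c) y"
        using transition_smooth[OF c d] lt[of t] t unfolding smooth_on_def by (metis greaterThanLessThan_iff atLeastAtMost_iff less_imp_le)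
      have "Ck_on (Suc 0) W F" by (rule W(3))
      then obtain F' where F': "\<And>x. x \<in> W \<Longrightarrow> (F has_derivative F' x) (at x)" "\<And>v. continuous_on W (\<lambda>x. F' x v)"
        by auto
      define T where "T = {\<alpha><..<\<beta>} \<inter> l -` W"
      have "open (l -` W)" by (rule open_vimage[OF W(1) lc])
      then have T: "open T" "t \<in> T" using t W(2) by (auto simp: T_def)
      show ?thesis
      proof (intro exI[of _ T] exI[of _ "\<lambda>s. F' (l s) (b - a)"] conjI T ballI)
        show "continuous_on T (\<lambda>s. F' (l s) (b - a))"
          by (rule continuous_on_compose2[OF F'(2) lc]) (auto simp: T_def)
        fix s assume s: "s \<in> T"
        have "(F has_derivative F' (l s)) (at (l s))" using s F'(1) by (auto simp: T_def)
        then have "(F \<circ> l has_derivative (\<lambda>x. F' (l s) (x *\<^sub>R (b - a)))) (at s)"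
          using diff_chain_at[OF ld[of s, unfolded has_vector_derivative_def]] by (simp add: comp_def)
        moreover have "F' (l s) (x *\<^sub>R (b - a)) = x *\<^sub>R F' (l s) (b - a)" for x
          using has_derivative_linear[OF \<open>(F has_derivative F' (l s)) (at (l s))\<close>] by (rule linear_cmul)
        ultimately have "(F \<circ> l has_vector_derivative F' (l s) (b - a)) (at s)" by (simp add: has_vector_derivative_def)
        then show "(?h has_vector_derivative F' (l s) (b - a)) (at s)"
        proof (rule has_vector_derivative_transform_within_open[OF _ T(1) s])
          fix u assume u: "u \<in> T"
          then have "l u \<in> coord c ` (dom_of c \<inter> dom_of d) \<inter> W" using lt[of u] by (auto simp: T_def)
          then have "F (l u) = (coord d \<circ> chart_inv c) (l u)" using W(4) by blast
          then show "(F \<circ> l) u = ?h u" by (simp add: \<gamma>)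
        qed
      qed
    qed
    have "?h C1_differentiable_on {\<alpha><..<\<beta>}"
      unfolding C1_differentiable_on_eq
    proof (intro conjI ballI continuous_at_imp_continuous_on)
      fix t assume t: "t \<in> {\<alpha><..<\<beta>}"
      obtain T k where T: "open T" "t \<in> T" "continuous_on T k" "\<And>s. s \<in> T \<Longrightarrow> (?h has_vector_derivative k s) (at s)"
        using local_C1[OF t] by blast
      show "?h differentiable (at t)" using T(4)[OF T(2)] by (rule differentiableI_vector)
      have "continuous_on T (\<lambda>s. vector_derivative ?h (at s))"
        by (rule continuous_on_eq[OF T(3)]) (use T(4) vector_derivative_at in force)
      then show "isCont (\<lambda>s. vector_derivative ?h (at s)) t"
        using T(1,2) by (simp add: continuous_on_eq_continuous_at)
    qed
    \<comment> \<open>The endpoints form the exceptional set: beyond them the curve may leave the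
      chart, and the derivative there is two-sided.\<close>
    moreover have "{\<alpha>..\<beta>} - {\<alpha>, \<beta>} = {\<alpha><..<\<beta>}" by auto
    ultimately show "?h piecewise_C1_differentiable_on {\<alpha>..\<beta>}"
      unfolding piecewise_C1_differentiable_on_def using hc by (intro conjI exI[of _ "{\<alpha>, \<beta>}"]) auto
  qed
qed

lemma geodesic_dist_segment_le:
  assumes c: "c \<in> atlas M" and seg: "closed_segment a b \<subseteq> patch c" and K: "K \<ge> 0"
    and le: "\<And>x v. x \<in> closed_segment a b \<Longrightarrow> riem M c (chart_inv c x) v v \<le> K * (norm v)\<^sup>2"
  shows "geodesic_dist M (chart_inv c a) (chart_inv c b) \<le> ennreal (sqrt K * dist a b)"
proof -
  define \<gamma> where "\<gamma> = (\<lambda>t. chart_inv c (a + t *\<^sub>R (b - a)))"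
  have pC1: "piecewise_C1_curve M \<gamma>" unfolding \<gamma>_def by (rule coordinate_segment_C1[OF c seg])
  then have cont: "continuous_map (top_of_set {0..1}) X \<gamma>" by (simp add: piecewise_C1_curve_def)
  have sp: "speed M \<gamma> t \<le> sqrt K * dist a b" if t: "t \<in> {0<..<1}" for t
  proof -
    have l: "a + s *\<^sub>R (b - a) \<in> closed_segment a b" if "s \<in> {0<..<1}" for s
      using that by (auto simp: in_segment algebra_simps intro!: exI[of _ s])
    have "((\<lambda>s. a + s *\<^sub>R (b - a)) has_vector_derivative (b - a)) (at t)" by (auto intro!: derivative_eq_intros)
    then have "((coord c \<circ> \<gamma>) has_vector_derivative (b - a)) (at t)"
    proof (rule has_vector_derivative_transform_within_open[OF _ _ t])
      fix s :: real assume "s \<in> {0<..<1}"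
      then have "a + s *\<^sub>R (b - a) \<in> patch c" using l seg by blast
      then show "a + s *\<^sub>R (b - a) = (coord c \<circ> \<gamma>) s" by (simp add: \<gamma>_def)
    qed simp
    moreover have "\<gamma> t \<in> dom_of c" unfolding \<gamma>_def by (rule chart_inv_in_dom[OF subsetD[OF seg l[OF t]]])
    ultimately have "speed M \<gamma> t = sqrt (riem M c (\<gamma> t) (b - a) (b - a))" by (intro speed_eq[OF cont t c])
    also have "\<dots> \<le> sqrt (K * (norm (b - a))\<^sup>2)" unfolding \<gamma>_def by (intro real_sqrt_le_mono le l t)
    also have "\<dots> = sqrt K * dist a b" using K by (simp add: real_sqrt_mult dist_norm norm_minus_commute)
    finally show ?thesis .
  qed
  have "curve_length M \<gamma> \<le> (\<integral>\<^sup>+ t\<in>{0..1::real}. ennreal (sqrt K * dist a b) \<partial>lborel)"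
    unfolding curve_length_def
  proof (rule nn_integral_mono_AE)
    \<comment> \<open>The speed is under control only at interior times; the two endpoints form a
      null set.\<close>
    have "AE t in lborel. t \<noteq> (0::real)" "AE t in lborel. t \<noteq> (1::real)" by (rule AE_lborel_singleton)+
    then show "AE t in lborel. ennreal (speed M \<gamma> t) * indicator {0..1} t \<le> ennreal (sqrt K * dist a b) * indicator {0..1} t"
    proof eventually_elim
      case (elim t)
      then show ?case using sp[of t] by (auto simp: indicator_def intro!: ennreal_leI)
    qed
  qed
  also have "\<dots> = ennreal (sqrt K * dist a b)" by (simp add: nn_integral_cmult_indicator)
  finally have "curve_length M \<gamma> \<le> ennreal (sqrt K * dist a b)" .
  moreover have "\<gamma> 0 = chart_inv c a" "\<gamma> 1 = chart_inv c b" by (simp_all add: \<gamma>_def)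
  ultimately show ?thesis unfolding geodesic_dist_def using pC1 by (intro INF_lower2[of \<gamma>]) auto
qed

text \<open>Concatenating the three segments is not necessary: Lipschitz estimates add up along them.\<close>

lemma geodesic_dist_three_segments:
  assumes c: "c \<in> atlas M" and p: "p \<in> dom_of c"
  obtains r C where "r > 0" "C \<ge> 0"
    "\<And>x y. x \<in> patch c \<inter> ball (coord c p) r \<Longrightarrow> y \<in> patch c \<inter> ball (coord c p) r \<Longrightarrow> \<exists>a\<in>patch c. \<exists>b\<in>patch c.
       geodesic_dist M (chart_inv c x) (chart_inv c a) \<le> ennreal (C * dist x y) \<and>
       geodesic_dist M (chart_inv c a) (chart_inv c b) \<le> ennreal (C * dist x y) \<and>
       geodesic_dist M (chart_inv c b) (chart_inv c y) \<le> ennreal (C * dist x y)"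
proof -
  obtain R m K where R: "R > 0" "K > 0"
    "\<And>x v. x \<in> patch c \<Longrightarrow> dist (coord c p) x < R \<Longrightarrow> riem M c (chart_inv c x) v v \<le> K * (norm v)\<^sup>2"
    using metric_bounds[OF c p] by metis
  have x0: "coord c p \<in> patch c" using p by simp
  obtain r C where r: "r > 0" "C \<ge> 0" "\<And>x y. x \<in> patch c \<inter> ball (coord c p) r \<Longrightarrow> y \<in> patch c \<inter> ball (coord c p) r \<Longrightarrow>
     \<exists>a b. closed_segment x a \<union> closed_segment a b \<union> closed_segment b y \<subseteq> patch c \<inter> ball (coord c p) R \<and>
       dist x a + dist a b + dist b y \<le> C * dist x y"
    using lipschitz_patch_quasiconvex[OF chart(2)[OF c] x0 R(1)] by metis
  show thesis
  proof (rule that[of r "sqrt K * C"])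
    show "r > 0" "sqrt K * C \<ge> 0" using r R by auto
    fix x y assume "x \<in> patch c \<inter> ball (coord c p) r" "y \<in> patch c \<inter> ball (coord c p) r"
    then obtain a b where ab: "closed_segment x a \<union> closed_segment a b \<union> closed_segment b y \<subseteq> patch c \<inter> ball (coord c p) R"
       "dist x a + dist a b + dist b y \<le> C * dist x y" using r(3) by blast
    have step: "geodesic_dist M (chart_inv c u) (chart_inv c v) \<le> ennreal (sqrt K * C * dist x y)"
      if "closed_segment u v \<subseteq> patch c \<inter> ball (coord c p) R" "dist u v \<le> C * dist x y" for u v
    proof -
      have "geodesic_dist M (chart_inv c u) (chart_inv c v) \<le> ennreal (sqrt K * dist u v)"
        by (rule geodesic_dist_segment_le[OF c]) (use that(1) R in \<open>auto simp: subset_eq\<close>)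
      also have "\<dots> \<le> ennreal (sqrt K * C * dist x y)"
        using that(2) R(2) by (intro ennreal_leI) (simp add: mult.assoc)
      finally show ?thesis .
    qed
    have d: "dist x a \<le> C * dist x y" "dist a b \<le> C * dist x y" "dist b y \<le> C * dist x y"
      using ab(2) zero_le_dist[of x a] zero_le_dist[of a b] zero_le_dist[of b y] by linarith+
    have s: "closed_segment x a \<subseteq> patch c \<inter> ball (coord c p) R" "closed_segment a b \<subseteq> patch c \<inter> ball (coord c p) R"
      "closed_segment b y \<subseteq> patch c \<inter> ball (coord c p) R" using ab(1) by auto
    have "a \<in> patch c" "b \<in> patch c" using s(2) by auto
    then show "\<exists>a\<in>patch c. \<exists>b\<in>patch c.
       geodesic_dist M (chart_inv c x) (chart_inv c a) \<le> ennreal (sqrt K * C * dist x y) \<and>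
       geodesic_dist M (chart_inv c a) (chart_inv c b) \<le> ennreal (sqrt K * C * dist x y) \<and>
       geodesic_dist M (chart_inv c b) (chart_inv c y) \<le> ennreal (sqrt K * C * dist x y)"
      using step[OF s(1) d(1)] step[OF s(2) d(2)] step[OF s(3) d(3)] by blast
  qed
qed

subsection \<open>Lower bounds for the length of curves\<close>

text \<open>The coordinate velocity integrates to the displacement, and the norm of an integral is
  at most the integral of the norm. The curve is watched only up to time \<open>s\<close>, the
  moment at which it may be about to leave the chart; what follows adds nonnegative length.\<close>

lemma curve_length_ge:
  assumes pC1: "piecewise_C1_curve M \<gamma>" and d: "d \<in> atlas M" and s: "0 \<le> s" "s \<le> 1" and m: "m > 0"
    and dom: "\<And>t. t \<in> {0..s} \<Longrightarrow> \<gamma> t \<in> dom_of d"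
    and low: "\<And>t v. t \<in> {0..s} \<Longrightarrow> m * (norm v)\<^sup>2 \<le> riem M d (\<gamma> t) v v"
  shows "ennreal (sqrt m * dist (coord d (\<gamma> 0)) (coord d (\<gamma> s))) \<le> curve_length M \<gamma>"
proof -
  let ?x = "coord d \<circ> \<gamma>"
  have cont: "continuous_map (top_of_set {0..1}) X \<gamma>" using pC1 by (simp add: piecewise_C1_curve_def)
  have "?x piecewise_C1_differentiable_on {0..s}"
    using pC1 d s dom unfolding piecewise_C1_curve_def by (auto simp: image_subset_iff)
  then obtain S where S: "finite S" "continuous_on {0..s} ?x" "?x C1_differentiable_on ({0..s} - S)"
    unfolding piecewise_C1_differentiable_on_def by blast
  define v where "v t = vector_derivative ?x (at t)" for t
  have v: "(?x has_vector_derivative v t) (at t)" if "t \<in> {0..s} - S" for t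
    using S(3) that unfolding C1_differentiable_on_eq v_def by (simp add: vector_derivative_works)
  have vc: "continuous_on ({0..s} - S) v" using S(3) unfolding C1_differentiable_on_eq v_def by blast
  have SB: "{0..s} - S \<in> sets borel" using S(1) by (intro sets.Diff) (auto simp: finite_imp_closed)
  define u where "u t = indicator ({0..s} - S) t *\<^sub>R v t" for t
  have um[measurable]: "u \<in> borel_measurable borel"
    unfolding u_def by (rule borel_measurable_continuous_on_indicator[OF SB vc])
  have le: "ennreal (sqrt m) * (\<integral>\<^sup>+t. ennreal (norm (u t)) \<partial>lborel) \<le> curve_length M \<gamma>"
  proof -
    have "ennreal (sqrt m) * (\<integral>\<^sup>+t. ennreal (norm (u t)) \<partial>lborel) = (\<integral>\<^sup>+t. ennreal (sqrt m) * ennreal (norm (u t)) \<partial>lborel)"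
      by (rule nn_integral_cmult[symmetric]) measurable
    also have "\<dots> \<le> curve_length M \<gamma>"
      unfolding curve_length_def
    proof (rule nn_integral_mono_AE)
      have "AE t in lborel. t \<noteq> (0::real)" "AE t in lborel. t \<noteq> (1::real)" by (rule AE_lborel_singleton)+
      then show "AE t in lborel. ennreal (sqrt m) * ennreal (norm (u t)) \<le> ennreal (speed M \<gamma> t) * indicator {0..1} t"
      proof eventually_elim
        case (elim t)
        show ?case
        proof (cases "t \<in> {0..s} - S")
          case True
          then have t: "t \<in> {0<..<1}" "t \<in> {0..s}" using elim s by auto
          have "speed M \<gamma> t = sqrt (riem M d (\<gamma> t) (v t) (v t))"
            by (rule speed_eq[OF cont t(1) d dom[OF t(2)] v[OF True]])
          moreover have "sqrt (m * (norm (v t))\<^sup>2) \<le> sqrt (riem M d (\<gamma> t) (v t) (v t))"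
            by (rule real_sqrt_le_mono[OF low[OF t(2)]])
          ultimately have "sqrt m * norm (u t) \<le> speed M \<gamma> t" using True by (simp add: u_def real_sqrt_mult)
          then have "ennreal (sqrt m * norm (u t)) \<le> ennreal (speed M \<gamma> t)" by (rule ennreal_leI)
          then show ?thesis using t by (simp add: ennreal_mult' m less_imp_le ennreal_mult)
        next
          case False
          then have "u t = 0" by (simp add: u_def)
          then show ?thesis by simp
        qed
      qed
    qed
    finally show ?thesis .
  qed
  have "ennreal (dist (?x 0) (?x s)) \<le> (\<integral>\<^sup>+t. ennreal (norm (u t)) \<partial>lborel)"
  \<comment> \<open>Curves of infinite coordinate length satisfy the bound trivially; otherwise
    \<open>u\<close> is integrable and the fundamental theorem applies.\<close>
  proof (cases "(\<integral>\<^sup>+t. ennreal (norm (u t)) \<partial>lborel) = \<infinity>")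
    case False
    then have int: "integrable lborel u" by (intro integrableI_bounded) (auto simp: top.not_eq_extremum)
    have "(u has_integral (\<integral>t. u t \<partial>lborel)) UNIV" by (rule has_integral_integral_lborel[OF int])
    moreover have "(v has_integral (?x s - ?x 0)) {0..s}"
      by (rule fundamental_theorem_of_calculus_interior_strong[OF S(1) s(1) _ S(2)]) (use v in auto)
    then have "((\<lambda>t. if t \<in> {0..s} then v t else 0) has_integral (?x s - ?x 0)) UNIV"
      by (simp only: has_integral_restrict_UNIV)
    then have "(u has_integral (?x s - ?x 0)) UNIV"
      by (rule has_integral_spike[OF negligible_finite[OF S(1)], rotated]) (auto simp: u_def indicator_def)
    ultimately have "(\<integral>t. u t \<partial>lborel) = ?x s - ?x 0" by (rule has_integral_unique)
    moreover have "ennreal (norm (\<integral>t. u t \<partial>lborel)) \<le> (\<integral>\<^sup>+t. ennreal (norm (u t)) \<partial>lborel)"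
      by (rule integral_norm_bound_ennreal[OF int])
    ultimately show ?thesis by (simp add: dist_norm norm_minus_commute)
  qed simp
  then have "ennreal (sqrt m) * ennreal (dist (?x 0) (?x s)) \<le> ennreal (sqrt m) * (\<integral>\<^sup>+t. ennreal (norm (u t)) \<partial>lborel)"
    by (intro mult_left_mono) auto
  then have "ennreal (sqrt m) * ennreal (dist (?x 0) (?x s)) \<le> curve_length M \<gamma>" using le by (rule order_trans)
  then show ?thesis by (simp add: ennreal_mult' m less_imp_le)
qed

text \<open>A curve that starts close to \<^term>\<open>q0\<close> either stays in a coordinate ball or first reaches the
  sphere bounding it.\<close>

lemma geodesic_dist_ge:
  assumes d: "d \<in> atlas M" and q0: "q0 \<in> dom_of d"
  obtains \<rho> m where "\<rho> > 0" "m > 0"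
    "\<And>q1 q2 t. q1 \<in> dom_of d \<Longrightarrow> dist (coord d q0) (coord d q1) < \<rho> \<Longrightarrow> 0 \<le> t \<Longrightarrow> t < m * \<rho> \<Longrightarrow>
       geodesic_dist M q1 q2 \<le> ennreal t \<Longrightarrow> q2 \<in> dom_of d \<and> m * dist (coord d q1) (coord d q2) \<le> t"
proof -
  let ?x = "coord d q0"
  have x0: "?x \<in> patch d" using q0 by simp
  obtain R m where R: "R > 0" "m > 0"
    and low: "\<And>x v. x \<in> patch d \<Longrightarrow> dist ?x x < R \<Longrightarrow> m * (norm v)\<^sup>2 \<le> riem M d (chart_inv d x) v v"
    using metric_bounds[OF d q0] by metis
  obtain r1 where r1: "r1 > 0" "\<And>e. e \<le> r1 \<Longrightarrow> compact (patch d \<inter> cball ?x e)"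
    using lipschitz_patch_locally_compact[OF chart(2)[OF d] x0] by metis
  define \<rho> where "\<rho> = min R r1 / 4"
  have \<rho>: "\<rho> > 0" "2 * \<rho> < R" "2 * \<rho> \<le> r1" using R r1 by (auto simp: \<rho>_def)
  define B where "B = {q\<in>dom_of d. coord d q \<in> ball ?x (2 * \<rho>)}"
  define K where "K = chart_inv d ` (patch d \<inter> cball ?x (2 * \<rho>))"
  have Bop: "openin X B" unfolding B_def by (rule openin_coord_preimage[OF d]) simp
  have Kd: "q \<in> dom_of d \<and> coord d q \<in> cball ?x (2 * \<rho>)" if "q \<in> K" for q
    using that chart_inv_in_dom[of _ d] by (auto simp: K_def)
  have BK: "B \<subseteq> K"
  proof
    fix q assume "q \<in> B"
    then have "q = chart_inv d (coord d q)" "coord d q \<in> patch d \<inter> cball ?x (2 * \<rho>)" using d by (auto simp: B_def)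
    then show "q \<in> K" unfolding K_def by (rule image_eqI)
  qed
  have "compactin (top_of_set (patch d)) (patch d \<inter> cball ?x (2 * \<rho>))"
    using r1(2)[OF \<rho>(3)] by (simp add: compactin_subtopology)
  then have "compactin X K" unfolding K_def using image_compactin continuous_chart_inv[OF d] by blast
  moreover have "Hausdorff_space X" using surface unfolding oriented_riemannian_surface_def by blast
  \<comment> \<open>Closedness in the surface, not only in the patch, is essential: it prevents a
    curve from leaving the domain of the chart without first reaching the coordinate sphere of
    radius 2 \<rho>.\<close>
  ultimately have Kcl: "closedin X K" by (rule compactin_imp_closedin[rotated])
  have lowK: "m * (norm v)\<^sup>2 \<le> riem M d q v v" if "q \<in> K" for q v
    using low[of "coord d q" v] Kd[OF that] d \<rho> by simp
  have main: "(if q2 \<in> B then ennreal (min (sqrt m * \<rho>) (sqrt m * dist (coord d q1) (coord d q2))) else ennreal (sqrt m * \<rho>))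
     \<le> curve_length M \<gamma>"
    if q1: "q1 \<in> dom_of d" "dist ?x (coord d q1) < \<rho>" and pC1: "piecewise_C1_curve M \<gamma>" and \<gamma>: "\<gamma> 0 = q1" "\<gamma> 1 = q2" for q1 q2 \<gamma>
  proof (cases "\<forall>t\<in>{0..1}. \<gamma> t \<in> B")
    case True
    then have q2: "q2 \<in> B" using \<gamma> by (metis atLeastAtMost_iff order_refl zero_le_one)
    have "ennreal (sqrt m * dist (coord d (\<gamma> 0)) (coord d (\<gamma> 1))) \<le> curve_length M \<gamma>"
    proof (rule curve_length_ge[OF pC1 d _ _ R(2)])
      fix t :: real assume "t \<in> {0..1}"
      then have "\<gamma> t \<in> K" using True BK by blast
      then show "\<gamma> t \<in> dom_of d" "\<And>v. m * (norm v)\<^sup>2 \<le> riem M d (\<gamma> t) v v" using Kd lowK by auto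
    qed auto
    moreover have "ennreal (min (sqrt m * \<rho>) (sqrt m * dist (coord d q1) (coord d q2))) \<le> ennreal (sqrt m * dist (coord d (\<gamma> 0)) (coord d (\<gamma> 1)))"
      unfolding \<gamma> by (rule ennreal_leI) simp
    ultimately show ?thesis using q2 by simp
  next
    case False
    have cont: "continuous_map (top_of_set {0..1}) X \<gamma>" using pC1 by (simp add: piecewise_C1_curve_def)
    have cl: "closed {t\<in>{0..1}. \<gamma> t \<in> C}" if "closedin X C" for C
    proof -
      have "closedin (top_of_set {0..1}) {t\<in>topspace (top_of_set {0..1}). \<gamma> t \<in> C}"
        by (rule closedin_continuous_map_preimage[OF cont that])
      then show ?thesis using closedin_closed_trans[of "{0..1::real}"] by simp
    qed
    define A where "A = {t\<in>{0..1}. \<gamma> t \<in> points M - B}"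
    have A: "closed A" unfolding A_def by (rule cl) (use Bop in auto)
    have "A \<noteq> {}" using False continuous_map_image_subset_topspace[OF cont] by (fastforce simp: A_def)
    moreover have Ab: "bdd_below A" by (rule bdd_belowI[of _ 0]) (auto simp: A_def)
    ultimately have "Inf A \<in> A" using A by (intro closed_contains_Inf)
    \<comment> \<open>The first exit time from \<open>B\<close>. Up to and including it the curve
      lies in the closed set \<open>K\<close>, so the chart can still measure it.\<close>
    define s where "s = Inf A"
    have sA: "s \<in> A" unfolding s_def by fact
    have s01: "0 \<le> s" "s \<le> 1" "\<gamma> s \<notin> B" using sA by (auto simp: A_def)
    have q1B: "q1 \<in> B" using q1 \<rho> by (auto simp: B_def)
    then have s0: "0 < s" using s01 \<gamma> by (cases "s = 0") auto
    have before: "\<gamma> t \<in> B" if "0 \<le> t" "t < s" for t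
    proof (rule ccontr)
      assume "\<gamma> t \<notin> B"
      then have "t \<in> A" using that s01 continuous_map_image_subset_topspace[OF cont] by (auto simp: A_def)
      then have "s \<le> t" unfolding s_def by (rule cInf_lower[OF _ Ab])
      then show False using that by simp
    qed
    have "{0..<s} \<subseteq> {t\<in>{0..1}. \<gamma> t \<in> K}" using before BK s01 by auto
    then have "closure {0..<s} \<subseteq> {t\<in>{0..1}. \<gamma> t \<in> K}" by (rule closure_minimal) (rule cl[OF Kcl])
    then have inK: "\<gamma> t \<in> K" if "t \<in> {0..s}" for t using that s0 by (auto simp: closure_atLeastLessThan)
    have "ennreal (sqrt m * dist (coord d (\<gamma> 0)) (coord d (\<gamma> s))) \<le> curve_length M \<gamma>"
      by (rule curve_length_ge[OF pC1 d s01(1,2) R(2)]) (use inK Kd lowK in auto)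
    moreover have "\<rho> \<le> dist (coord d (\<gamma> 0)) (coord d (\<gamma> s))"
    proof -
      \<comment> \<open>At the exit the point is in the domain but outside the open coordinate ball
        of radius 2 \<rho>, while the start is within \<rho> of the centre.\<close>
      have "2 * \<rho> \<le> dist ?x (coord d (\<gamma> s))"
        using inK[of s] s0 Kd[of "\<gamma> s"] s01(3) by (auto simp: B_def not_less)
      then show ?thesis using q1(2) dist_triangle[of ?x "coord d (\<gamma> s)" "coord d q1"] \<gamma>(1) by simp
    qed
    then have "sqrt m * \<rho> \<le> sqrt m * dist (coord d (\<gamma> 0)) (coord d (\<gamma> s))" using R(2) by (intro mult_left_mono) auto
    ultimately have le1: "ennreal (sqrt m * \<rho>) \<le> curve_length M \<gamma>" using ennreal_leI order_trans by blast
    have le2: "ennreal (min (sqrt m * \<rho>) (sqrt m * dist (coord d q1) (coord d q2))) \<le> ennreal (sqrt m * \<rho>)"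
      by (rule ennreal_leI) simp
    show ?thesis using le1 order_trans[OF le2 le1] by simp
  qed
  show thesis
  proof (rule that[of \<rho> "sqrt m"])
    show "\<rho> > 0" "sqrt m > 0" using \<rho> R by auto
    fix q1 q2 t assume q1: "q1 \<in> dom_of d" "dist ?x (coord d q1) < \<rho>" and t: "0 \<le> t" "t < sqrt m * \<rho>"
      and le: "geodesic_dist M q1 q2 \<le> ennreal t"
    have "(if q2 \<in> B then ennreal (min (sqrt m * \<rho>) (sqrt m * dist (coord d q1) (coord d q2))) else ennreal (sqrt m * \<rho>))
       \<le> geodesic_dist M q1 q2"
      unfolding geodesic_dist_def by (rule INF_greatest) (use main[OF q1] in blast)
    then have *: "(if q2 \<in> B then ennreal (min (sqrt m * \<rho>) (sqrt m * dist (coord d q1) (coord d q2))) else ennreal (sqrt m * \<rho>)) \<le> ennreal t"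
      using le by (rule order_trans)
    have "q2 \<in> B"
    proof (rule ccontr)
      assume "q2 \<notin> B"
      then have "ennreal (sqrt m * \<rho>) \<le> ennreal t" using * by simp
      then have "sqrt m * \<rho> \<le> t" using t by (simp add: ennreal_le_iff)
      then show False using t by simp
    qed
    then have "ennreal (min (sqrt m * \<rho>) (sqrt m * dist (coord d q1) (coord d q2))) \<le> ennreal t" using * by simp
    then have "min (sqrt m * \<rho>) (sqrt m * dist (coord d q1) (coord d q2)) \<le> t" using t by (simp add: ennreal_le_iff)
    then show "q2 \<in> dom_of d \<and> sqrt m * dist (coord d q1) (coord d q2) \<le> t"
      using \<open>q2 \<in> B\<close> t by (auto simp: B_def min_le_iff_disj)
  qed
qed

end

section \<open>Lipschitz maps between surfaces\<close>

locale surface_map = M: compact_surface M + N: compact_surface N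
  for M :: "'a surface" and N :: "'b surface" +
  fixes \<phi> :: "'a \<Rightarrow> 'b"
  assumes lip: "lipschitz_map M N \<phi>"
begin

lemma \<phi>_points: "p \<in> points M \<Longrightarrow> \<phi> p \<in> points N"
  using lip unfolding lipschitz_map_def by blast

definition loc :: "'a chart \<Rightarrow> 'b chart \<Rightarrow> real^2 \<Rightarrow> real^2" where
  "loc c d = coord d \<circ> \<phi> \<circ> chart_inv c"

text \<open>Two nearby points are joined through the corners \<open>a\<close> and \<open>b\<close>
  of a broken line. For each of the three legs the geodesic distance of the images is small, and by
  \<open>geodesic_dist_ge\<close> the image of the far end lies in the chart again, at controlled
  coordinate distance.\<close>

lemma locally_lipschitz_in_charts:
  assumes c: "c \<in> atlas M" "p \<in> dom_of c" and d: "d \<in> atlas N" "\<phi> p \<in> dom_of d"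
  obtains r L where "r > 0" "L-lipschitz_on (M.patch c \<inter> ball (coord c p) r) (loc c d)"
    "\<And>x. x \<in> M.patch c \<inter> ball (coord c p) r \<Longrightarrow> \<phi> (chart_inv c x) \<in> dom_of d"
proof -
  obtain \<Lambda> where \<Lambda>: "\<Lambda> \<ge> 0" "\<And>p q. p \<in> points M \<Longrightarrow> q \<in> points M \<Longrightarrow>
        geodesic_dist N (\<phi> p) (\<phi> q) \<le> ennreal \<Lambda> * geodesic_dist M p q"
    using lip unfolding lipschitz_map_def by blast
  let ?x0 = "coord c p" and ?y0 = "coord d (\<phi> p)"
  obtain r0 C where r0: "r0 > 0" "C \<ge> 0"
    "\<And>x y. x \<in> M.patch c \<inter> ball ?x0 r0 \<Longrightarrow> y \<in> M.patch c \<inter> ball ?x0 r0 \<Longrightarrow> \<exists>a\<in>M.patch c. \<exists>b\<in>M.patch c.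
       geodesic_dist M (chart_inv c x) (chart_inv c a) \<le> ennreal (C * dist x y) \<and>
       geodesic_dist M (chart_inv c a) (chart_inv c b) \<le> ennreal (C * dist x y) \<and>
       geodesic_dist M (chart_inv c b) (chart_inv c y) \<le> ennreal (C * dist x y)"
    by (rule M.geodesic_dist_three_segments[OF c]) blast
  obtain \<rho> m where \<rho>: "\<rho> > 0" "m > 0"
    "\<And>q1 q2 t. q1 \<in> dom_of d \<Longrightarrow> dist ?y0 (coord d q1) < \<rho> \<Longrightarrow> 0 \<le> t \<Longrightarrow> t < m * \<rho> \<Longrightarrow>
       geodesic_dist N q1 q2 \<le> ennreal t \<Longrightarrow> q2 \<in> dom_of d \<and> m * dist (coord d q1) (coord d q2) \<le> t"
    by (rule N.geodesic_dist_ge[OF d]) blast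
  define A where "A = \<Lambda> * C"
  have A: "A \<ge> 0" using \<Lambda> r0 by (simp add: A_def)
  have ci: "chart_inv c x \<in> points M" if "x \<in> M.patch c" for x
    using M.chart_inv_in_dom[OF that] M.dom_subset[OF c(1)] by blast
  have image: "geodesic_dist N (\<phi> (chart_inv c u)) (\<phi> (chart_inv c v)) \<le> ennreal (A * s)"
    if "u \<in> M.patch c" "v \<in> M.patch c" "geodesic_dist M (chart_inv c u) (chart_inv c v) \<le> ennreal (C * s)" for u v s
  proof -
    have "geodesic_dist N (\<phi> (chart_inv c u)) (\<phi> (chart_inv c v)) \<le> ennreal \<Lambda> * geodesic_dist M (chart_inv c u) (chart_inv c v)"
      by (rule \<Lambda>(2)[OF ci ci]) (use that in auto)
    also have "\<dots> \<le> ennreal \<Lambda> * ennreal (C * s)" using that(3) by (rule mult_left_mono) simp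
    also have "\<dots> = ennreal (A * s)" using \<Lambda>(1) by (simp add: A_def ennreal_mult' mult.assoc)
    finally show ?thesis .
  qed
  have step: "\<phi> (chart_inv c v) \<in> dom_of d \<and> dist (loc c d u) (loc c d v) \<le> t / m"
    if "u \<in> M.patch c" "v \<in> M.patch c" "\<phi> (chart_inv c u) \<in> dom_of d" "dist ?y0 (loc c d u) < \<rho>" "0 \<le> t" "t < m * \<rho>"
      "geodesic_dist N (\<phi> (chart_inv c u)) (\<phi> (chart_inv c v)) \<le> ennreal t" for u v t
    using \<rho>(3)[OF that(3) _ that(5,6,7)] that(4) \<rho>(2) by (simp add: loc_def pos_le_divide_eq mult.commute)
  \<comment> \<open>The smallness hypothesis leaves room for three legs: the images of
    \<open>x\<close>, \<open>a\<close> and \<open>b\<close> stay within \<rho> of the centre, where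
    \<open>step\<close> can be applied next.\<close>
  have chain: "\<phi> (chart_inv c y) \<in> dom_of d \<and> dist (loc c d x) (loc c d y) \<le> 3 * (A * dist x y / m)"
    if x: "x \<in> M.patch c \<inter> ball ?x0 r0" and y: "y \<in> M.patch c \<inter> ball ?x0 r0"
      and x': "\<phi> (chart_inv c x) \<in> dom_of d" and small: "dist ?y0 (loc c d x) + 3 * (A * dist x y / m) < \<rho>" for x y
  proof -
    let ?t = "A * dist x y"
    obtain a b where ab: "a \<in> M.patch c" "b \<in> M.patch c"
       "geodesic_dist M (chart_inv c x) (chart_inv c a) \<le> ennreal (C * dist x y)"
       "geodesic_dist M (chart_inv c a) (chart_inv c b) \<le> ennreal (C * dist x y)"
       "geodesic_dist M (chart_inv c b) (chart_inv c y) \<le> ennreal (C * dist x y)"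
      using r0(3)[OF x y] by blast
    have t0: "0 \<le> ?t" "0 \<le> ?t / m" using A \<rho>(2) by simp_all
    have "?t / m < \<rho>" using small t0 zero_le_dist[of ?y0 "loc c d x"] by linarith
    then have t1: "?t < m * \<rho>" using \<rho>(2) by (simp add: pos_divide_less_eq mult.commute)
    have 1: "\<phi> (chart_inv c a) \<in> dom_of d \<and> dist (loc c d x) (loc c d a) \<le> ?t / m"
      by (rule step) (use x x' ab small t0 t1 image in auto)
    have 2: "\<phi> (chart_inv c b) \<in> dom_of d \<and> dist (loc c d a) (loc c d b) \<le> ?t / m"
    proof (rule step)
      show "dist ?y0 (loc c d a) < \<rho>" using dist_triangle[of ?y0 "loc c d a" "loc c d x"] 1 small t0 by linarith
    qed (use 1 ab t0 t1 image in auto)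
    have 3: "\<phi> (chart_inv c y) \<in> dom_of d \<and> dist (loc c d b) (loc c d y) \<le> ?t / m"
    proof (rule step)
      show "dist ?y0 (loc c d b) < \<rho>"
        using dist_triangle[of ?y0 "loc c d a" "loc c d x"] dist_triangle[of ?y0 "loc c d b" "loc c d a"] 1 2 small t0 by linarith
    qed (use 2 ab y t0 t1 image in auto)
    show ?thesis
      using 1 2 3 dist_triangle[of "loc c d x" "loc c d y" "loc c d a"] dist_triangle[of "loc c d a" "loc c d y" "loc c d b"] by linarith
  qed
  \<comment> \<open>Two points of the ball are at most 2 r apart, so each leg costs at most \<rho> /
    10. Reaching a point from the centre takes three legs and passing to a second point three more,
    in total below \<rho>. The summand 1 covers A = 0.\<close>
  define r where "r = min r0 (m * \<rho> / (20 * (A + 1)))"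
  have r: "r > 0" "r \<le> r0" using r0 \<rho> A by (simp_all add: r_def)
  have Ar: "A * r / m \<le> \<rho> / 20"
  proof -
    have "A * r \<le> (A + 1) * (m * \<rho> / (20 * (A + 1)))" using A r by (intro mult_mono) (auto simp: r_def)
    also have "\<dots> = m * \<rho> / 20" using A by (simp add: field_simps)
    finally show ?thesis using \<rho>(2) by (simp add: field_simps)
  qed
  have small: "A * dist x y / m \<le> \<rho> / 10" if "dist x y \<le> 2 * r" for x y :: "real^2"
  proof -
    have "A * dist x y \<le> A * (2 * r)" using that A by (intro mult_left_mono)
    then have "A * dist x y / m \<le> A * (2 * r) / m" using \<rho>(2) by (intro divide_right_mono) auto
    moreover have "A * (2 * r) / m = 2 * (A * r / m)" by simp
    ultimately show ?thesis using Ar by linarith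
  qed
  have x0: "?x0 \<in> M.patch c \<inter> ball ?x0 r0" using c r0 by simp
  have y0: "loc c d ?x0 = ?y0" using c by (simp add: loc_def)
  have near: "\<phi> (chart_inv c x) \<in> dom_of d \<and> dist ?y0 (loc c d x) \<le> 3 * \<rho> / 10" if x: "x \<in> M.patch c \<inter> ball ?x0 r" for x
  proof -
    have s: "A * dist ?x0 x / m \<le> \<rho> / 10" using x r by (intro small) auto
    then have "\<phi> (chart_inv c x) \<in> dom_of d \<and> dist (loc c d ?x0) (loc c d x) \<le> 3 * (A * dist ?x0 x / m)"
      using \<rho>(1) x r d c by (intro chain x0) (auto simp: y0)
    then show ?thesis using s y0 by auto
  qed
  show thesis
  proof (rule that[of r "3 * A / m"])
    show "r > 0" by fact
    show "(3 * A / m)-lipschitz_on (M.patch c \<inter> ball ?x0 r) (loc c d)"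
    proof (rule lipschitz_onI)
      fix x y assume x: "x \<in> M.patch c \<inter> ball ?x0 r" and y: "y \<in> M.patch c \<inter> ball ?x0 r"
      have "dist x y \<le> dist ?x0 x + dist ?x0 y" by (metis dist_commute dist_triangle)
      then have "dist x y \<le> 2 * r" using x y by auto
      from small[OF this] have "dist ?y0 (loc c d x) + 3 * (A * dist x y / m) < \<rho>"
        using near[OF x] \<rho>(1) by linarith
      then have "dist (loc c d x) (loc c d y) \<le> 3 * (A * dist x y / m)"
        using chain[of x y] near[OF x] x y r by auto
      then show "dist (loc c d x) (loc c d y) \<le> 3 * A / m * dist x y" by simp
    qed (use A \<rho> in auto)
  qed (use near in blast)
qed

text \<open>Continuity for the surface topologies, about which \<open>lipschitz_map\<close> is
  silent; it follows from the Lipschitz estimate in charts.\<close>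

lemma \<phi>_openin_preimage:
  assumes V: "openin (surface_top N) V"
  shows "openin (surface_top M) {p\<in>points M. \<phi> p \<in> V}"
proof (subst openin_subopen, rule ballI)
  fix p assume "p \<in> {p\<in>points M. \<phi> p \<in> V}"
  then have p: "p \<in> points M" "\<phi> p \<in> V" by auto
  note c = M.chart_at[OF p(1)] and d = N.chart_at[OF \<phi>_points[OF p(1)]]
  let ?c = "chart_at M p" and ?d = "chart_at N (\<phi> p)"
  obtain r L where r: "r > 0" "L-lipschitz_on (M.patch ?c \<inter> ball (coord ?c p) r) (loc ?c ?d)"
    "\<And>x. x \<in> M.patch ?c \<inter> ball (coord ?c p) r \<Longrightarrow> \<phi> (chart_inv ?c x) \<in> dom_of ?d"
    using locally_lipschitz_in_charts[OF c d] by blast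
  obtain W where W: "open W" "\<And>q. q \<in> dom_of ?d \<Longrightarrow> coord ?d q \<in> W \<longleftrightarrow> q \<in> V"
    using N.openin_coord_image[OF d(1) V] by blast
  have "continuous_on (M.patch ?c \<inter> ball (coord ?c p) r) (loc ?c ?d)" by (rule lipschitz_on_continuous_on[OF r(2)])
  then obtain O' where O': "open O'" "O' \<inter> (M.patch ?c \<inter> ball (coord ?c p) r) = loc ?c ?d -` W \<inter> (M.patch ?c \<inter> ball (coord ?c p) r)"
    using W(1) unfolding continuous_on_open_invariant by blast
  define T where "T = {q\<in>dom_of ?c. coord ?c q \<in> O' \<inter> ball (coord ?c p) r}"
  have "openin (surface_top M) T" unfolding T_def using O'(1) by (intro M.openin_coord_preimage c) auto
  moreover have "T \<subseteq> {p\<in>points M. \<phi> p \<in> V}"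
  proof
    fix q assume q: "q \<in> T"
    then have qd: "q \<in> dom_of ?c" "coord ?c q \<in> O' \<inter> (M.patch ?c \<inter> ball (coord ?c p) r)" by (auto simp: T_def)
    then have "loc ?c ?d (coord ?c q) \<in> W" unfolding O'(2) by simp
    then have "coord ?d (\<phi> q) \<in> W" using qd(1) c(1) by (simp add: loc_def)
    moreover have "\<phi> q \<in> dom_of ?d" using r(3)[of "coord ?c q"] qd c(1) by auto
    ultimately show "q \<in> {p\<in>points M. \<phi> p \<in> V}" using W(2) qd(1) M.dom_subset[OF c(1)] by auto
  qed
  moreover have "p \<in> T"
  proof -
    have "coord ?d (\<phi> p) \<in> W" using W(2)[OF d(2)] p by simp
    then have "coord ?c p \<in> loc ?c ?d -` W \<inter> (M.patch ?c \<inter> ball (coord ?c p) r)" using c r(1) by (simp add: loc_def)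
    then have "coord ?c p \<in> O'" unfolding O'(2)[symmetric] by simp
    then show ?thesis using c r(1) by (simp add: T_def)
  qed
  ultimately show "\<exists>T. openin (surface_top M) T \<and> p \<in> T \<and> T \<subseteq> {p\<in>points M. \<phi> p \<in> V}" by blast
qed

lemma \<phi>_measurable: "\<phi> \<in> measurable M.borel_sets N.borel_sets"
  unfolding N.borel_sets_def
proof (rule measurable_measure_of)
  show "{U. openin N.X U} \<subseteq> Pow (points N)" using openin_subset by auto
  show "\<phi> \<in> space M.borel_sets \<rightarrow> points N" using \<phi>_points by simp
  fix V assume "V \<in> {U. openin N.X U}"
  then have "{p\<in>points M. \<phi> p \<in> V} \<in> sets M.borel_sets" using \<phi>_openin_preimage M.openin_borel by blast
  moreover have "\<phi> -` V \<inter> space M.borel_sets = {p\<in>points M. \<phi> p \<in> V}" by auto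
  ultimately show "\<phi> -` V \<inter> space M.borel_sets \<in> sets M.borel_sets" by simp
qed

end

subsection \<open>Lebesgue measurable sets and functions in charts\<close>

lemma borel_measurable_completion_AE:
  assumes f: "f \<in> borel_measurable (completion A)" and ae: "AE x in completion A. f x = g x"
  shows "g \<in> borel_measurable (completion A)"
proof (rule measurableI)
  fix B :: "'b set" assume "B \<in> sets borel"
  then have 1: "f -` B \<inter> space (completion A) \<in> sets (completion A)" by (rule measurable_sets[OF f])
  have 2: "AE x in completion A. x \<in> f -` B \<inter> space (completion A) \<longleftrightarrow> x \<in> g -` B \<inter> space (completion A)"
    using ae by eventually_elim auto
  show "g -` B \<inter> space (completion A) \<in> sets (completion A)"
    by (rule completion.in_sets_AE[OF 2 1]) auto
qed auto

context compact_surface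
begin

lemma space_area_measure [simp]: "space (area_measure M) = points M"
  by (simp add: area_measure_def)

lemma borel_sets_area_measure: "E \<in> sets borel_sets \<Longrightarrow> E \<in> sets (area_measure M)"
  by (simp add: area_measure_def sets_borel_area_measure)

lemma borel_measurable_area_measure: "f \<in> measurable borel_sets A \<Longrightarrow> f \<in> measurable (area_measure M) A"
  unfolding area_measure_def
  by (rule measurable_completion) (simp add: measurable_cong_sets[OF sets_borel_area_measure refl])

lemma AE_chart:
  assumes c: "c \<in> atlas M" and T: "negligible T"
  shows "AE q in area_measure M. q \<in> dom_of c \<longrightarrow> coord c q \<notin> T"
proof -
  have "negligible (coord c ` {q\<in>dom_of c. coord c q \<in> T})" using T by (rule negligible_subset) auto
  then have "{q\<in>dom_of c. coord c q \<in> T} \<in> null_sets (area_measure M)"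
    by (subst null_area_iff_negligible[OF c]) auto
  from AE_not_in[OF this] show ?thesis by eventually_elim blast
qed

text \<open>Functions built from a derivative are merely Lebesgue measurable in the chart. They are
  replaced by a Borel representative, and \<open>AE_chart\<close> turns the exceptional null set of
  the plane into one of the surface.\<close>

lemma chart_function_borel_ae:
  fixes \<Psi> :: "real^2 \<Rightarrow> ennreal"
  assumes c: "c \<in> atlas M" and E: "E \<in> sets borel_sets" "E \<subseteq> dom_of c" and \<Psi>: "\<Psi> \<in> borel_measurable lebesgue"
  obtains \<Psi>' where "\<Psi>' \<in> borel_measurable borel" "AE x in lborel. \<Psi> x = \<Psi>' x"
    "(\<lambda>q. \<Psi>' (coord c q) * indicator E q) \<in> borel_measurable borel_sets"
    "AE q in area_measure M. \<Psi> (coord c q) * indicator E q = \<Psi>' (coord c q) * indicator E q"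
proof -
  obtain \<Psi>' where p: "\<Psi>' \<in> borel_measurable lborel" "AE x in lborel. \<Psi> x = \<Psi>' x"
    using completion_ex_borel_measurable[OF \<Psi>] by blast
  then obtain T where T: "T \<in> null_sets lborel" "\<And>x. x \<notin> T \<Longrightarrow> \<Psi> x = \<Psi>' x"
    unfolding eventually_ae_filter by auto
  show thesis
  proof (rule that[of \<Psi>'])
    show pb: "\<Psi>' \<in> borel_measurable borel" using p(1) by simp
    show "AE x in lborel. \<Psi> x = \<Psi>' x" by (rule p(2))
    have "(\<lambda>q. \<Psi>' (coord c q)) \<in> borel_measurable (restrict_space borel_sets (dom_of c))"
      by (rule measurable_compose[OF coord_measurable[OF c] pb])
    then have "(\<lambda>q. \<Psi>' (coord c q) * indicator (dom_of c) q) \<in> borel_measurable borel_sets"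
      using dom_borel[OF c] dom_subset[OF c] by (subst (asm) borel_measurable_restrict_space_iff_ennreal) (simp_all add: Int_absorb2)
    then have "(\<lambda>q. \<Psi>' (coord c q) * indicator (dom_of c) q * indicator E q) \<in> borel_measurable borel_sets"
      by (rule borel_measurable_times_ennreal[OF _ borel_measurable_indicator[OF E(1)]])
    moreover have "\<Psi>' (coord c q) * indicator (dom_of c) q * indicator E q = \<Psi>' (coord c q) * indicator E q" for q
      using E(2) by (auto simp: indicator_def)
    ultimately show "(\<lambda>q. \<Psi>' (coord c q) * indicator E q) \<in> borel_measurable borel_sets" by simp
    have "negligible T" using T(1) by (simp add: negligible_iff_null_sets null_sets_completionI)
    from AE_chart[OF c this] show "AE q in area_measure M. \<Psi> (coord c q) * indicator E q = \<Psi>' (coord c q) * indicator E q"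
    proof eventually_elim
      case (elim q)
      then show ?case using T(2)[of "coord c q"] E(2) by (cases "q \<in> E") auto
    qed
  qed
qed

lemma measurable_chart_function:
  fixes \<Psi> :: "real^2 \<Rightarrow> ennreal"
  assumes "c \<in> atlas M" "E \<in> sets borel_sets" "E \<subseteq> dom_of c" "\<Psi> \<in> borel_measurable lebesgue"
  shows "(\<lambda>q. \<Psi> (coord c q) * indicator E q) \<in> borel_measurable (area_measure M)"
proof -
  obtain \<Psi>' where p: "\<Psi>' \<in> borel_measurable borel" "AE x in lborel. \<Psi> x = \<Psi>' x"
    "(\<lambda>q. \<Psi>' (coord c q) * indicator E q) \<in> borel_measurable borel_sets"
    "AE q in area_measure M. \<Psi> (coord c q) * indicator E q = \<Psi>' (coord c q) * indicator E q"
    by (rule chart_function_borel_ae[OF assms])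
  have ae: "AE q in completion \<mu>. \<Psi>' (coord c q) * indicator E q = \<Psi> (coord c q) * indicator E q"
    using p(4) unfolding area_measure_def by eventually_elim (rule sym)
  have "(\<lambda>q. \<Psi>' (coord c q) * indicator E q) \<in> borel_measurable (completion \<mu>)"
    using borel_measurable_area_measure[OF p(3)] unfolding area_measure_def .
  from borel_measurable_completion_AE[OF this ae] show ?thesis unfolding area_measure_def .
qed

lemma nn_integral_chart_function:
  fixes \<Psi> :: "real^2 \<Rightarrow> ennreal"
  assumes c: "c \<in> atlas M" and E: "E \<in> sets borel_sets" "E \<subseteq> dom_of c" and \<Psi>: "\<Psi> \<in> borel_measurable lebesgue"
  shows "(\<integral>\<^sup>+q. \<Psi> (coord c q) * indicator E q \<partial>area_measure M) =
    (\<integral>\<^sup>+x. ennreal (density_in c x) * \<Psi> x * indicator (coord c ` E) x \<partial>lborel)"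
proof -
  obtain \<Psi>' where p: "\<Psi>' \<in> borel_measurable borel" "AE x in lborel. \<Psi> x = \<Psi>' x"
    "(\<lambda>q. \<Psi>' (coord c q) * indicator E q) \<in> borel_measurable borel_sets"
    "AE q in area_measure M. \<Psi> (coord c q) * indicator E q = \<Psi>' (coord c q) * indicator E q"
    by (rule chart_function_borel_ae[OF c E \<Psi>])
  have "(\<integral>\<^sup>+q. \<Psi> (coord c q) * indicator E q \<partial>area_measure M) = (\<integral>\<^sup>+q. \<Psi>' (coord c q) * indicator E q \<partial>area_measure M)"
    by (rule nn_integral_cong_AE[OF p(4)])
  also have "\<dots> = (\<integral>\<^sup>+q. (\<Psi>' (coord c q) * indicator E q) * indicator E q \<partial>\<mu>)"
    unfolding area_measure_def nn_integral_completion by (intro nn_integral_cong) (auto simp: indicator_def)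
  also have "\<dots> = (\<integral>\<^sup>+x. ennreal (density_in c x) * (\<Psi>' (coord c (chart_inv c x)) * indicator E (chart_inv c x)) * indicator (coord c ` E) x \<partial>lborel)"
    by (rule nn_integral_area_chart[OF c E p(3)])
  also have "\<dots> = (\<integral>\<^sup>+x. ennreal (density_in c x) * \<Psi> x * indicator (coord c ` E) x \<partial>lborel)"
  proof (rule nn_integral_cong_AE)
    show "AE x in lborel. ennreal (density_in c x) * (\<Psi>' (coord c (chart_inv c x)) * indicator E (chart_inv c x)) * indicator (coord c ` E) x
        = ennreal (density_in c x) * \<Psi> x * indicator (coord c ` E) x"
      using p(2)
    proof eventually_elim
      case (elim x)
      show ?case
      proof (cases "x \<in> coord c ` E")
        case True
        then have "x \<in> patch c" "chart_inv c x \<in> E" using coord_image_eq[OF c E(2)] by auto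
        then show ?thesis using elim by simp
      qed simp
    qed
  qed
  finally show ?thesis .
qed

text \<open>Images under a Lipschitz map are Lebesgue sets in a chart, not Borel sets in general.
  The set is split into a Borel part and a part of measure zero, which the completed area measure
  ignores.\<close>

lemma emeasure_chart_inv_image:
  assumes d: "d \<in> atlas M" and T: "T \<in> sets lebesgue" "T \<subseteq> patch d"
  shows "chart_inv d ` T \<in> sets (area_measure M)"
    and "emeasure (area_measure M) (chart_inv d ` T) = (\<integral>\<^sup>+y. ennreal (density_in d y) * indicator T y \<partial>lborel)"
proof -
  obtain T0 N N' where N: "T = T0 \<union> N" "N \<subseteq> N'" "N' \<in> null_sets lborel" "T0 \<in> sets lborel"
    using T(1) by (rule sets_completionE)
  define E where "E = {q\<in>dom_of d. coord d q \<in> T0}"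
  have E: "E \<in> sets borel_sets" "E \<subseteq> dom_of d" using coord_preimage_borel[OF d] N(4) by (auto simp: E_def)
  have im: "coord d ` E = T0" using N(1) T(2) by (auto simp: E_def image_iff)
  have E': "chart_inv d ` T0 = E" using chart_inv_image[OF d E(2)] im by simp
  have "negligible N"
    using N(2,3) by (meson negligible_iff_null_sets negligible_subset null_sets_completionI)
  moreover have "coord d ` chart_inv d ` N = N"
  proof -
    have "(coord d \<circ> chart_inv d) ` N = id ` N" by (rule image_cong) (use N(1) T(2) in auto)
    then show ?thesis by (simp add: image_comp)
  qed
  moreover have "chart_inv d ` N \<subseteq> dom_of d" using N(1) T(2) chart_inv_in_dom by blast
  ultimately have null: "chart_inv d ` N \<in> null_sets (area_measure M)" using null_area_iff_negligible[OF d] by simp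
  have eq: "chart_inv d ` T = E \<union> chart_inv d ` N" using N(1) E' by auto
  have Es: "E \<in> sets (area_measure M)" by (rule borel_sets_area_measure[OF E(1)])
  show "chart_inv d ` T \<in> sets (area_measure M)" unfolding eq using Es null by auto
  have "emeasure (area_measure M) (chart_inv d ` T) = emeasure (area_measure M) E"
    unfolding eq by (rule emeasure_Un_null_set[OF Es null])
  also have "\<dots> = emeasure \<mu> E" unfolding area_measure_def using E(1) by (simp add: sets_borel_area_measure)
  also have "\<dots> = (\<integral>\<^sup>+y. ennreal (density_in d y) * indicator T0 y \<partial>lborel)"
    using emeasure_area_chart[OF d E] im by simp
  also have "\<dots> = (\<integral>\<^sup>+y. ennreal (density_in d y) * indicator T y \<partial>lborel)"
  proof (rule nn_integral_cong_AE)
    have "AE y in lborel. y \<notin> N'" by (rule AE_not_in[OF N(3)])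
    then show "AE y in lborel. ennreal (density_in d y) * indicator T0 y = ennreal (density_in d y) * indicator T y"
      by eventually_elim (use N(1,2) in \<open>auto simp: indicator_def\<close>)
  qed
  finally show "emeasure (area_measure M) (chart_inv d ` T) = (\<integral>\<^sup>+y. ennreal (density_in d y) * indicator T y \<partial>lborel)" .
qed

lemma finite_area_measure: "finite_measure (area_measure M)"
proof (rule finite_measureI)
  have "emeasure (area_measure M) (points M) = emeasure \<mu> (points M)"
    unfolding area_measure_def using sets.top[of \<mu>] by simp
  then show "emeasure (area_measure M) (space (area_measure M)) \<noteq> \<infinity>" using emeasure_points_finite by simp
qed

end

subsection \<open>The differential at interior points\<close>

context surface_map
begin

lemma inner_metric_at:
  "p \<in> points M \<Longrightarrow> inner_product (metric_at M p)" "q \<in> points N \<Longrightarrow> inner_product (metric_at N q)"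
  using M.inner_riem[OF M.chart_at] N.inner_riem[OF N.chart_at] by (simp_all add: metric_at_def)

lemma linear_differential: "linear (differential M N \<phi> p)"
proof -
  define P where "P A \<longleftrightarrow> (coord (chart_at N (\<phi> p)) \<circ> \<phi> \<circ> chart_inv (chart_at M p) has_derivative A)
     (at (coord (chart_at M p) p) within coord (chart_at M p) ` dom_of (chart_at M p))" for A
  have eq: "differential M N \<phi> p = (if \<exists>A. P A then SOME A. P A else (\<lambda>v. 0))"
    unfolding differential_def Let_def P_def ..
  show ?thesis
  proof (cases "\<exists>A. P A")
    case True
    then have "P (SOME A. P A)" by (rule someI_ex)
    then have "linear (SOME A. P A)" unfolding P_def by (rule has_derivative_linear)
    then show ?thesis using True by (simp add: eq)
  next
    case False
    have "linear (\<lambda>v :: real^2. 0 :: real^2)" by (rule linearI) auto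
    then show ?thesis using False by (simp add: eq)
  qed
qed

text \<open>\<open>differential\<close> uses the charts selected by \<open>chart_at\<close> and a
  derivative within a patch selected by SOME. The lemma replaces them by arbitrary fixed charts and
  a derivative in the full sense, so that the energy density can be studied on a whole chart domain
  at once.\<close>

lemma differential_in_charts:
  assumes c: "c \<in> atlas M" "q \<in> dom_of c" and d: "d \<in> atlas N" "\<phi> q \<in> dom_of d"
    and int: "coord c q \<in> interior (M.patch c)" and A: "(loc c d has_derivative A) (at (coord c q))"
  shows "jacobian M N \<phi> q = hom_det (riem M c q) (riem N d (\<phi> q)) A"
    and "hom_norm_sq (metric_at M q) (metric_at N (\<phi> q)) (differential M N \<phi> q)
       = hom_norm_sq (riem M c q) (riem N d (\<phi> q)) A"
proof -
  have q: "q \<in> points M" using M.dom_subset[OF c(1)] c(2) by blast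
  define c' where "c' = chart_at M q"
  define d' where "d' = chart_at N (\<phi> q)"
  have c': "c' \<in> atlas M" "q \<in> dom_of c'" using M.chart_at[OF q] by (simp_all add: c'_def)
  have d': "d' \<in> atlas N" "\<phi> q \<in> dom_of d'" using N.chart_at[OF \<phi>_points[OF q]] by (simp_all add: d'_def)
  let ?\<tau> = "coord c \<circ> chart_inv c'" and ?\<sigma> = "coord d' \<circ> chart_inv d" and ?F = "coord d' \<circ> \<phi> \<circ> chart_inv c'"
  obtain D where D: "(?\<tau> has_derivative D) (at (coord c' q) within coord c' ` (dom_of c' \<inter> dom_of c))"
    "det (matrix D) > 0" "\<And>u v. riem M c q (D u) (D v) = riem M c' q u v"
    by (rule M.transition[OF c'(1) c(1) c'(2) c(2)]) (rule that)
  obtain E where E: "(?\<sigma> has_derivative E) (at (coord d (\<phi> q)) within coord d ` (dom_of d \<inter> dom_of d'))"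
    "det (matrix E) > 0" "\<And>u v. riem N d' (\<phi> q) (E u) (E v) = riem N d (\<phi> q) u v"
    by (rule N.transition[OF d(1) d'(1) d(2) d'(2)]) (rule that)
  have linD: "linear D" and linE: "linear E" and linA: "linear A"
    using D(1) E(1) A by (auto intro: has_derivative_linear)
  \<comment> \<open>A neighbourhood of \<open>q\<close> on which both source charts are defined and
    whose image lies in both target charts.\<close>
  define V where "V = {q\<in>points M. \<phi> q \<in> dom_of d \<inter> dom_of d'} \<inter> (dom_of c \<inter> dom_of c')"
  have "openin (surface_top M) V"
    unfolding V_def by (intro openin_Int \<phi>_openin_preimage M.chart(1) N.chart(1) c c' d d')
  then obtain W where W: "open W" "\<And>p. p \<in> dom_of c' \<Longrightarrow> coord c' p \<in> W \<longleftrightarrow> p \<in> V"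
    using M.openin_coord_image[OF c'(1)] by blast
  define S where "S = M.patch c' \<inter> W"
  have SV: "chart_inv c' x \<in> V" "coord c' (chart_inv c' x) = x" if "x \<in> S" for x
    using that W(2)[OF M.chart_inv_in_dom[of x c']] by (simp_all add: S_def)
  have "q \<in> V" using q c c' d d' by (auto simp: V_def)
  then have xS: "coord c' q \<in> S" using W(2)[OF c'(2)] c'(2) by (simp add: S_def)
  have S1: "S \<subseteq> coord c' ` (dom_of c' \<inter> dom_of c)"
  proof
    fix x assume "x \<in> S"
    from SV[OF this] show "x \<in> coord c' ` (dom_of c' \<inter> dom_of c)" by (intro image_eqI[of _ _ "chart_inv c' x"]) (auto simp: V_def)
  qed
  have comp: "loc c d (?\<tau> x) = coord d (\<phi> (chart_inv c' x))" if "x \<in> S" for x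
    using SV(1)[OF that] c(1) by (auto simp: loc_def V_def)
  have S2: "(loc c d \<circ> ?\<tau>) ` S \<subseteq> coord d ` (dom_of d \<inter> dom_of d')"
  proof safe
    fix x assume x: "x \<in> S"
    then show "(loc c d \<circ> ?\<tau>) x \<in> coord d ` (dom_of d \<inter> dom_of d')"
      using SV(1)[OF x] comp[OF x] by (auto simp: V_def)
  qed
  have \<tau>q: "?\<tau> (coord c' q) = coord c q" using c' by simp
  have locq: "(loc c d \<circ> ?\<tau>) (coord c' q) = coord d (\<phi> q)" using c c' by (simp add: loc_def)
  define A' where "A' = E \<circ> (A \<circ> D)"
  have FA': "(?F has_derivative A') (at (coord c' q) within M.patch c')"
  proof -
    have 1: "(?\<tau> has_derivative D) (at (coord c' q) within S)" by (rule has_derivative_subset[OF D(1) S1])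
    have 2: "(loc c d has_derivative A) (at (?\<tau> (coord c' q)) within ?\<tau> ` S)"
      unfolding \<tau>q by (rule has_derivative_at_withinI[OF A])
    have 3: "(?\<sigma> has_derivative E) (at ((loc c d \<circ> ?\<tau>) (coord c' q)) within (loc c d \<circ> ?\<tau>) ` S)"
      unfolding locq by (rule has_derivative_subset[OF E(1) S2])
    have "(?\<sigma> \<circ> (loc c d \<circ> ?\<tau>) has_derivative A') (at (coord c' q) within S)"
      unfolding A'_def by (rule diff_chain_within[OF diff_chain_within[OF 1 2] 3])
    then have "(?F has_derivative A') (at (coord c' q) within S)"
    proof (rule has_derivative_transform[OF xS, rotated])
      fix x assume x: "x \<in> S"
      have "\<phi> (chart_inv c' x) \<in> dom_of d" using SV(1)[OF x] by (simp add: V_def)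
      then show "?F x = (?\<sigma> \<circ> (loc c d \<circ> ?\<tau>)) x" using comp[OF x] d(1) by simp
    qed
    moreover have "at (coord c' q) within S = at (coord c' q) within M.patch c'"
      by (rule at_within_nhd[of _ W]) (use xS W(1) in \<open>auto simp: S_def\<close>)
    ultimately show ?thesis by simp
  qed
  \<comment> \<open>A derivative within a patch need not be unique in general. Here \<open>q\<close>
    is interior in the chart \<open>c\<close>, so composing with the coordinate change from
    \<open>c\<close> gives derivatives on an open set, which are unique, and the derivative of the
    coordinate change can be cancelled.\<close>
  have unique: "A2 = A'" if A2: "(?F has_derivative A2) (at (coord c' q) within M.patch c')" for A2
  proof -
    let ?\<theta> = "coord c' \<circ> chart_inv c"
    obtain G where G: "(?\<theta> has_derivative G) (at (coord c q) within coord c ` (dom_of c \<inter> dom_of c'))" "det (matrix G) > 0"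
      by (rule M.transition[OF c(1) c'(1) c(2) c'(2)]) (rule that)
    obtain W3 where W3: "open W3" "\<And>p. p \<in> dom_of c \<Longrightarrow> coord c p \<in> W3 \<longleftrightarrow> p \<in> dom_of c'"
      using M.openin_coord_image[OF c(1) M.chart(1)[OF c'(1)]] by blast
    define O3 where "O3 = interior (M.patch c) \<inter> W3"
    have O3: "open O3" "coord c q \<in> O3" using W3 int c c' by (auto simp: O3_def)
    have O3d: "chart_inv c x \<in> dom_of c \<inter> dom_of c' \<and> coord c (chart_inv c x) = x" if "x \<in> O3" for x
    proof -
      have "x \<in> M.patch c" "x \<in> W3" using that interior_subset by (auto simp: O3_def)
      then show ?thesis using M.chart_inv_in_dom[of x c] W3(2)[of "chart_inv c x"] by simp
    qed
    have sub: "O3 \<subseteq> coord c ` (dom_of c \<inter> dom_of c')"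
    proof
      fix x assume "x \<in> O3"
      from O3d[OF this] show "x \<in> coord c ` (dom_of c \<inter> dom_of c')" by (intro image_eqI[of _ _ "chart_inv c x"]) auto
    qed
    have G': "(?\<theta> has_derivative G) (at (coord c q))"
      using has_derivative_subset[OF G(1) sub] O3 by (simp add: at_within_open[of _ O3])
    then have G3: "(?\<theta> has_derivative G) (at (coord c q) within O3)" by (rule has_derivative_at_withinI)
    have im: "?\<theta> ` O3 \<subseteq> M.patch c'" using O3d by auto
    have \<theta>q: "?\<theta> (coord c q) = coord c' q" using c by simp
    have chain: "(?F \<circ> ?\<theta> has_derivative (B \<circ> G)) (at (coord c q))"
      if B: "(?F has_derivative B) (at (coord c' q) within M.patch c')" for B
    proof -
      have "(?F has_derivative B) (at (?\<theta> (coord c q)) within ?\<theta> ` O3)"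
        unfolding \<theta>q by (rule has_derivative_subset[OF B im])
      from diff_chain_within[OF G3 this] show ?thesis unfolding at_within_open[OF O3(2,1)] .
    qed
    have eq: "A2 \<circ> G = A' \<circ> G" by (rule has_derivative_unique[OF chain[OF A2] chain[OF FA']])
    have linG: "linear G" using G(1) by (rule has_derivative_linear)
    have "inj G" using G(2) linG by (simp add: det_nz_iff_inj[symmetric])
    then have "surj G" using linG by (simp add: linear_injective_imp_surjective)
    then show "A2 = A'" using eq by (metis comp_apply ext surjD)
  qed
  have diff: "differential M N \<phi> q = A'"
  proof -
    have "(SOME A. (?F has_derivative A) (at (coord c' q) within M.patch c')) = A'"
      by (rule some_equality, rule FA', rule unique)
    moreover have "\<exists>A. (?F has_derivative A) (at (coord c' q) within M.patch c')" using FA' by blast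
    ultimately show ?thesis unfolding differential_def Let_def c'_def[symmetric] d'_def[symmetric] by simp
  qed
  note g = M.inner_riem[OF c] and g' = M.inner_riem[OF c'] and h = N.inner_riem[OF d] and h' = N.inner_riem[OF d']
  have linEA: "linear (E \<circ> A)" using linear_compose[OF linA linE] .
  have linA': "linear A'" unfolding A'_def by (rule linear_compose[OF linear_compose[OF linD linA] linE])
  have lid: "linear (\<lambda>v :: real^2. v)" "det (matrix (\<lambda>v :: real^2. v)) > 0"
    by (simp_all add: linear_ident matrix_id_mat_1[unfolded id_def])
  \<comment> \<open>First the target chart is changed, with the identity on the source, and then the
    source chart.\<close>
  have "hom_det (riem M c q) (riem N d (\<phi> q)) A = hom_det (riem M c q) (riem N d' (\<phi> q)) (E \<circ> A)"
    by (rule hom_det_change[OF g g h h' linA linEA lid(1) linE _ E(3) _ lid(2) E(2), symmetric]) simp_all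
  also have "\<dots> = hom_det (riem M c' q) (riem N d' (\<phi> q)) A'"
    by (rule hom_det_change[OF g' g h' h' linA' linEA linD lid(1) D(3) _ _ D(2) lid(2)]) (simp_all add: A'_def)
  finally show "jacobian M N \<phi> q = hom_det (riem M c q) (riem N d (\<phi> q)) A"
    by (simp add: jacobian_def metric_at_def diff c'_def d'_def)
  have "hom_norm_sq (riem M c q) (riem N d (\<phi> q)) A = hom_norm_sq (riem M c q) (riem N d' (\<phi> q)) (E \<circ> A)"
    by (rule hom_norm_sq_change[OF g g h h' linA linEA _ E(3), of "\<lambda>v. v", symmetric]) simp_all
  also have "\<dots> = hom_norm_sq (riem M c' q) (riem N d' (\<phi> q)) A'"
    by (rule hom_norm_sq_change[OF g' g h' h' linA' linEA D(3), of "\<lambda>v. v"]) (simp_all add: A'_def)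
  finally show "hom_norm_sq (metric_at M q) (metric_at N (\<phi> q)) (differential M N \<phi> q)
       = hom_norm_sq (riem M c q) (riem N d (\<phi> q)) A"
    by (simp add: metric_at_def diff c'_def d'_def)
qed

end

subsection \<open>The area formula on small pieces\<close>

lemma lipschitz_derivative_bound:
  fixes f :: "'a::real_normed_vector \<Rightarrow> 'b::real_normed_vector"
  assumes L: "L-lipschitz_on S f" and S: "open S" "x \<in> S" and A: "(f has_derivative A) (at x)"
  shows "norm (A v) \<le> L * norm v"
proof (cases "v = 0")
  case True
  then show ?thesis using has_derivative_linear[OF A] by (simp add: linear_0)
next
  case False
  obtain r where r: "r > 0" "ball x r \<subseteq> S" using S by (auto simp: open_contains_ball)
  have lin: "linear A" by (rule has_derivative_linear[OF A])
  show ?thesis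
  proof (rule field_le_epsilon)
    fix e :: real assume e: "e > 0"
    define e' where "e' = e / norm v"
    have e': "e' > 0" using e False by (simp add: e'_def)
    obtain d where d: "d > 0" "\<And>y. norm (y - x) < d \<Longrightarrow> norm (f y - f x - A (y - x)) \<le> e' * norm (y - x)"
      using A e' unfolding has_derivative_at_alt by blast
    define s where "s = min d r / (2 * norm v)"
    have s: "s > 0" using d r False by (simp add: s_def)
    have sv: "norm (s *\<^sub>R v) = min d r / 2" using False d r by (simp add: s_def)
    let ?y = "x + s *\<^sub>R v"
    have "norm (s *\<^sub>R v) < d" "norm (s *\<^sub>R v) < r" using d r unfolding sv by auto
    then have y: "norm (?y - x) < d" "?y \<in> S" using r by (auto simp: dist_norm)
    have "norm (A (s *\<^sub>R v)) \<le> norm (f ?y - f x) + norm (f ?y - f x - A (s *\<^sub>R v))"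
      using norm_triangle_ineq4[of "f ?y - f x" "f ?y - f x - A (s *\<^sub>R v)"] by simp
    also have "\<dots> \<le> L * norm (s *\<^sub>R v) + e' * norm (s *\<^sub>R v)"
      using d(2)[OF y(1)] lipschitz_onD[OF L y(2) S(2)] by (simp add: dist_norm)
    finally have "s * norm (A v) \<le> s * (L * norm v + e' * norm v)"
      using s by (simp add: linear_cmul[OF lin] algebra_simps)
    then have "norm (A v) \<le> L * norm v + e' * norm v" using s by simp
    then show "norm (A v) \<le> L * norm v + e" using False by (simp add: e'_def)
  qed
qed

context surface_map
begin

text \<open>The bound \<open>K\<close> is required for all linear maps of operator norm at most
  \<open>L\<close>, so it can be fixed from the metrics alone, before anything is known about where
  \<open>\<phi>\<close> is differentiable.\<close>

definition piece :: "'a chart \<Rightarrow> 'b chart \<Rightarrow> 'a set \<Rightarrow> real \<Rightarrow> real \<Rightarrow> bool" where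
  "piece c d U L K \<longleftrightarrow> c \<in> atlas M \<and> d \<in> atlas N \<and> openin (surface_top M) U \<and> U \<subseteq> dom_of c \<and> \<phi> ` U \<subseteq> dom_of d \<and>
     L-lipschitz_on (coord c ` U) (loc c d) \<and>
     (\<forall>q\<in>U. \<forall>A. linear A \<longrightarrow> (\<forall>v. norm (A v) \<le> L * norm v) \<longrightarrow> hom_norm_sq (riem M c q) (riem N d (\<phi> q)) A \<le> K)"

lemma piece_exists:
  assumes p: "p \<in> points M"
  shows "\<exists>U. openin (surface_top M) U \<and> p \<in> U \<and> (\<exists>c d L K. piece c d U L K)"
proof -
  define c where "c = chart_at M p"
  define d where "d = chart_at N (\<phi> p)"
  have c: "c \<in> atlas M" "p \<in> dom_of c" using M.chart_at[OF p] by (simp_all add: c_def)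
  have d: "d \<in> atlas N" "\<phi> p \<in> dom_of d" using N.chart_at[OF \<phi>_points[OF p]] by (simp_all add: d_def)
  obtain r L where r: "r > 0" "L-lipschitz_on (M.patch c \<inter> ball (coord c p) r) (loc c d)"
    "\<And>x. x \<in> M.patch c \<inter> ball (coord c p) r \<Longrightarrow> \<phi> (chart_inv c x) \<in> dom_of d"
    by (rule locally_lipschitz_in_charts[OF c d]) (rule that)
  obtain R1 m1 where R1: "R1 > 0" "m1 > 0"
    "\<And>x v. x \<in> M.patch c \<Longrightarrow> dist (coord c p) x < R1 \<Longrightarrow> m1 * (norm v)\<^sup>2 \<le> riem M c (chart_inv c x) v v"
    by (rule M.metric_bounds[OF c]) blast
  obtain R2 K2 where R2: "R2 > 0" "K2 > 0"
    "\<And>x v. x \<in> N.patch d \<Longrightarrow> dist (coord d (\<phi> p)) x < R2 \<Longrightarrow> riem N d (chart_inv d x) v v \<le> K2 * (norm v)\<^sup>2"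
    by (rule N.metric_bounds[OF d]) blast
  define V where "V = {q\<in>dom_of d. coord d q \<in> ball (coord d (\<phi> p)) R2}"
  define U where "U = {q\<in>dom_of c. coord c q \<in> ball (coord c p) r \<inter> ball (coord c p) R1} \<inter> {q\<in>points M. \<phi> q \<in> V}"
  have L0: "L \<ge> 0" using r(2) by (rule lipschitz_on_nonneg)
  have "openin (surface_top M) U"
    unfolding U_def V_def by (intro openin_Int M.openin_coord_preimage \<phi>_openin_preimage N.openin_coord_preimage c d) auto
  moreover have "p \<in> U" using p c d r R1 R2 by (simp add: U_def V_def)
  \<comment> \<open>A unit vector for the source metric has Euclidean square length at most 1 / m1,
    so its image has square length at most K2 L^2 / m1 for the target metric; a basis has two
    vectors.\<close>
  moreover have "piece c d U L (2 * (K2 * (L\<^sup>2 / m1)))"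
    unfolding piece_def
  proof (intro conjI c(1) d(1) ballI allI impI)
    show "openin (surface_top M) U" by fact
    show "U \<subseteq> dom_of c" by (auto simp: U_def)
    show "\<phi> ` U \<subseteq> dom_of d" by (auto simp: U_def V_def)
    show "L-lipschitz_on (coord c ` U) (loc c d)" by (rule lipschitz_on_subset[OF r(2)]) (auto simp: U_def)
    fix q and A :: "real^2 \<Rightarrow> real^2" assume q: "q \<in> U" and A: "linear A" "\<forall>v. norm (A v) \<le> L * norm v"
    have qc: "q \<in> dom_of c" "\<phi> q \<in> dom_of d" using q by (auto simp: U_def V_def)
    have gq: "m1 * (norm v)\<^sup>2 \<le> riem M c q v v" for v
      using R1(3)[of "coord c q" v] q c(1) qc by (simp add: U_def)
    have hq: "riem N d (\<phi> q) v v \<le> K2 * (norm v)\<^sup>2" for v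
      using R2(3)[of "coord d (\<phi> q)" v] q d(1) qc by (simp add: U_def V_def)
    note g = M.inner_riem[OF c(1) qc(1)] and h = N.inner_riem[OF d(1) qc(2)]
    let ?e = "oriented_frame (riem M c q)"
    have "riem N d (\<phi> q) (A (?e j)) (A (?e j)) \<le> K2 * (L\<^sup>2 / m1)" for j
    proof -
      have "m1 * (norm (?e j))\<^sup>2 \<le> 1" using gq[of "?e j"] oriented_frame(1)[OF g] by (simp add: orthonormal_basis_def)
      then have "(norm (?e j))\<^sup>2 \<le> 1 / m1" using R1(2) by (simp add: field_simps)
      then have 1: "L\<^sup>2 * (norm (?e j))\<^sup>2 \<le> L\<^sup>2 * (1 / m1)" by (rule mult_left_mono) simp
      have "(norm (A (?e j)))\<^sup>2 \<le> (L * norm (?e j))\<^sup>2" using A(2) by (intro power_mono) auto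
      also have "\<dots> \<le> L\<^sup>2 / m1" using 1 by (simp add: power_mult_distrib)
      finally have "K2 * (norm (A (?e j)))\<^sup>2 \<le> K2 * (L\<^sup>2 / m1)" using R2(2) by (intro mult_left_mono) auto
      then show ?thesis using hq[of "A (?e j)"] by linarith
    qed
    then have "(\<Sum>j\<in>UNIV. riem N d (\<phi> q) (A (?e j)) (A (?e j))) \<le> 2 * (K2 * (L\<^sup>2 / m1))"
      unfolding sum_2 by (metis add_mono mult_2)
    then show "hom_norm_sq (riem M c q) (riem N d (\<phi> q)) A \<le> 2 * (K2 * (L\<^sup>2 / m1))"
      using sum_orthonormal_basis[OF g h oriented_frame(1)[OF g] A(1)] by simp
  qed
  ultimately show ?thesis by blast
qed

definition dnorm_sq :: "'a \<Rightarrow> real" where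
  "dnorm_sq q = hom_norm_sq (metric_at M q) (metric_at N (\<phi> q)) (differential M N \<phi> q)"

text \<open>Interior points are singled out since only there is the derivative within the patch a
  derivative in the full sense, as \<open>differential_in_charts\<close> demands.\<close>

definition regular :: "'a chart \<Rightarrow> 'b chart \<Rightarrow> 'a set \<Rightarrow> 'a set" where
  "regular c d U = {q\<in>U. coord c q \<in> interior (M.patch c) \<and> loc c d differentiable (at (coord c q))}"

abbreviation dloc :: "'a chart \<Rightarrow> 'b chart \<Rightarrow> real^2 \<Rightarrow> real^2 \<Rightarrow> real^2" where
  "dloc c d x \<equiv> frechet_derivative (loc c d) (at x)"

context
  fixes c d U L K
  assumes piece: "piece c d U L K"
begin

lemma pieceD:
  shows "c \<in> atlas M" "d \<in> atlas N" "openin (surface_top M) U" "U \<subseteq> dom_of c" "q \<in> U \<Longrightarrow> \<phi> q \<in> dom_of d"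
    "L-lipschitz_on (coord c ` U) (loc c d)" "U \<in> sets M.borel_sets" "q \<in> U \<Longrightarrow> q \<in> dom_of c"
  using piece M.openin_borel unfolding piece_def by blast+

lemma coord_piece_open:
  obtains W where "open W" "coord c ` U = M.patch c \<inter> W"
proof -
  obtain W where W: "open W" "\<And>p. p \<in> dom_of c \<Longrightarrow> coord c p \<in> W \<longleftrightarrow> p \<in> U"
    using M.openin_coord_image[OF pieceD(1,3)] by blast
  have "coord c ` U = M.patch c \<inter> W" using W(2) pieceD(4) by blast
  then show thesis using W(1) that by blast
qed

text \<open>Rademacher's theorem covers the interior of the patch; the remaining points lie on
  Lipschitz graphs.\<close>

lemma negligible_irregular: "negligible (coord c ` (U - regular c d U))"
proof -
  obtain W where W: "open W" "coord c ` U = M.patch c \<inter> W" by (rule coord_piece_open)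
  let ?O = "interior (M.patch c) \<inter> W"
  have O: "open ?O" "?O \<subseteq> coord c ` U"
    unfolding W(2) using W(1) interior_subset[of "M.patch c"] by (simp add: open_Int, blast)
  have "negligible {x\<in>?O. \<not> loc c d differentiable (at x)}"
    by (rule rademacher_locally[OF O(1)])
       (intro exI[of _ 1] exI[of _ L] conjI zero_less_one lipschitz_on_subset[OF pieceD(6)], use O(2) in auto)
  moreover have "negligible (M.patch c - interior (M.patch c))"
    by (rule lipschitz_patch_negligible_boundary[OF M.chart(2)[OF pieceD(1)]])
  moreover have "coord c ` (U - regular c d U) \<subseteq>
     {x\<in>?O. \<not> loc c d differentiable (at x)} \<union> (M.patch c - interior (M.patch c))"
  proof
    fix x assume "x \<in> coord c ` (U - regular c d U)"
    then obtain q where q: "q \<in> U" "q \<notin> regular c d U" "x = coord c q" by blast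
    then have "x \<in> M.patch c \<inter> W" using W(2) by blast
    then show "x \<in> {x\<in>?O. \<not> loc c d differentiable (at x)} \<union> (M.patch c - interior (M.patch c))"
      using q by (auto simp: regular_def)
  qed
  ultimately show ?thesis using negligible_Un negligible_subset by blast
qed

lemma AE_regular: "AE q in area_measure M. q \<in> U \<longrightarrow> q \<in> regular c d U"
proof -
  have "U - regular c d U \<in> null_sets (area_measure M)"
    using negligible_irregular pieceD(4) by (subst M.null_area_iff_negligible[OF pieceD(1)]) auto
  from AE_not_in[OF this] show ?thesis by eventually_elim blast
qed

lemma regular_derivative:
  assumes "q \<in> regular c d U"
  shows "(loc c d has_derivative dloc c d (coord c q)) (at (coord c q))"
    "linear (dloc c d (coord c q))"
    "norm (dloc c d (coord c q) v) \<le> L * norm v"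
proof -
  show 1: "(loc c d has_derivative dloc c d (coord c q)) (at (coord c q))"
    using assms by (simp add: regular_def frechet_derivative_works[symmetric])
  then show "linear (dloc c d (coord c q))" by (rule has_derivative_linear)
  obtain W where W: "open W" "coord c ` U = M.patch c \<inter> W" by (rule coord_piece_open)
  let ?O = "interior (M.patch c) \<inter> W"
  have O: "open ?O" "?O \<subseteq> coord c ` U"
    unfolding W(2) using W(1) interior_subset[of "M.patch c"] by (simp add: open_Int, blast)
  have "coord c q \<in> M.patch c \<inter> W" using assms W(2) by (auto simp: regular_def)
  then have "coord c q \<in> ?O" using assms by (simp add: regular_def)
  then show "norm (dloc c d (coord c q) v) \<le> L * norm v"
    by (rule lipschitz_derivative_bound[OF lipschitz_on_subset[OF pieceD(6) O(2)] O(1) _ 1])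
qed

lemma regular_dom: "q \<in> regular c d U \<Longrightarrow> q \<in> U \<and> q \<in> dom_of c \<and> \<phi> q \<in> dom_of d"
  using pieceD(5,8) by (auto simp: regular_def)

lemma jacobian_regular:
  assumes q: "q \<in> regular c d U"
  shows "jacobian M N \<phi> q = det (matrix (dloc c d (coord c q))) * N.density_in d (loc c d (coord c q)) / M.density_in c (coord c q)"
proof -
  have qd: "q \<in> dom_of c" "\<phi> q \<in> dom_of d" using regular_dom[OF q] by auto
  have "jacobian M N \<phi> q = hom_det (riem M c q) (riem N d (\<phi> q)) (dloc c d (coord c q))"
    by (rule differential_in_charts(1)[OF pieceD(1) qd(1) pieceD(2) qd(2) _ regular_derivative(1)[OF q]])
       (use q in \<open>simp add: regular_def\<close>)
  also have "\<dots> = det (matrix (dloc c d (coord c q))) * sqrt (gram_det (riem N d (\<phi> q))) / sqrt (gram_det (riem M c q))"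
    by (rule hom_det_eq[OF M.inner_riem[OF pieceD(1) qd(1)] N.inner_riem[OF pieceD(2) qd(2)] regular_derivative(2)[OF q]])
  finally show ?thesis
    using qd pieceD(1,2) by (simp add: loc_def M.density_in_coord N.density_in_coord M.area_density_eq N.area_density_eq)
qed

lemma dnorm_sq_regular:
  assumes q: "q \<in> regular c d U"
  shows "dnorm_sq q = hom_norm_sq (riem M c q) (riem N d (\<phi> q)) (dloc c d (coord c q))" "dnorm_sq q \<le> K"
proof -
  have qd: "q \<in> dom_of c" "\<phi> q \<in> dom_of d" "q \<in> U" using regular_dom[OF q] by auto
  show *: "dnorm_sq q = hom_norm_sq (riem M c q) (riem N d (\<phi> q)) (dloc c d (coord c q))"
    unfolding dnorm_sq_def
    by (rule differential_in_charts(2)[OF pieceD(1) qd(1) pieceD(2) qd(2) _ regular_derivative(1)[OF q]])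
       (use q in \<open>simp add: regular_def\<close>)
  show "dnorm_sq q \<le> K"
    unfolding * using piece qd(3) regular_derivative(2,3)[OF q] unfolding piece_def by blast
qed

lemma regular_image_lebesgue:
  assumes E: "E \<in> sets M.borel_sets" "E \<subseteq> U"
  shows "coord c ` (E \<inter> regular c d U) \<in> sets lebesgue"
proof -
  have "coord c ` (E \<inter> regular c d U) = coord c ` E - coord c ` (E - regular c d U)"
  proof -
    have "E - (E - regular c d U) \<subseteq> dom_of c" "E - regular c d U \<subseteq> dom_of c" using E(2) pieceD(4) by blast+
    from inj_on_image_set_diff[OF M.inj_coord[OF pieceD(1)] this] show ?thesis by (simp add: Diff_Diff_Int)
  qed
  moreover have "coord c ` E \<in> sets lebesgue"
  proof -
    have "E \<subseteq> dom_of c" using E(2) pieceD(4) by blast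
    from M.coord_image_borel[OF pieceD(1) E(1) this] show ?thesis by simp
  qed
  moreover have "negligible (coord c ` (E - regular c d U))"
    by (rule negligible_subset[OF negligible_irregular]) (use E(2) in auto)
  ultimately show ?thesis by (simp only: sets.Diff negligible_imp_sets)
qed

section \<open>Measurability of the Jacobian and of the norm of the differential\<close>

definition mloc :: "2 \<Rightarrow> 2 \<Rightarrow> real^2 \<Rightarrow> real" where
  "mloc i j x = indicator (coord c ` regular c d U) x * (matrix (dloc c d x) $ i $ j)"

definition floc :: "real^2 \<Rightarrow> real^2" where
  "floc x = indicator (coord c ` U) x *\<^sub>R loc c d x"

lemma mloc_measurable [measurable]: "mloc i j \<in> borel_measurable lebesgue"
proof -
  let ?S = "coord c ` regular c d U"
  have "U \<inter> regular c d U = regular c d U" by (auto simp: regular_def)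
  then have S: "?S \<in> sets lebesgue" using regular_image_lebesgue[OF pieceD(7) subset_refl] by simp
  have "(\<lambda>x. matrix (dloc c d x) $ i $ j) \<in> borel_measurable (lebesgue_on ?S)"
  proof (rule borel_measurable_partial_derivatives[OF S])
    fix x assume "x \<in> ?S"
    then show "(loc c d has_derivative dloc c d x) (at x within ?S)"
      using regular_derivative(1) has_derivative_at_withinI by blast
  qed
  then show ?thesis using S unfolding mloc_def by (simp add: borel_measurable_restrict_space_iff mult.commute)
qed

lemma floc_measurable: "floc \<in> borel_measurable borel"
  unfolding floc_def
  by (rule borel_measurable_continuous_on_indicator[OF M.coord_image_borel[OF pieceD(1,7,4)] lipschitz_on_continuous_on[OF pieceD(6)]])

text \<open>The functions on the target have to be Borel, as in \<open>riem_measurable_N\<close>: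
  composing a merely Lebesgue measurable function with \<open>floc\<close> could destroy
  measurability.\<close>

lemma floc_comp_measurable [measurable]: "f \<in> borel_measurable borel \<Longrightarrow> (\<lambda>x. f (floc x)) \<in> borel_measurable lebesgue"
  by (rule measurable_completion) (use measurable_compose[OF floc_measurable] in simp)

lemma riem_measurable_M: "(\<lambda>x. indicator (M.patch c) x * riem M c (chart_inv c x) u v) \<in> borel_measurable lebesgue"
  using borel_measurable_continuous_on_indicator[OF M.patch_borel[OF pieceD(1)] M.continuous_riem[OF pieceD(1)], of u v]
  by (simp add: measurable_completion)

lemma riem_measurable_N: "(\<lambda>x. indicator (N.patch d) x * riem N d (chart_inv d x) u v) \<in> borel_measurable borel"
  using borel_measurable_continuous_on_indicator[OF N.patch_borel[OF pieceD(2)] N.continuous_riem[OF pieceD(2)], of u v]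
  by simp

lemma jacobian_in_chart:
  obtains \<Psi> where "\<Psi> \<in> borel_measurable lebesgue"
    "\<And>q. q \<in> regular c d U \<Longrightarrow> \<Psi> (coord c q) = ennreal \<bar>jacobian M N \<phi> q\<bar>"
proof -
  define \<Psi> where "\<Psi> x = ennreal (\<bar>mloc 1 1 x * mloc 2 2 x - mloc 1 2 x * mloc 2 1 x\<bar> * N.density_in d (floc x) / M.density_in c x)" for x
  show thesis
  proof (rule that[of \<Psi>])
    have [measurable]: "M.density_in c \<in> borel_measurable lebesgue"
      using M.density_in_measurable[OF pieceD(1)] by (simp add: measurable_completion)
    have [measurable]: "(\<lambda>x. N.density_in d (floc x)) \<in> borel_measurable lebesgue"
      by (rule floc_comp_measurable[OF N.density_in_measurable[OF pieceD(2)]])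
    show "\<Psi> \<in> borel_measurable lebesgue" unfolding \<Psi>_def by measurable
    fix q assume q: "q \<in> regular c d U"
    have m: "mloc i j (coord c q) = matrix (dloc c d (coord c q)) $ i $ j" for i j using q by (simp add: mloc_def)
    have f: "floc (coord c q) = loc c d (coord c q)" using regular_dom[OF q] by (simp add: floc_def)
    have "\<bar>N.density_in d (loc c d (coord c q))\<bar> = N.density_in d (loc c d (coord c q))"
      "\<bar>M.density_in c (coord c q)\<bar> = M.density_in c (coord c q)"
      using N.density_in_nonneg[OF pieceD(2)] M.density_in_nonneg[OF pieceD(1)] by simp_all
    then show "\<Psi> (coord c q) = ennreal \<bar>jacobian M N \<phi> q\<bar>"
      unfolding \<Psi>_def jacobian_regular[OF q] m f det_2 abs_mult abs_divide by simp
  qed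
qed

text \<open>Here the formula for \<open>hom_norm_sq\<close> pays off: it is a rational expression in
  the metric coefficients and the partial derivatives, whereas the frames in \<open>hom_norm\<close>
  are selected point by point without any measurability.\<close>

lemma dnorm_sq_in_chart:
  obtains \<Psi> where "\<Psi> \<in> borel_measurable lebesgue"
    "\<And>q. q \<in> regular c d U \<Longrightarrow> \<Psi> (coord c q) = ennreal (dnorm_sq q)"
proof -
  define g where "g i j x = indicator (M.patch c) x * riem M c (chart_inv c x) (axis i 1) (axis j 1)" for i j :: 2 and x
  define h where "h i j x = indicator (N.patch d) x * riem N d (chart_inv d x) (axis i 1) (axis j 1)" for i j :: 2 and x
  \<comment> \<open>The Gram matrix of the pulled back metric: the inner product of the images of
    the axes \<open>k\<close> and \<open>l\<close>.\<close>
  define Q where "Q k l x = mloc 1 k x * mloc 1 l x * h 1 1 (floc x) + mloc 1 k x * mloc 2 l x * h 1 2 (floc x)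
     + mloc 2 k x * mloc 1 l x * h 2 1 (floc x) + mloc 2 k x * mloc 2 l x * h 2 2 (floc x)" for k l x
  define \<Psi> where "\<Psi> x = ennreal ((g 2 2 x * Q 1 1 x - 2 * g 1 2 x * Q 1 2 x + g 1 1 x * Q 2 2 x) / (g 1 1 x * g 2 2 x - (g 1 2 x)\<^sup>2))" for x
  show thesis
  proof (rule that[of \<Psi>])
    have [measurable]: "g i j \<in> borel_measurable lebesgue" for i j unfolding g_def by (rule riem_measurable_M)
    have [measurable]: "(\<lambda>x. h i j (floc x)) \<in> borel_measurable lebesgue" for i j
      by (rule floc_comp_measurable) (simp add: h_def riem_measurable_N)
    have [measurable]: "Q k l \<in> borel_measurable lebesgue" for k l unfolding Q_def by measurable
    show "\<Psi> \<in> borel_measurable lebesgue" unfolding \<Psi>_def by measurable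
    fix q assume q: "q \<in> regular c d U"
    have qd: "q \<in> dom_of c" "\<phi> q \<in> dom_of d" "q \<in> U" using regular_dom[OF q] by auto
    have m: "mloc i j (coord c q) = dloc c d (coord c q) (axis j 1) $ i" for i j using q by (simp add: mloc_def matrix_def)
    have f: "floc (coord c q) = coord d (\<phi> q)" using qd pieceD(1) by (simp add: floc_def loc_def)
    have gq: "g i j (coord c q) = riem M c q (axis i 1) (axis j 1)" for i j using qd pieceD(1) by (simp add: g_def)
    have hq: "h i j (coord d (\<phi> q)) = riem N d (\<phi> q) (axis i 1) (axis j 1)" for i j using qd pieceD(2) by (simp add: h_def)
    have "Q k l (coord c q) = riem N d (\<phi> q) (dloc c d (coord c q) (axis k 1)) (dloc c d (coord c q) (axis l 1))" for k l
      unfolding Q_def m f hq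
      by (rule bilinear_real2[OF inner_productD(1)[OF N.inner_riem[OF pieceD(2) qd(2)]], symmetric])
    then show "\<Psi> (coord c q) = ennreal (dnorm_sq q)"
      unfolding \<Psi>_def dnorm_sq_regular(1)[OF q] hom_norm_sq_def gram_det_def gq by simp
  qed
qed

lemma measurable_from_chart:
  assumes E: "E \<in> sets M.borel_sets" "E \<subseteq> U" and \<Psi>: "\<Psi> \<in> borel_measurable lebesgue"
    and eq: "\<And>q. q \<in> regular c d U \<Longrightarrow> \<Psi> (coord c q) = F q"
  shows "(\<lambda>q. F q * indicator E q :: ennreal) \<in> borel_measurable (area_measure M)"
proof -
  have "E \<subseteq> dom_of c" using E(2) pieceD(4) by blast
  from M.measurable_chart_function[OF pieceD(1) E(1) this \<Psi>]
  have m: "(\<lambda>q. \<Psi> (coord c q) * indicator E q) \<in> borel_measurable (completion (borel_area_measure M))"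
    by (simp add: area_measure_def)
  have "AE q in area_measure M. \<Psi> (coord c q) * indicator E q = F q * indicator E q"
    using AE_regular by eventually_elim (use E(2) eq in \<open>auto simp: indicator_def\<close>)
  then have ae: "AE q in completion (borel_area_measure M). \<Psi> (coord c q) * indicator E q = F q * indicator E q"
    unfolding area_measure_def .
  from borel_measurable_completion_AE[OF m ae] show ?thesis unfolding area_measure_def .
qed

lemma piece_measurable:
  assumes E: "E \<in> sets M.borel_sets" "E \<subseteq> U"
  shows "(\<lambda>q. ennreal \<bar>jacobian M N \<phi> q\<bar> * indicator E q) \<in> borel_measurable (area_measure M)"
    "(\<lambda>q. ennreal (dnorm_sq q) * indicator E q) \<in> borel_measurable (area_measure M)"
proof -
  obtain \<Psi> where \<Psi>: "\<Psi> \<in> borel_measurable lebesgue" "\<And>q. q \<in> regular c d U \<Longrightarrow> \<Psi> (coord c q) = ennreal \<bar>jacobian M N \<phi> q\<bar>"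
    by (rule jacobian_in_chart) (rule that)
  show "(\<lambda>q. ennreal \<bar>jacobian M N \<phi> q\<bar> * indicator E q) \<in> borel_measurable (area_measure M)"
    by (rule measurable_from_chart[OF E \<Psi>])
  obtain \<Theta> where \<Theta>: "\<Theta> \<in> borel_measurable lebesgue" "\<And>q. q \<in> regular c d U \<Longrightarrow> \<Theta> (coord c q) = ennreal (dnorm_sq q)"
    by (rule dnorm_sq_in_chart) (rule that)
  show "(\<lambda>q. ennreal (dnorm_sq q) * indicator E q) \<in> borel_measurable (area_measure M)"
    by (rule measurable_from_chart[OF E \<Theta>])
qed

text \<open>In charts the map is Lipschitz, and Lipschitz images of null sets in the plane are null.
  Thus irregular points matter on neither side of the area formula.\<close>

lemma irregular_image_null:
  assumes "E \<subseteq> U"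
  shows "\<phi> ` (E - regular c d U) \<in> null_sets (area_measure N)"
proof -
  have sub: "\<phi> ` (E - regular c d U) \<subseteq> dom_of d" using assms pieceD(5) by blast
  have "negligible (coord c ` (E - regular c d U))"
    by (rule negligible_subset[OF negligible_irregular]) (use assms in auto)
  then have "negligible (loc c d ` coord c ` (E - regular c d U))"
  proof (rule negligible_locally_Lipschitz_image[rotated])
    fix x assume x: "x \<in> coord c ` (E - regular c d U)"
    show "\<exists>T B. open T \<and> x \<in> T \<and> (\<forall>y\<in>coord c ` (E - regular c d U) \<inter> T. norm (loc c d y - loc c d x) \<le> B * norm (y - x))"
    proof (intro exI[of _ UNIV] exI[of _ L] conjI ballI)
      fix y assume "y \<in> coord c ` (E - regular c d U) \<inter> UNIV"
      then show "norm (loc c d y - loc c d x) \<le> L * norm (y - x)"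
        using x assms lipschitz_onD[OF pieceD(6), of y x] by (auto simp: dist_norm)
    qed auto
  qed simp
  moreover have "loc c d ` coord c ` (E - regular c d U) = coord d ` \<phi> ` (E - regular c d U)"
    unfolding image_image by (rule image_cong) (use assms pieceD(1,8) in \<open>auto simp: loc_def\<close>)
  ultimately show ?thesis using N.null_area_iff_negligible[OF pieceD(2) sub] by simp
qed

lemma piece_loc_image: "E \<subseteq> U \<Longrightarrow> loc c d ` coord c ` E = coord d ` \<phi> ` E"
  unfolding image_image by (rule image_cong) (use pieceD(1,8) in \<open>auto simp: loc_def\<close>)

text \<open>The Jacobian is the determinant in the charts times the quotient of the area densities.
  The source density cancels against the one in the area measure of \<open>M\<close>, and the change
  of variables formula turns the rest into the area of the image.\<close>

lemma piece_area_formula: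
  assumes E: "E \<in> sets M.borel_sets" "E \<subseteq> U" and inj: "inj_on \<phi> E"
  shows "\<phi> ` E \<in> sets (area_measure N)"
    "(\<integral>\<^sup>+q. ennreal \<bar>jacobian M N \<phi> q\<bar> * indicator E q \<partial>area_measure M) = emeasure (area_measure N) (\<phi> ` E)"
proof -
  let ?G = "E \<inter> regular c d U"
  let ?S = "coord c ` ?G"
  have Ec: "E \<subseteq> dom_of c" using E(2) pieceD(4) by blast
  have S: "?S \<in> sets lebesgue" by (rule regular_image_lebesgue[OF E])
  have im: "loc c d ` ?S = coord d ` \<phi> ` ?G" by (rule piece_loc_image) (use E(2) in auto)
  have Gd: "\<phi> ` ?G \<subseteq> dom_of d" using regular_dom by blast
  have der: "(loc c d has_derivative dloc c d x) (at x within ?S)" if "x \<in> ?S" for x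
    using that regular_derivative(1) has_derivative_at_withinI by blast
  have injS: "inj_on (loc c d) ?S"
  proof (rule inj_onI)
    fix x y assume xy: "x \<in> ?S" "y \<in> ?S" "loc c d x = loc c d y"
    then obtain p q where pq: "p \<in> ?G" "q \<in> ?G" "x = coord c p" "y = coord c q" by blast
    then have "p \<in> dom_of c" "q \<in> dom_of c" "\<phi> p \<in> dom_of d" "\<phi> q \<in> dom_of d" using regular_dom by blast+
    then have "\<phi> p = \<phi> q"
      using xy(3) pq pieceD(1) inj_onD[OF N.inj_coord[OF pieceD(2)], of "\<phi> p" "\<phi> q"] by (simp add: loc_def)
    then have "p = q" using inj_onD[OF inj] pq by blast
    then show "x = y" using pq by simp
  qed
  have Sd: "loc c d ` ?S \<in> sets lebesgue"
    by (rule lebesgue_measurable_differentiable_image[OF S]) (use der in \<open>auto simp: differentiable_on_def differentiable_def\<close>)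
  have Sp: "loc c d ` ?S \<subseteq> N.patch d" unfolding im using Gd by blast
  have ci: "chart_inv d ` loc c d ` ?S = \<phi> ` ?G" unfolding im by (rule N.chart_inv_image[OF pieceD(2) Gd])
  note N1 = N.emeasure_chart_inv_image[OF pieceD(2) Sd Sp, unfolded ci]
  have eq: "\<phi> ` E = \<phi> ` ?G \<union> \<phi> ` (E - regular c d U)" by blast
  note null = irregular_image_null[OF E(2)]
  show "\<phi> ` E \<in> sets (area_measure N)" unfolding eq using N1(1) null by auto
  have meas: "emeasure (area_measure N) (\<phi> ` E) = emeasure (area_measure N) (\<phi> ` ?G)"
    unfolding eq by (rule emeasure_Un_null_set[OF N1(1) null])
  obtain \<Psi> where \<Psi>: "\<Psi> \<in> borel_measurable lebesgue" "\<And>q. q \<in> regular c d U \<Longrightarrow> \<Psi> (coord c q) = ennreal \<bar>jacobian M N \<phi> q\<bar>"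
    by (rule jacobian_in_chart) (rule that)
  have "(\<integral>\<^sup>+q. ennreal \<bar>jacobian M N \<phi> q\<bar> * indicator E q \<partial>area_measure M) = (\<integral>\<^sup>+q. \<Psi> (coord c q) * indicator E q \<partial>area_measure M)"
    by (rule nn_integral_cong_AE) (use AE_regular in \<open>eventually_elim, use E(2) \<Psi>(2) in \<open>auto simp: indicator_def\<close>\<close>)
  also have "\<dots> = (\<integral>\<^sup>+x. ennreal (M.density_in c x) * \<Psi> x * indicator (coord c ` E) x \<partial>lborel)"
    by (rule M.nn_integral_chart_function[OF pieceD(1) E(1) Ec \<Psi>(1)])
  also have "\<dots> = (\<integral>\<^sup>+x. ennreal (\<bar>det (matrix (dloc c d x))\<bar> * N.density_in d (loc c d x)) * indicator ?S x \<partial>lebesgue)"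
    unfolding nn_integral_completion[symmetric, of lborel]
  proof (rule nn_integral_cong_AE)
    have "negligible (coord c ` (E - regular c d U))"
      by (rule negligible_subset[OF negligible_irregular]) (use E(2) in auto)
    then have "AE x in lebesgue. x \<notin> coord c ` (E - regular c d U)"
      unfolding negligible_iff_null_sets by (rule AE_not_in)
    then show "AE x in lebesgue. ennreal (M.density_in c x) * \<Psi> x * indicator (coord c ` E) x =
       ennreal (\<bar>det (matrix (dloc c d x))\<bar> * N.density_in d (loc c d x)) * indicator ?S x"
    proof eventually_elim
      case (elim x)
      show ?case
      proof (cases "x \<in> coord c ` E")
        case True
        then obtain q where q: "q \<in> E" "q \<in> regular c d U" "x = coord c q" using elim by blast
        then have xS: "x \<in> ?S" by blast
        have pos: "M.density_in c x > 0" using q Ec pieceD(1) by (intro M.density_in_pos) auto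
        have nn: "0 \<le> N.density_in d (loc c d x)" by (rule N.density_in_nonneg[OF pieceD(2)])
        have "\<Psi> x = ennreal (\<bar>det (matrix (dloc c d x))\<bar> * N.density_in d (loc c d x) / M.density_in c x)"
          using \<Psi>(2)[OF q(2)] jacobian_regular[OF q(2)] pos nn by (simp add: q(3) abs_mult)
        then have "ennreal (M.density_in c x) * \<Psi> x = ennreal (M.density_in c x) * ennreal (\<bar>det (matrix (dloc c d x))\<bar> * N.density_in d (loc c d x) / M.density_in c x)"
          by (rule arg_cong)
        also have "\<dots> = ennreal (M.density_in c x * (\<bar>det (matrix (dloc c d x))\<bar> * N.density_in d (loc c d x) / M.density_in c x))"
          by (rule ennreal_mult'[symmetric]) (use pos in simp)
        also have "M.density_in c x * (\<bar>det (matrix (dloc c d x))\<bar> * N.density_in d (loc c d x) / M.density_in c x) = \<bar>det (matrix (dloc c d x))\<bar> * N.density_in d (loc c d x)"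
          using pos by simp
        finally show ?thesis using True xS by simp
      next
        case False
        then have "x \<notin> ?S" by blast
        then show ?thesis using False by simp
      qed
    qed
  qed
  also have "\<dots> = (\<integral>\<^sup>+y. ennreal (N.density_in d y) * indicator (loc c d ` ?S) y \<partial>lborel)"
    unfolding nn_integral_completion
    by (rule nn_integral_change_of_variables[OF S der injS N.density_in_measurable[OF pieceD(2)] N.density_in_nonneg[OF pieceD(2)]])
  also have "\<dots> = emeasure (area_measure N) (\<phi> ` E)" unfolding meas by (rule N1(2)[symmetric])
  finally show "(\<integral>\<^sup>+q. ennreal \<bar>jacobian M N \<phi> q\<bar> * indicator E q \<partial>area_measure M) = emeasure (area_measure N) (\<phi> ` E)" .
qed

text \<open>This handles the points whose values are attained several times: by
  \<open>negligible_image_imp_det_zero\<close> the derivative is singular almost everywhere on a set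
  with negligible image.\<close>

lemma piece_jacobian_zero:
  assumes E: "E \<subseteq> U" and null: "\<phi> ` E \<in> null_sets (area_measure N)"
  shows "AE q in area_measure M. q \<in> E \<longrightarrow> jacobian M N \<phi> q = 0"
proof -
  let ?G = "E \<inter> regular c d U"
  let ?S = "coord c ` ?G"
  have Ed: "\<phi> ` E \<subseteq> dom_of d" using E pieceD(5) by blast
  have "negligible (coord d ` \<phi> ` E)" using null N.null_area_iff_negligible[OF pieceD(2) Ed] by blast
  moreover have "loc c d ` ?S \<subseteq> coord d ` \<phi> ` E"
    using piece_loc_image[of ?G] E by auto
  ultimately have "negligible (loc c d ` ?S)" by (rule negligible_subset)
  moreover have "(loc c d has_derivative dloc c d x) (at x within ?S)" if "x \<in> ?S" for x
    using that regular_derivative(1) has_derivative_at_withinI by blast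
  ultimately have "negligible {x\<in>?S. det (matrix (dloc c d x)) \<noteq> 0}" by (intro negligible_image_imp_det_zero)
  from M.AE_chart[OF pieceD(1) this] AE_regular show ?thesis
  proof eventually_elim
    case (elim q)
    show ?case
    proof
      assume q: "q \<in> E"
      then have r: "q \<in> regular c d U" "q \<in> dom_of c" using elim E pieceD(8) by auto
      then have "coord c q \<in> ?S" using q by blast
      then have "det (matrix (dloc c d (coord c q))) = 0" using elim r by blast
      then show "jacobian M N \<phi> q = 0" using jacobian_regular[OF r(1)] by simp
    qed
  qed
qed

end

end

section \<open>The area formula and the energy\<close>

lemma sum_indicator_partition:
  fixes D :: "nat \<Rightarrow> 'a set"
  assumes "disjoint_family_on D {..<n}" "q \<in> (\<Union>i<n. D i)"
  shows "(\<Sum>i<n. indicator (D i) q :: ennreal) = 1"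
proof -
  obtain i where i: "i < n" "q \<in> D i" using assms(2) by auto
  have "(\<Sum>j<n. indicator (D j) q :: ennreal) = (\<Sum>j<n. if j = i then 1 else 0)"
  proof (rule sum.cong)
    fix j assume j: "j \<in> {..<n}"
    show "indicator (D j) q = (if j = i then 1 else 0 :: ennreal)"
    proof (cases "j = i")
      case False
      then have "D j \<inter> D i = {}" using assms(1) i j unfolding disjoint_family_on_def by simp
      then show ?thesis using i False by (auto simp: indicator_def)
    qed (use i in simp)
  qed simp
  also have "\<dots> = 1" using i by simp
  finally show ?thesis .
qed

context surface_map
begin

lemma pieces:
  obtains n :: nat and c d U L K D where "\<And>i. i < n \<Longrightarrow> piece (c i) (d i) (U i) (L i) (K i)"
    "\<And>i. i < n \<Longrightarrow> D i \<in> sets M.borel_sets" "\<And>i. i < n \<Longrightarrow> D i \<subseteq> U i"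
    "disjoint_family_on D {..<n}" "(\<Union>i<n. D i) = points M"
proof -
  obtain n :: nat and U D where "\<And>i. i < n \<Longrightarrow> openin (surface_top M) (U i)"
    and *: "\<And>i. i < n \<Longrightarrow> \<exists>c d L K. piece c d (U i) L K"
    "\<And>i. i < n \<Longrightarrow> D i \<in> sets M.borel_sets" "\<And>i. i < n \<Longrightarrow> D i \<subseteq> U i"
    "disjoint_family_on D {..<n}" "(\<Union>i<n. D i) = points M"
    by (rule M.compact_borel_partition[where Q="\<lambda>U. \<exists>c d L K. piece c d U L K"])
      (erule piece_exists, rule that)
  from *(1) have "\<forall>i. \<exists>c d L K. i < n \<longrightarrow> piece c d (U i) L K" by blast
  then obtain c d L K where "\<And>i. i < n \<Longrightarrow> piece (c i) (d i) (U i) (L i) (K i)" by metis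
  then show thesis using that[of n c d U L K D] * by blast
qed

lemma jacobian_measurable: "(\<lambda>q. ennreal \<bar>jacobian M N \<phi> q\<bar>) \<in> borel_measurable (area_measure M)"
  and dnorm_sq_measurable: "(\<lambda>q. ennreal (dnorm_sq q)) \<in> borel_measurable (area_measure M)"
proof -
  obtain n :: nat and c d U L K D where P: "\<And>i. i < n \<Longrightarrow> piece (c i) (d i) (U i) (L i) (K i)"
    and D: "\<And>i. i < n \<Longrightarrow> D i \<in> sets M.borel_sets" "\<And>i. i < n \<Longrightarrow> D i \<subseteq> U i"
    "disjoint_family_on D {..<n}" "(\<Union>i<n. D i) = points M"
    by (rule pieces) (rule that)
  have *: "f \<in> borel_measurable (area_measure M)"
    if f: "\<And>i. i < n \<Longrightarrow> (\<lambda>q. f q * indicator (D i) q) \<in> borel_measurable (area_measure M)" for f :: "'a \<Rightarrow> ennreal"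
  proof -
    have sum: "(\<lambda>q. \<Sum>i<n. f q * indicator (D i) q) \<in> borel_measurable (area_measure M)"
      by (rule borel_measurable_sum) (use f in simp)
    have eq: "(\<Sum>i<n. f q * indicator (D i) q) = f q" if "q \<in> space (area_measure M)" for q
    proof -
      have "q \<in> (\<Union>i<n. D i)" using that D(4) by simp
      then show ?thesis by (simp only: sum_distrib_left[symmetric] sum_indicator_partition[OF D(3)] mult_1_right)
    qed
    show ?thesis by (rule iffD1[OF measurable_cong[OF eq] sum])
  qed
  show "(\<lambda>q. ennreal \<bar>jacobian M N \<phi> q\<bar>) \<in> borel_measurable (area_measure M)"
    by (rule *) (rule piece_measurable(1)[OF P D(1,2)])
  show "(\<lambda>q. ennreal (dnorm_sq q)) \<in> borel_measurable (area_measure M)"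
    by (rule *) (rule piece_measurable(2)[OF P D(1,2)])
qed

lemma dnorm_sq_bounded: obtains K where "AE q in area_measure M. dnorm_sq q \<le> K"
proof -
  obtain n :: nat and c d U L K D where P: "\<And>i. i < n \<Longrightarrow> piece (c i) (d i) (U i) (L i) (K i)"
    and D: "\<And>i. i < n \<Longrightarrow> D i \<in> sets M.borel_sets" "\<And>i. i < n \<Longrightarrow> D i \<subseteq> U i"
    "disjoint_family_on D {..<n}" "(\<Union>i<n. D i) = points M"
    by (rule pieces) (rule that)
  have "AE q in area_measure M. \<forall>i\<in>{..<n}. q \<in> U i \<longrightarrow> q \<in> regular (c i) (d i) (U i)"
    by (rule AE_finite_allI) (auto intro: AE_regular[OF P])
  then have "AE q in area_measure M. dnorm_sq q \<le> (\<Sum>i<n. \<bar>K i\<bar>)"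
    using AE_space
  proof eventually_elim
    case (elim q)
    then obtain i where i: "i < n" "q \<in> D i" using D(4) by auto
    then have "q \<in> regular (c i) (d i) (U i)" using elim(1) D(2) by auto
    then have "dnorm_sq q \<le> K i" by (rule dnorm_sq_regular(2)[OF P[OF i(1)]])
    also have "\<dots> \<le> \<bar>K i\<bar>" by simp
    also have "\<dots> \<le> (\<Sum>i<n. \<bar>K i\<bar>)" using i by (intro member_le_sum) auto
    finally show ?case .
  qed
  then show thesis by (rule that)
qed

text \<open>The values attained more than once lie in a null set \<open>Z\<close>. Off its preimage
  the map is injective and \<open>piece_area_formula\<close> applies; on the preimage, which may
  have positive area, \<open>piece_jacobian_zero\<close> makes the integrand vanish.\<close>

theorem area_formula:
  assumes inj: "AE q in area_measure N. finite {p\<in>points M. \<phi> p = q} \<and> card {p\<in>points M. \<phi> p = q} \<le> 1"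
  shows "\<phi> ` points M \<in> sets (area_measure N)"
    and "(\<integral>\<^sup>+q. ennreal \<bar>jacobian M N \<phi> q\<bar> \<partial>area_measure M) = emeasure (area_measure N) (\<phi> ` points M)"
proof -
  let ?P = "\<lambda>q. finite {p\<in>points M. \<phi> p = q} \<and> card {p\<in>points M. \<phi> p = q} \<le> 1"
  obtain Z0 where Z0: "{q\<in>space (area_measure N). \<not> ?P q} \<subseteq> Z0" "Z0 \<in> null_sets (area_measure N)"
    using inj unfolding eventually_ae_filter by blast
  \<comment> \<open>A Borel null set is taken, so that its preimage under \<open>\<phi>\<close> is
    Borel and can be intersected with the pieces.\<close>
  then obtain Z where Z: "Z \<in> null_sets (borel_area_measure N)" "Z0 \<subseteq> Z"
    unfolding area_measure_def null_sets_completion_iff2 by blast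
  have ZP: "?P q" if "q \<in> points N" "q \<notin> Z" for q
    using that Z0(1) Z(2) by auto
  have Zn: "T \<in> null_sets (area_measure N)" if "T \<subseteq> Z" for T
    unfolding area_measure_def null_sets_completion_iff2 using Z(1) that by blast
  define X0 where "X0 = {p\<in>points M. \<phi> p \<notin> Z}"
  have X0: "X0 \<in> sets M.borel_sets"
  proof -
    have "Z \<in> sets N.borel_sets" using Z(1) N.sets_borel_area_measure by auto
    then have "space M.borel_sets - (\<phi> -` Z \<inter> space M.borel_sets) \<in> sets M.borel_sets"
      using measurable_sets[OF \<phi>_measurable] by blast
    moreover have "space M.borel_sets - (\<phi> -` Z \<inter> space M.borel_sets) = X0" by (auto simp: X0_def)
    ultimately show ?thesis by simp
  qed
  \<comment> \<open>At most one preimage over each point outside \<open>Z\<close> is exactly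
    injectivity on \<open>X0\<close>.\<close>
  have injX: "inj_on \<phi> X0"
  proof (rule inj_onI)
    fix p1 p2 assume p: "p1 \<in> X0" "p2 \<in> X0" "\<phi> p1 = \<phi> p2"
    then have "?P (\<phi> p1)" using \<phi>_points by (intro ZP) (auto simp: X0_def)
    moreover have "p1 \<in> {p\<in>points M. \<phi> p = \<phi> p1}" "p2 \<in> {p\<in>points M. \<phi> p = \<phi> p1}" using p by (auto simp: X0_def)
    ultimately show "p1 = p2" by (metis (no_types, lifting) One_nat_def card_le_Suc0_iff_eq)
  qed
  obtain n :: nat and c d U L K D where P: "\<And>i. i < n \<Longrightarrow> piece (c i) (d i) (U i) (L i) (K i)"
    and D: "\<And>i. i < n \<Longrightarrow> D i \<in> sets M.borel_sets" "\<And>i. i < n \<Longrightarrow> D i \<subseteq> U i"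
    "disjoint_family_on D {..<n}" "(\<Union>i<n. D i) = points M"
    by (rule pieces) (rule that)
  have A: "D i \<inter> X0 \<in> sets M.borel_sets" "D i \<inter> X0 \<subseteq> U i" and B: "D i - X0 \<in> sets M.borel_sets" "D i - X0 \<subseteq> U i"
    if "i < n" for i using D(1,2)[OF that] X0 by auto
  let ?J = "\<lambda>q. ennreal \<bar>jacobian M N \<phi> q\<bar>"
  have af: "\<phi> ` (D i \<inter> X0) \<in> sets (area_measure N)"
    "(\<integral>\<^sup>+q. ?J q * indicator (D i \<inter> X0) q \<partial>area_measure M) = emeasure (area_measure N) (\<phi> ` (D i \<inter> X0))"
    if "i < n" for i
    using piece_area_formula[OF P[OF that] A[OF that] inj_on_subset[OF injX]] by auto
  have zero: "(\<integral>\<^sup>+q. ?J q * indicator (D i - X0) q \<partial>area_measure M) = 0" if i: "i < n" for i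
  proof -
    have "\<phi> ` (D i - X0) \<in> null_sets (area_measure N)"
      by (rule Zn) (use D(4) i in \<open>auto simp: X0_def\<close>)
    from piece_jacobian_zero[OF P[OF i] B(2)[OF i] this]
    have "AE q in area_measure M. ?J q * indicator (D i - X0) q = 0"
      by eventually_elim (auto simp: indicator_def)
    then have "(\<integral>\<^sup>+q. ?J q * indicator (D i - X0) q \<partial>area_measure M) = (\<integral>\<^sup>+q. 0 \<partial>area_measure M)"
      by (rule nn_integral_cong_AE)
    then show ?thesis by simp
  qed
  have split: "?J q = (\<Sum>i<n. ?J q * indicator (D i \<inter> X0) q + ?J q * indicator (D i - X0) q)"
    if "q \<in> space (area_measure M)" for q
  proof -
    have "q \<in> (\<Union>i<n. D i)" using that D(4) by simp
    then have "?J q = (\<Sum>i<n. ?J q * indicator (D i) q)"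
      by (simp only: sum_distrib_left[symmetric] sum_indicator_partition[OF D(3)] mult_1_right)
    also have "\<dots> = (\<Sum>i<n. ?J q * indicator (D i \<inter> X0) q + ?J q * indicator (D i - X0) q)"
      by (rule sum.cong) (auto simp: indicator_def)
    finally show ?thesis .
  qed
  have image: "(\<Union>i<n. \<phi> ` (D i \<inter> X0)) = \<phi> ` X0"
  proof -
    have "(\<Union>i<n. \<phi> ` (D i \<inter> X0)) = \<phi> ` ((\<Union>i<n. D i) \<inter> X0)" by blast
    moreover have "points M \<inter> X0 = X0" by (auto simp: X0_def)
    ultimately show ?thesis unfolding D(4) by simp
  qed
  have X0s: "\<phi> ` X0 \<in> sets (area_measure N)" unfolding image[symmetric] using af(1) by auto
  have eq: "\<phi> ` points M = \<phi> ` X0 \<union> \<phi> ` (points M - X0)" by (auto simp: X0_def)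
  have null: "\<phi> ` (points M - X0) \<in> null_sets (area_measure N)" by (rule Zn) (auto simp: X0_def)
  show "\<phi> ` points M \<in> sets (area_measure N)" unfolding eq using X0s null by auto
  have "(\<integral>\<^sup>+q. ?J q \<partial>area_measure M) =
     (\<integral>\<^sup>+q. (\<Sum>i<n. ?J q * indicator (D i \<inter> X0) q + ?J q * indicator (D i - X0) q) \<partial>area_measure M)"
    by (rule nn_integral_cong) (rule split)
  also have "\<dots> = (\<Sum>i<n. \<integral>\<^sup>+q. (?J q * indicator (D i \<inter> X0) q + ?J q * indicator (D i - X0) q) \<partial>area_measure M)"
  proof (rule nn_integral_sum)
    fix i assume "i \<in> {..<n}"
    then have i: "i < n" by simp
    show "(\<lambda>q. ?J q * indicator (D i \<inter> X0) q + ?J q * indicator (D i - X0) q) \<in> borel_measurable (area_measure M)"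
      by (intro borel_measurable_add piece_measurable(1)[OF P[OF i] A[OF i]] piece_measurable(1)[OF P[OF i] B[OF i]])
  qed
  also have "\<dots> = (\<Sum>i<n. emeasure (area_measure N) (\<phi> ` (D i \<inter> X0)))"
  proof (rule sum.cong)
    fix i assume "i \<in> {..<n}"
    then have i: "i < n" by simp
    have "(\<integral>\<^sup>+q. (?J q * indicator (D i \<inter> X0) q + ?J q * indicator (D i - X0) q) \<partial>area_measure M) =
       (\<integral>\<^sup>+q. ?J q * indicator (D i \<inter> X0) q \<partial>area_measure M) + (\<integral>\<^sup>+q. ?J q * indicator (D i - X0) q \<partial>area_measure M)"
      by (rule nn_integral_add) (rule piece_measurable(1)[OF P[OF i] A[OF i]], rule piece_measurable(1)[OF P[OF i] B[OF i]])
    then show "(\<integral>\<^sup>+q. (?J q * indicator (D i \<inter> X0) q + ?J q * indicator (D i - X0) q) \<partial>area_measure M) = emeasure (area_measure N) (\<phi> ` (D i \<inter> X0))"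
      using af(2)[OF i] zero[OF i] by simp
  qed simp
  also have "\<dots> = emeasure (area_measure N) (\<phi> ` X0)"
    unfolding image[symmetric]
  proof (rule sum_emeasure)
    show "(\<lambda>i. \<phi> ` (D i \<inter> X0)) ` {..<n} \<subseteq> sets (area_measure N)" using af(1) by auto
    show "disjoint_family_on (\<lambda>i. \<phi> ` (D i \<inter> X0)) {..<n}"
      unfolding disjoint_family_on_def
    proof (intro ballI impI)
      fix i j assume ij: "i \<in> {..<n}" "j \<in> {..<n}" "i \<noteq> j"
      then have "(D i \<inter> X0) \<inter> (D j \<inter> X0) = {}" using D(3) unfolding disjoint_family_on_def by blast
      then show "\<phi> ` (D i \<inter> X0) \<inter> \<phi> ` (D j \<inter> X0) = {}"
        using inj_on_image_Int[OF injX, of "D i \<inter> X0" "D j \<inter> X0"] by simp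
    qed
  qed simp
  also have "\<dots> = emeasure (area_measure N) (\<phi> ` points M)"
    unfolding eq by (rule emeasure_Un_null_set[OF X0s null, symmetric])
  finally show "(\<integral>\<^sup>+q. ?J q \<partial>area_measure M) = emeasure (area_measure N) (\<phi> ` points M)" .
qed

text \<open>\<open>I\<close> is the integral of \<open>(s - 1)\<^sup>2\<close>, the part of the
  energy density that is comparable to the squared distance to \<open>K\<close>; the Jacobian part
  integrates to the area of the image. Integrability is established for each term, since otherwise
  the Bochner integrals could neither be split nor compared.\<close>

theorem energy_identity:
  assumes pos: "AE p in area_measure M. 0 \<le> jacobian M N \<phi> p"
    and inj: "AE q in area_measure N. finite {p\<in>points M. \<phi> p = q} \<and> card {p\<in>points M. \<phi> p = q} \<le> 1"
  obtains I where "E2 M N \<phi> = I / total_area M + 1 - 2 * area N (\<phi> ` points M) / total_area M"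
    "(\<integral>p. (dist_K M N \<phi> p)\<^sup>2 \<partial>area_measure M) \<le> I" "I \<le> 2 * (\<integral>p. (dist_K M N \<phi> p)\<^sup>2 \<partial>area_measure M)"
    "area N (\<phi> ` points M) \<le> total_area N"
proof -
  interpret fM: finite_measure "area_measure M" by (rule M.finite_area_measure)
  interpret fN: finite_measure "area_measure N" by (rule N.finite_area_measure)
  let ?J = "jacobian M N \<phi>"
  define s where "s q = sqrt (dnorm_sq q + 2 * ?J q)" for q
  define t where "t q = sqrt (dnorm_sq q - 2 * ?J q)" for q
  have nn: "0 \<le> dnorm_sq q + 2 * ?J q" "0 \<le> dnorm_sq q - 2 * ?J q" if "q \<in> points M" for q
    using hom_norm_sq_plus_det_nonneg[OF inner_metric_at(1)[OF that] inner_metric_at(2)[OF \<phi>_points[OF that]] linear_differential]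
    by (simp_all add: dnorm_sq_def jacobian_def)
  have SO: "(dist_SO M N \<phi> q)\<^sup>2 = (s q - 1)\<^sup>2 + 1 - 2 * ?J q" if "q \<in> points M" for q
    using hom_setdist_SO[OF inner_metric_at(1)[OF that] inner_metric_at(2)[OF \<phi>_points[OF that]] linear_differential]
    by (simp add: dist_SO_def Let_def s_def dnorm_sq_def jacobian_def)
  have KK: "(dist_K M N \<phi> q)\<^sup>2 = (s q - 1)\<^sup>2 / 2 + (max (t q - 1) 0)\<^sup>2 / 2" if "q \<in> points M" for q
    using hom_setdist_K[OF inner_metric_at(1)[OF that] inner_metric_at(2)[OF \<phi>_points[OF that]] linear_differential]
    by (simp add: dist_K_def Let_def s_def t_def dnorm_sq_def jacobian_def)
  have KB: "(dist_K M N \<phi> q)\<^sup>2 \<le> (s q - 1)\<^sup>2" "(s q - 1)\<^sup>2 \<le> 2 * (dist_K M N \<phi> q)\<^sup>2" if "q \<in> points M" "0 \<le> ?J q" for q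
    using hom_setdist_K_bounds[OF inner_metric_at(1)[OF that(1)] inner_metric_at(2)[OF \<phi>_points[OF that(1)]] linear_differential] that(2)
    by (simp_all add: dist_K_def Let_def s_def dnorm_sq_def jacobian_def)
  \<comment> \<open>So far only the absolute value of the Jacobian is known to be measurable; it
    agrees with the Jacobian almost everywhere, and the measure is complete.\<close>
  have Jm [measurable]: "?J \<in> borel_measurable (area_measure M)"
  proof -
    have 1: "(\<lambda>q. enn2real (ennreal \<bar>?J q\<bar>)) \<in> borel_measurable (area_measure M)"
      using jacobian_measurable by measurable
    have "AE q in area_measure M. enn2real (ennreal \<bar>?J q\<bar>) = ?J q" using pos by eventually_elim simp
    with 1 show ?thesis
      unfolding area_measure_def by (rule borel_measurable_completion_AE)
  qed
  have nm [measurable]: "dnorm_sq \<in> borel_measurable (area_measure M)"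
  proof -
    have "(\<lambda>q. enn2real (ennreal (dnorm_sq q))) \<in> borel_measurable (area_measure M)"
      using dnorm_sq_measurable by measurable
    moreover have "enn2real (ennreal (dnorm_sq q)) = dnorm_sq q" if "q \<in> space (area_measure M)" for q
      using nn[of q] that by simp
    ultimately show ?thesis by (subst measurable_cong[symmetric]) auto
  qed
  have sm [measurable]: "s \<in> borel_measurable (area_measure M)" unfolding s_def by measurable
  have tm [measurable]: "t \<in> borel_measurable (area_measure M)" unfolding t_def by measurable
  \<comment> \<open>The infimum over \<open>K\<close> is not visibly measurable; its closed form in
    terms of \<open>s\<close> and \<open>t\<close> is.\<close>
  have Km: "(\<lambda>q. (dist_K M N \<phi> q)\<^sup>2) \<in> borel_measurable (area_measure M)"
  proof -
    have "(\<lambda>q. (s q - 1)\<^sup>2 / 2 + (max (t q - 1) 0)\<^sup>2 / 2) \<in> borel_measurable (area_measure M)" by measurable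
    then show ?thesis by (subst measurable_cong[OF KK]) auto
  qed
  obtain K where K: "AE q in area_measure M. dnorm_sq q \<le> K" by (rule dnorm_sq_bounded)
  have Jint: "integrable (area_measure M) ?J"
  proof (rule fM.integrable_const_bound[of _ "K / 2"])
    \<comment> \<open>The two inequalities \<open>nn\<close> say that twice the absolute value of
      the Jacobian is at most the squared norm of the differential.\<close>
    show "AE q in area_measure M. norm (?J q) \<le> K / 2"
      using K AE_space
    proof eventually_elim
      case (elim q)
      then show ?case using nn[of q] by (auto simp: abs_le_iff)
    qed
  qed measurable
  have sint: "integrable (area_measure M) (\<lambda>q. (s q - 1)\<^sup>2)"
  proof (rule fM.integrable_const_bound[of _ "2 * (2 * K + 1)"])
    show "AE q in area_measure M. norm ((s q - 1)\<^sup>2) \<le> 2 * (2 * K + 1)"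
      using K AE_space
    proof eventually_elim
      case (elim q)
      then have "(s q)\<^sup>2 = dnorm_sq q + 2 * ?J q" using nn(1)[of q] by (simp add: s_def)
      also have "\<dots> \<le> 2 * K" using elim nn(2)[of q] by simp
      finally have "(s q)\<^sup>2 \<le> 2 * K" .
      moreover have "(s q - 1)\<^sup>2 \<le> 2 * ((s q)\<^sup>2 + 1)"
        using zero_le_power2[of "s q + 1"] by (simp add: power2_eq_square algebra_simps)
      ultimately show ?case by simp
    qed
  qed measurable
  have Kint: "integrable (area_measure M) (\<lambda>q. (dist_K M N \<phi> q)\<^sup>2)"
  proof (rule Bochner_Integration.integrable_bound[OF sint Km])
    show "AE q in area_measure M. norm ((dist_K M N \<phi> q)\<^sup>2) \<le> norm ((s q - 1)\<^sup>2)"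
      using pos AE_space by eventually_elim (use KB(1) in simp)
  qed
  define I where "I = (\<integral>q. (s q - 1)\<^sup>2 \<partial>area_measure M)"
  have Jarea: "(\<integral>q. ?J q \<partial>area_measure M) = area N (\<phi> ` points M)"
  proof -
    have "(\<integral>q. ?J q \<partial>area_measure M) = enn2real (\<integral>\<^sup>+q. ennreal (?J q) \<partial>area_measure M)"
      by (rule integral_eq_nn_integral[OF Jm pos])
    also have "(\<integral>\<^sup>+q. ennreal (?J q) \<partial>area_measure M) = (\<integral>\<^sup>+q. ennreal \<bar>?J q\<bar> \<partial>area_measure M)"
      by (rule nn_integral_cong_AE) (use pos in \<open>eventually_elim, simp\<close>)
    also have "\<dots> = emeasure (area_measure N) (\<phi> ` points M)" by (rule area_formula(2)[OF inj])
    finally show ?thesis by (simp add: area_def measure_def)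
  qed
  have V: "total_area M > 0" by (rule M.total_area_pos)
  have SOint: "(\<integral>p. (dist_SO M N \<phi> p)\<^sup>2 \<partial>area_measure M) = I + total_area M - 2 * area N (\<phi> ` points M)"
  proof -
    have "(\<integral>p. (dist_SO M N \<phi> p)\<^sup>2 \<partial>area_measure M) = (\<integral>p. (s p - 1)\<^sup>2 + 1 - 2 * ?J p \<partial>area_measure M)"
      by (rule Bochner_Integration.integral_cong) (simp_all add: SO)
    also have "\<dots> = I + total_area M - 2 * area N (\<phi> ` points M)"
      using sint Jint by (simp add: I_def Jarea area_def)
    finally show ?thesis .
  qed
  have E: "E2 M N \<phi> = I / total_area M + 1 - 2 * area N (\<phi> ` points M) / total_area M"
    unfolding E2_def SOint using V by (simp add: diff_divide_distrib add_divide_distrib)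
  have "(\<integral>p. (dist_K M N \<phi> p)\<^sup>2 \<partial>area_measure M) \<le> I"
    unfolding I_def by (rule integral_mono_AE[OF Kint sint]) (use pos AE_space in \<open>eventually_elim, use KB(1) in simp\<close>)
  moreover have "I \<le> (\<integral>p. 2 * (dist_K M N \<phi> p)\<^sup>2 \<partial>area_measure M)"
    unfolding I_def
    by (rule integral_mono_AE[OF sint integrable_mult_right[OF Kint]]) (use pos AE_space in \<open>eventually_elim, use KB(2) in simp\<close>)
  then have "I \<le> 2 * (\<integral>p. (dist_K M N \<phi> p)\<^sup>2 \<partial>area_measure M)" by simp
  moreover have "area N (\<phi> ` points M) \<le> total_area N"
    unfolding area_def
    by (rule fN.finite_measure_mono) (use \<phi>_points N.borel_sets_area_measure[OF sets.top[of N.borel_sets]] in auto)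
  ultimately show thesis using E that by blast
qed

end

text \<open>The excess of the energy is squeezed between two positive combinations of the
  nonnegative quantities \<open>k n\<close> and \<open>A - a n\<close>, so it tends to 0 iff both of
  them do. The square root of \<open>k n\<close> will be the L2 norm of the distance to
  \<open>K\<close>.\<close>

lemma excess_tendsto_iff:
  fixes e a k :: "nat \<Rightarrow> real"
  assumes V: "V > 0" and a: "\<And>n. a n \<le> A" and k: "\<And>n. 0 \<le> k n"
    and lo: "\<And>n. 1 / V * k n + 2 * (A - a n) / V \<le> e n - f" and hi: "\<And>n. e n - f \<le> 2 / V * k n + 2 * (A - a n) / V"
  shows "e \<longlonglongrightarrow> f \<longleftrightarrow> a \<longlonglongrightarrow> A \<and> (\<lambda>n. sqrt (k n)) \<longlonglongrightarrow> 0"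
proof
  assume "e \<longlonglongrightarrow> f"
  then have "(\<lambda>n. V * (e n - f)) \<longlonglongrightarrow> V * (f - f)" by (intro tendsto_intros)
  then have lim: "(\<lambda>n. V * (e n - f)) \<longlonglongrightarrow> 0" by simp
  have le: "k n + 2 * (A - a n) \<le> V * (e n - f)" for n
  proof -
    have "k n + 2 * (A - a n) = V * (1 / V * k n + 2 * (A - a n) / V)" using V by (simp add: distrib_left)
    also have "\<dots> \<le> V * (e n - f)" using lo[of n] V by (intro mult_left_mono) auto
    finally show ?thesis .
  qed
  have k0: "k \<longlonglongrightarrow> 0"
    by (rule tendsto_sandwich[OF _ _ tendsto_const lim]) (use k le a in \<open>auto intro!: always_eventually order_trans[OF _ le]\<close>)
  then have "(\<lambda>n. sqrt (k n)) \<longlonglongrightarrow> sqrt 0" by (rule tendsto_real_sqrt)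
  moreover have "(\<lambda>n. A - a n) \<longlonglongrightarrow> 0"
  proof (rule tendsto_sandwich[OF _ _ tendsto_const lim])
    have "A - a n \<le> k n + 2 * (A - a n)" for n using k[of n] a[of n] by (simp add: add_nonneg_nonneg)
    then have "A - a n \<le> V * (e n - f)" for n using le[of n] order_trans by blast
    then show "\<forall>\<^sub>F n in sequentially. A - a n \<le> V * (e n - f)" by simp
  qed (use a in simp)
  then have "(\<lambda>n. A - (A - a n)) \<longlonglongrightarrow> A - 0" by (intro tendsto_intros)
  ultimately show "a \<longlonglongrightarrow> A \<and> (\<lambda>n. sqrt (k n)) \<longlonglongrightarrow> 0" by simp
next
  assume *: "a \<longlonglongrightarrow> A \<and> (\<lambda>n. sqrt (k n)) \<longlonglongrightarrow> 0"
  then have "(\<lambda>n. (sqrt (k n))\<^sup>2) \<longlonglongrightarrow> 0\<^sup>2" by (intro tendsto_intros) simp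
  then have "k \<longlonglongrightarrow> 0" using k by simp
  then have "(\<lambda>n. 2 / V * k n + 2 * (A - a n) / V) \<longlonglongrightarrow> 2 / V * 0 + 2 * (A - A) / V"
    using * V by (intro tendsto_intros) auto
  then have lim: "(\<lambda>n. 2 / V * k n + 2 * (A - a n) / V) \<longlonglongrightarrow> 0" by simp
  have "(\<lambda>n. e n - f) \<longlonglongrightarrow> 0"
  proof (rule tendsto_sandwich[OF _ _ tendsto_const lim])
    have "0 \<le> e n - f" for n
    proof -
      have "0 \<le> 1 / V * k n + 2 * (A - a n) / V" using V k[of n] a[of n] by simp
      then show ?thesis using lo[of n] by linarith
    qed
    then show "\<forall>\<^sub>F n in sequentially. 0 \<le> e n - f" by simp
  qed (use hi in simp)
  then have "(\<lambda>n. (e n - f) + f) \<longlonglongrightarrow> 0 + f" by (intro tendsto_intros)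
  then show "e \<longlonglongrightarrow> f" by simp
qed

theorem theorem1p9:
  fixes M :: "'a surface" and N :: "'b surface"
  assumes M: "oriented_riemannian_surface M"
      "compact_space (surface_top M)" "connected_space (surface_top M)"
    and N: "oriented_riemannian_surface N"
      "compact_space (surface_top N)" "connected_space (surface_top N)"
    and area_le: "total_area N \<le> total_area M"
  shows
    "(\<forall>\<phi> \<in> Lip_inj_plus M N. area N (\<phi> ` points M) / total_area M \<le> 1/4 \<longrightarrow>
        1 / total_area M * (\<integral>p. (dist_K M N \<phi> p)\<^sup>2 \<partial>area_measure M)
          \<le> E2 M N \<phi> - F_fun (area N (\<phi> ` points M) / total_area M) \<and>
        E2 M N \<phi> - F_fun (area N (\<phi> ` points M) / total_area M)
          \<le> 2 / total_area M * (\<integral>p. (dist_K M N \<phi> p)\<^sup>2 \<partial>area_measure M))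
     \<and>
     (total_area N / total_area M \<le> 1/4 \<longrightarrow>
        (\<forall>\<phi> \<in> Lip_inj_plus M N.
           1 / total_area M * (\<integral>p. (dist_K M N \<phi> p)\<^sup>2 \<partial>area_measure M)
               + 2 * (total_area N - area N (\<phi> ` points M)) / total_area M
             \<le> E2 M N \<phi> - F_fun (total_area N / total_area M) \<and>
           E2 M N \<phi> - F_fun (total_area N / total_area M)
             \<le> 2 / total_area M * (\<integral>p. (dist_K M N \<phi> p)\<^sup>2 \<partial>area_measure M)
               + 2 * (total_area N - area N (\<phi> ` points M)) / total_area M) \<and>
        (\<forall>\<phi> :: nat \<Rightarrow> 'a \<Rightarrow> 'b. (\<forall>n. \<phi> n \<in> Lip_inj_plus M N) \<longrightarrow>
           ((\<lambda>n. E2 M N (\<phi> n)) \<longlonglongrightarrow> F_fun (total_area N / total_area M)) \<longleftrightarrow>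
           ((\<lambda>n. area N (\<phi> n ` points M)) \<longlonglongrightarrow> total_area N) \<and>
           ((\<lambda>n. L2_norm (area_measure M) (dist_K M N (\<phi> n))) \<longlonglongrightarrow> 0)))"
proof -
  interpret M: compact_surface M using M by unfold_locales
  interpret N: compact_surface N using N by unfold_locales
  have V: "total_area M > 0" by (rule M.total_area_pos)
  let ?k = "\<lambda>\<phi>. \<integral>p. (dist_K M N \<phi> p)\<^sup>2 \<partial>area_measure M"
  have core: "\<exists>I. E2 M N \<phi> = I / total_area M + 1 - 2 * area N (\<phi> ` points M) / total_area M \<and>
      ?k \<phi> / total_area M \<le> I / total_area M \<and> I / total_area M \<le> 2 * ?k \<phi> / total_area M \<and> area N (\<phi> ` points M) \<le> total_area N"
    if \<phi>: "\<phi> \<in> Lip_inj_plus M N" for \<phi>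
  proof -
    interpret surface_map M N \<phi>
      using \<phi> by unfold_locales (simp add: Lip_inj_plus_def)
    have pos: "AE p in area_measure M. 0 \<le> jacobian M N \<phi> p"
      and inj: "AE q in area_measure N. finite {p\<in>points M. \<phi> p = q} \<and> card {p\<in>points M. \<phi> p = q} \<le> 1"
      using \<phi> unfolding Lip_inj_plus_def by blast+
    obtain I where I: "E2 M N \<phi> = I / total_area M + 1 - 2 * area N (\<phi> ` points M) / total_area M"
      "?k \<phi> \<le> I" "I \<le> 2 * ?k \<phi>" "area N (\<phi> ` points M) \<le> total_area N"
      by (rule energy_identity[OF pos inj]) (rule that)
    then show ?thesis using V by (intro exI[of _ I] conjI divide_right_mono) auto
  qed
  \<comment> \<open>On this range F is affine and cancels the terms 1 - 2 t of the energy identity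
    exactly, so the difference is I divided by the total area.\<close>
  have part_a: "1 / total_area M * ?k \<phi> \<le> E2 M N \<phi> - F_fun (area N (\<phi> ` points M) / total_area M) \<and>
      E2 M N \<phi> - F_fun (area N (\<phi> ` points M) / total_area M) \<le> 2 / total_area M * ?k \<phi>"
    if "\<phi> \<in> Lip_inj_plus M N" "area N (\<phi> ` points M) / total_area M \<le> 1/4" for \<phi>
    using core[OF that(1)] that(2) by (auto simp: F_fun_def)
  \<comment> \<open>Now F is evaluated at the ratio of the total areas, and the affine formula
    leaves the area missed by the image as an extra term.\<close>
  have part_b: "1 / total_area M * ?k \<phi> + 2 * (total_area N - area N (\<phi> ` points M)) / total_area M
        \<le> E2 M N \<phi> - F_fun (total_area N / total_area M) \<and>
      E2 M N \<phi> - F_fun (total_area N / total_area M)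
        \<le> 2 / total_area M * ?k \<phi> + 2 * (total_area N - area N (\<phi> ` points M)) / total_area M"
    if "\<phi> \<in> Lip_inj_plus M N" "total_area N / total_area M \<le> 1/4" for \<phi>
    using core[OF that(1)] that(2) by (auto simp: F_fun_def diff_divide_distrib right_diff_distrib)
  have part_c: "((\<lambda>n. E2 M N (\<phi> n)) \<longlonglongrightarrow> F_fun (total_area N / total_area M)) \<longleftrightarrow>
      ((\<lambda>n. area N (\<phi> n ` points M)) \<longlonglongrightarrow> total_area N) \<and>
      ((\<lambda>n. L2_norm (area_measure M) (dist_K M N (\<phi> n))) \<longlonglongrightarrow> 0)"
    if "\<And>n. \<phi> n \<in> Lip_inj_plus M N" "total_area N / total_area M \<le> 1/4" for \<phi> :: "nat \<Rightarrow> 'a \<Rightarrow> 'b"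
    unfolding L2_norm_def
    by (rule excess_tendsto_iff[OF V]) (use core[OF that(1)] part_b[OF that(1,2)] in \<open>auto intro!: integral_nonneg_AE\<close>)
  show ?thesis using part_a part_b part_c by blast
qed

end
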